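(* Let $m\ge 0$ and $n\ge 1$ be integers, and let $\mathcal{F}(u_0,\dots,u_m;v_0,\dots,v_n)$ be a function of $m+n+2$ complex variables belonging to the family $\mathscr{F}$ (defined in the context). Suppose that $$\mathcal{F}\big(\zeta(z),\zeta'(z),\dots,\zeta^{(m)}(z);\Gamma(z),\Gamma'(z),\dots,\Gamma^{(n)}(z)\big)=0$$ for all $z\in\mathbf{C}$ (at which $\zeta$ and $\Gamma$ are defined, i.e. away from their poles). Then $\mathcal{F}$ vanishes identically, i.e. $F_\lambda\equiv 0$ on $\mathbf{C}^{m+1}$ for every $\lambda\in\Lambda$.
   Context: $\zeta$ denotes the Riemann zeta-function and $\Gamma$ the Euler gamma-function. Let $\Lambda$ be a finite set of tuples $\lambda=(\lambda_0,\lambda_1,\dots,\lambda_n)$ of nonnegative integers. For $\lambda\in\Lambda$ put $|\lambda|:=\lambda_0+\lambda_1+\cdots+\lambda_n$ and $|\lambda|^\star:=\lambda_1+n\lambda_n$, and set $\Lambda_p:=\{\lambda\in\Lambda:|\lambda|=p\}$, $\Lambda^\star_q:=\{\lambda\in\Lambda:|\lambda|^\star=q\}$. The family $\mathscr{F}$ consists of all functions of the form $$\mathcal{F}(u_0,\dots,u_m;v_0,\dots,v_n)=\sum_{\lambda\in\Lambda}F_\lambda(u_0,\dots,u_m)\,v_0^{\lambda_0}v_1^{\lambda_1}\cdots v_n^{\lambda_n},$$ where $\Lambda$ is such a finite index set, each $F_\lambda:\mathbf{C}^{m+1}\to\mathbf{C}$ is continuous, and the following conditions hold: (i) for each fixed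 $p$, the entries $\lambda_2,\dots,\lambda_{n-1}$ of $\lambda\in\Lambda_p$ depend only on $|\lambda|^\star$ (i.e. if $\lambda,\mu\in\Lambda_p$ and $|\lambda|^\star=|\mu|^\star$ then $\lambda_j=\mu_j$ for $2\le j\le n-1$; $\lambda_1$ and $\lambda_n$ may vary); (ii) for each fixed $p$, the quantity $\chi(|\lambda|^\star):=2\lambda_2+3\lambda_3+\cdots+(n-1)\lambda_{n-1}$, regarded (by (i)) as a function of $q=|\lambda|^\star$ for $\lambda\in\Lambda_p$, is nondecreasing in $q$. *)

theory Defs
  imports "HOL-Analysis.Analysis"
begin

text \<open>The Riemann zeta function: the unique function holomorphic on the complex plane
  minus the point 1 that agrees with the Dirichlet series sum of k^(-s) (k >= 1) on the
  half-plane Re s > 1.  Its value at the pole s = 1 is fixed to 0 by convention only to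
  make the description unique; it plays no role below.\<close>
definition riemann_zeta :: "complex \<Rightarrow> complex" where
  "riemann_zeta = (THE f. f holomorphic_on (UNIV - {1}) \<and>
      (\<forall>s. 1 < Re s \<longrightarrow> (\<lambda>k. inverse (of_nat (Suc k) powr s)) sums f s) \<and> f 1 = 0)"

text \<open>Exponent tuples lambda = (lambda_0, ..., lambda_n) are functions nat => nat that vanish
  beyond n.\<close>
definition tup_abs :: "nat \<Rightarrow> (nat \<Rightarrow> nat) \<Rightarrow> nat" where
  "tup_abs n l = (\<Sum>j\<le>n. l j)"

definition tup_star :: "nat \<Rightarrow> (nat \<Rightarrow> nat) \<Rightarrow> nat" where
  "tup_star n l = l 1 + n * l n"

definition tup_chi :: "nat \<Rightarrow> (nat \<Rightarrow> nat) \<Rightarrow> nat" where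
  "tup_chi n l = (\<Sum>j\<in>{2..<n}. j * l j)"

definition in_family :: "nat \<Rightarrow> nat \<Rightarrow> (nat \<Rightarrow> nat) set
      \<Rightarrow> ((nat \<Rightarrow> nat) \<Rightarrow> (nat \<Rightarrow> complex) \<Rightarrow> complex) \<Rightarrow> bool" where
  "in_family m n Lam Fc \<longleftrightarrow>
     finite Lam \<and>
     (\<forall>l\<in>Lam. \<forall>j>n. l j = 0) \<and>
     (\<forall>l\<in>Lam. \<forall>u u'. (\<forall>j\<le>m. u j = u' j) \<longrightarrow> Fc l u = Fc l u') \<and>
     (\<forall>l\<in>Lam. continuous_on UNIV (Fc l)) \<and>
     (\<forall>l\<in>Lam. \<forall>\<mu>\<in>Lam. tup_abs n l = tup_abs n \<mu> \<and> tup_star n l = tup_star n \<mu>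
          \<longrightarrow> (\<forall>j\<in>{2..<n}. l j = \<mu> j)) \<and>
     (\<forall>l\<in>Lam. \<forall>\<mu>\<in>Lam. tup_abs n l = tup_abs n \<mu> \<and> tup_star n l \<le> tup_star n \<mu>
          \<longrightarrow> tup_chi n l \<le> tup_chi n \<mu>)"

definition family_eval :: "nat \<Rightarrow> (nat \<Rightarrow> nat) set
      \<Rightarrow> ((nat \<Rightarrow> nat) \<Rightarrow> (nat \<Rightarrow> complex) \<Rightarrow> complex) \<Rightarrow> (nat \<Rightarrow> complex) \<Rightarrow> (nat \<Rightarrow> complex) \<Rightarrow> complex" where
  "family_eval n Lam Fc u v = (\<Sum>l\<in>Lam. Fc l u * (\<Prod>i\<le>n. v i ^ l i))"

end

theory Submission
  imports Defs "HOL-Complex_Analysis.Complex_Analysis" "HOL-Computational_Algebra.Primes"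
begin

text \<open>
  In the strip \<open>1 < Re z \<le> 2\<close> as \<open>|Im z| \<rightarrow> \<infinity>\<close>, \<open>\<Gamma>(z)\<close> decays faster than every power of \<open>z\<close>, the digamma
  function \<open>\<psi>\<close> grows like \<open>log z\<close>, and \<open>\<Gamma>\<^sup>(\<^sup>i\<^sup>)/\<Gamma> = \<psi>\<^sup>i (1 + (i choose 2) \<psi>'/\<psi>\<^sup>2 + \<dots>)\<close>. With
  \<open>\<epsilon> = \<Gamma>\<^sup>(\<^sup>n\<^sup>)/(\<Gamma> \<psi>\<^sup>n) - 1\<close>, of size \<open>1/(|z| log\<^sup>2 |z|)\<close>, the monomial of \<open>\<lambda>\<close> equals
  \<open>\<Gamma>\<^sup>p \<psi>\<^sup>a (1 + \<epsilon>)\<^sup>k c\<close> where \<open>p = |\<lambda>|\<close>, \<open>a = \<Sum>i \<lambda>\<^sub>i = |\<lambda>|\<^sup>\<star> + \<chi>\<close>, \<open>k = \<lambda>\<^sub>n\<close>, and \<open>c \<rightarrow> 1\<close> depends only on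
  \<open>(p, a)\<close>. Conditions (i) and (ii) make \<open>\<lambda> \<mapsto> (p, a, k)\<close> injective. The quantities \<open>\<Gamma>\<close>, \<open>\<epsilon>\<close>, \<open>\<psi>\<close> live on
  different scales, so the coefficients are eliminated one after the other, provided that the vector
  \<open>(\<zeta>, \<zeta>', \<dots>, \<zeta>\<^sup>(\<^sup>m\<^sup>))\<close> comes close to every point at points of the strip with arbitrarily large imaginary part.

  This density does not need Voronin's theorem inside the critical strip, since the abscissa may vary: for
  \<open>Re s\<close> close to \<open>1\<close> from the right, divergence of \<open>\<Sum>1/p\<close> allows one to choose unimodular \<open>\<theta>\<^sub>p\<close> such that the
  sums \<open>\<Sum>\<theta>\<^sub>p (log p)\<^sup>j p\<^sup>-\<^sup>s\<close> take prescribed values, and Kronecker's theorem gives \<open>p\<^sup>-\<^sup>i\<^sup>t \<approx> \<theta>\<^sub>p\<close>.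
\<close>

subsection \<open>Analytic continuation of the zeta function\<close>

text \<open>Every \<Gamma>^(j) with j >= 2 deviates from \<Gamma> \<psi>^j by a relative correction
  of order 1/(z \<psi>^2), so corrections stemming from different j cannot be told apart by growth.
  Condition (i) removes this obstacle: for given p and a the entries of index 2 to n - 1 are the
  same in all competing monomials, and their corrections merge into the one factor c. What can still
  vary is the exchange of n factors \<Gamma>' for \<Gamma>^(n) \<Gamma>^(n-1), which changes neither
  p nor a. Only \<epsilon> detects it, and it does so because its leading constant, n choose 2, is
  nonzero for n >= 2. The coefficients are merely continuous, so they are tested by limits along
  points where the zeta jet approaches a given u. A coefficient can be read off only after those of
  all dominating monomials are known to vanish identically, not just at u; hence the elimination
  runs over all u at once and needs density at every u.\<close>

lemma norm_gbinomial_le: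
  fixes a :: complex
  assumes "norm a \<le> A"
  shows "norm (a gchoose k) \<le> pochhammer A k / fact k"
proof -
  have "norm (pochhammer (-a) k) = (\<Prod>i<k. norm (- a + of_nat i))"
    by (simp add: pochhammer_prod atLeast0LessThan prod_norm)
  also have "\<dots> \<le> (\<Prod>i<k. A + of_nat i)"
  proof (rule prod_mono, safe)
    fix i
    show "norm (- a + of_nat i) \<le> A + of_nat i"
      using norm_triangle_ineq[of "-a" "of_nat i"] assms by simp
  qed auto
  also have "\<dots> = pochhammer A k"
    by (simp add: pochhammer_prod atLeast0LessThan)
  finally show ?thesis
    by (simp add: gbinomial_pochhammer norm_mult norm_divide norm_power divide_right_mono)
qed

text \<open>Uniformity in \<open>a\<close> is the point: \<open>C\<close> depends on
  \<open>A\<close> and \<open>M\<close> only, so the bound holds on whole discs of s when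
  \<open>a\<close> is 1 - s.\<close>

lemma binomial_series_remainder:
  fixes A :: real
  assumes "A \<ge> 0"
  obtains C where "C \<ge> 0"
    "\<And>a x :: complex. norm a \<le> A \<Longrightarrow> norm x \<le> 1/2 \<Longrightarrow>
        norm ((1 + x) powr a - (\<Sum>k\<le>M. (a gchoose k) * x ^ k)) \<le> C * norm x ^ Suc M"
proof -
  define b where "b k = pochhammer A k / fact k * (1/2)^k" for k
  have b0: "b k \<ge> 0" for k
    unfolding b_def using assms by (intro mult_nonneg_nonneg divide_nonneg_nonneg) (auto simp: pochhammer_prod intro!: prod_nonneg)
  \<comment> \<open>The majorant \<open>b\<close> is the binomial series of (1 - 1/2) powr (-A),
    hence summable.\<close>
  have "(\<lambda>n. ((-A) gchoose n) * (-1/2)^n) sums (1 + (-1/2)) powr (-A)"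
    by (rule gen_binomial_real) auto
  also have "(\<lambda>n. ((-A) gchoose n) * (-1/2)^n) = b"
  proof
    fix n
    have e: "(- 1 :: real) ^ n * (-1/2)^n = (1/2)^n"
      by (simp flip: power_mult_distrib)
    have "((-A) gchoose n) * (-1/2)^n = ((- 1) ^ n * (-1/2)^n) * (pochhammer A n / fact n)"
      by (simp only: gbinomial_pochhammer minus_minus times_divide_eq_right times_divide_eq_left mult_ac)
    also have "\<dots> = b n"
      unfolding e b_def by simp
    finally show "((-A) gchoose n) * (-1/2)^n = b n" .
  qed
  finally have sb: "summable b"
    by (simp add: sums_iff)
  have sb': "summable (\<lambda>n. b (n + Suc M))"
    using sb summable_iff_shift by blast
  define C where "C = (\<Sum>n. b (n + Suc M)) * 2 ^ Suc M"
  have "C \<ge> 0"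
    unfolding C_def using b0 sb' by (intro mult_nonneg_nonneg suminf_nonneg) auto
  moreover have "norm ((1 + x) powr a - (\<Sum>k\<le>M. (a gchoose k) * x ^ k)) \<le> C * norm x ^ Suc M"
    if "norm a \<le> A" "norm x \<le> 1/2" for a x :: complex
  proof -
    have "(\<lambda>n. (a gchoose n) * x^n) sums (1 + x) powr a"
      by (rule gen_binomial_complex) (use that in auto)
    hence s: "(\<lambda>n. (a gchoose (n + Suc M)) * x^(n + Suc M)) sums
         ((1 + x) powr a - (\<Sum>k<Suc M. (a gchoose k) * x ^ k))"
      by (subst sums_iff_shift) auto
    have bd: "norm ((a gchoose (n + Suc M)) * x^(n + Suc M)) \<le> b (n + Suc M) * (2 ^ Suc M * norm x ^ Suc M)" for n
    proof -
      have "norm x ^ n \<le> (1/2)^n"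
        using that by (intro power_mono) auto
      hence "norm x ^ n * norm x ^ Suc M \<le> (1/2)^n * norm x ^ Suc M"
        by (intro mult_right_mono) auto
      also have "\<dots> = (1/2)^(n + Suc M) * (2 ^ Suc M * norm x ^ Suc M)"
        by (simp add: power_add power_divide)
      finally have 1: "norm x ^ (n + Suc M) \<le> (1/2)^(n + Suc M) * (2 ^ Suc M * norm x ^ Suc M)"
        by (simp only: power_add)
      have p0: "pochhammer A (n + Suc M) \<ge> 0"
        unfolding pochhammer_prod by (rule prod_nonneg) (use assms in auto)
      show ?thesis
        unfolding b_def norm_mult norm_power mult.assoc[of _ "(1/2)^_"]
        by (intro mult_mono norm_gbinomial_le that 1) (use p0 in auto)
    qed
    have s2: "summable (\<lambda>n. b (n + Suc M) * (2 ^ Suc M * norm x ^ Suc M))"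
      using sb' by (rule summable_mult2)
    have "norm ((1 + x) powr a - (\<Sum>k<Suc M. (a gchoose k) * x ^ k)) \<le>
        (\<Sum>n. b (n + Suc M) * (2 ^ Suc M * norm x ^ Suc M))"
      using norm_suminf_le[OF bd s2] s by (simp add: sums_iff)
    also have "\<dots> = C * norm x ^ Suc M"
      unfolding C_def by (subst suminf_mult2[OF sb', symmetric]) (simp add: mult_ac)
    finally show ?thesis
      by (simp add: lessThan_Suc_atMost)
  qed
  ultimately show ?thesis using that by blast
qed
text \<open>Weierstrass' theorem with local majorants. The last part, termwise differentiation,
  later identifies the derivatives of \<open>log_zeta\<close>.\<close>

lemma holomorphic_series:
  fixes f :: "nat \<Rightarrow> complex \<Rightarrow> complex"
  assumes S: "open S" and hol: "\<And>n. f n holomorphic_on S"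
    and bd: "\<And>x. x \<in> S \<Longrightarrow> \<exists>d h. 0 < d \<and> summable h \<and> (\<forall>\<^sub>F n in sequentially. \<forall>y\<in>ball x d \<inter> S. norm (f n y) \<le> h n)"
  shows "(\<lambda>x. \<Sum>n. f n x) holomorphic_on S"
    and "\<And>x. x \<in> S \<Longrightarrow> summable (\<lambda>n. f n x)"
    and "\<And>x. x \<in> S \<Longrightarrow> (\<lambda>n. deriv (f n) x) sums deriv (\<lambda>x. \<Sum>n. f n x) x"
proof -
  have "(f n has_field_derivative deriv (f n) x) (at x)" if "x \<in> S" for n x
    using hol S that holomorphic_derivI by blast
  from series_and_derivative_comparison_local[OF S this bd]
  obtain g g' where g: "\<And>x. x \<in> S \<Longrightarrow> (\<lambda>n. f n x) sums g x"
       "\<And>x. x \<in> S \<Longrightarrow> (\<lambda>n. deriv (f n) x) sums g' x"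
       "\<And>x. x \<in> S \<Longrightarrow> (g has_field_derivative g' x) (at x)"
    by blast
  have eq: "(\<Sum>n. f n x) = g x" if "x \<in> S" for x
    using g(1)[OF that] by (simp add: sums_iff)
  have der: "((\<lambda>x. \<Sum>n. f n x) has_field_derivative g' x) (at x)" if "x \<in> S" for x
    using g(3)[OF that] by (rule has_field_derivative_transform_within_open[OF _ S that]) (simp add: eq)
  show "(\<lambda>x. \<Sum>n. f n x) holomorphic_on S"
    using der S by (auto simp: holomorphic_on_open)
  show "summable (\<lambda>n. f n x)" if "x \<in> S" for x
    using g(1)[OF that] by (simp add: sums_iff)
  show "(\<lambda>n. deriv (f n) x) sums deriv (\<lambda>x. \<Sum>n. f n x) x" if "x \<in> S" for x
    using g(2)[OF that] DERIV_imp_deriv[OF der[OF that]] by simp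
qed

text \<open>The continuation rests on the telescoping series \<open>\<Sum>\<^sub>N ((N+1)\<^sup>1\<^sup>-\<^sup>s - N\<^sup>1\<^sup>-\<^sup>s) = -1\<close>: expanding the summand in powers
  of \<open>1/N\<close> expresses \<open>(s - 1) \<zeta>(s)\<close> by \<open>\<zeta>(s + 1)\<close>, \<open>\<zeta>(s + 2)\<close>, \<open>\<dots>\<close> and a remainder that converges
  further to the left.\<close>

definition zeta_taylor_rem :: "nat \<Rightarrow> nat \<Rightarrow> complex \<Rightarrow> complex" where
  "zeta_taylor_rem M n s = of_nat (Suc (Suc n)) powr (1 - s) -
     (\<Sum>k\<le>M. ((1 - s) gchoose k) * of_nat (Suc n) powr (1 - s - of_nat k))"

text \<open>With N = n + 1, factoring out N powr (1 - s) leaves the binomial remainder at x = 1/N,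
  and n >= 1 keeps x <= 1/2. The exponent is (1 - Re s) - (M + 1).\<close>

lemma zeta_taylor_rem_bound:
  assumes "A \<ge> 0"
  obtains C where "C \<ge> 0"
    "\<And>n s. norm (1 - s) \<le> A \<Longrightarrow> n \<ge> 1 \<Longrightarrow>
        norm (zeta_taylor_rem M n s) \<le> C * real (Suc n) powr (- Re s - real M)"
proof -
  obtain C where C: "C \<ge> 0"
    "\<And>a x :: complex. norm a \<le> A \<Longrightarrow> norm x \<le> 1/2 \<Longrightarrow>
        norm ((1 + x) powr a - (\<Sum>k\<le>M. (a gchoose k) * x ^ k)) \<le> C * norm x ^ Suc M"
    using binomial_series_remainder[OF assms] by metis
  show ?thesis
  proof (rule that[OF C(1)])
    fix n and s :: complex assume s: "norm (1 - s) \<le> A" and n: "n \<ge> (1::nat)"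
    define N where "N = real (Suc n)"
    have N: "N \<ge> 2" using n by (simp add: N_def)
    define x :: complex where "x = of_real (1 / N)"
    have x: "norm x \<le> 1/2" "norm x = 1 / N" using N by (simp_all add: x_def norm_divide field_simps)
    have c: "complex_of_nat (Suc n) = of_real N" "complex_of_nat (Suc (Suc n)) = of_real (N + 1)"
      by (simp_all add: N_def)
    have "N + 1 = N * (1 + 1/N)"
      using N by (simp add: field_simps)
    hence "of_real (N + 1) powr (1 - s) = of_real (N * (1 + 1/N)) powr (1 - s)"
      by presburger
    also have "\<dots> = of_real N powr (1 - s) * of_real (1 + 1/N) powr (1 - s)"
      unfolding of_real_mult using N by (intro powr_times_real) auto
    also have "complex_of_real (1 + 1 / N) = 1 + x" by (simp add: x_def)
    finally have 1: "of_real (N + 1) powr (1 - s) = of_real N powr (1 - s) * (1 + x) powr (1 - s)" .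
    have 2: "of_real N powr (1 - s - of_nat k) = of_real N powr (1 - s) * x ^ k" for k
      using N by (simp add: powr_diff x_def powr_nat' power_divide)
    have "zeta_taylor_rem M n s = of_real N powr (1 - s) * ((1 + x) powr (1 - s) - (\<Sum>k\<le>M. ((1 - s) gchoose k) * x ^ k))"
      unfolding zeta_taylor_rem_def c 1 2 by (simp add: algebra_simps sum_distrib_left)
    also have "norm \<dots> \<le> N powr (1 - Re s) * (C * norm x ^ Suc M)"
      unfolding norm_mult using N
      by (intro mult_mono C s x(1)) (simp_all add: norm_powr_real_powr)
    also have "\<dots> = C * N powr (- Re s - real M)"
    proof -
      have "norm x ^ Suc M = N powr (- real (Suc M))"
        using N x(2) by (simp add: powr_minus powr_realpow power_divide inverse_eq_divide del: of_nat_Suc power_Suc)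
      thus ?thesis using N by (simp add: powr_add[symmetric] algebra_simps)
    qed
    finally show "norm (zeta_taylor_rem M n s) \<le> C * real (Suc n) powr (- Re s - real M)"
      by (simp add: N_def)
  qed
qed

lemma ball_locally:
  fixes s :: complex
  assumes "c < Re s"
  obtains d e where "d > 0" "e > c" "\<And>y. y \<in> ball s d \<Longrightarrow> Re y \<ge> e"
proof (rule that[of "(Re s - c)/2" "(Re s + c)/2"])
  fix y assume "y \<in> ball s ((Re s - c) / 2)"
  moreover have "\<bar>Re s - Re y\<bar> \<le> dist s y"
    using abs_Re_le_cmod[of "s - y"] by (simp add: dist_norm)
  ultimately show "(Re s + c)/2 \<le> Re y" by (simp add: field_simps)
qed (use assms in auto)

lemma summable_Suc_powr: "e < -1 \<Longrightarrow> summable (\<lambda>n. real (Suc n) powr e)"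
  using summable_iff_shift[of "\<lambda>n. real n powr e" 1] summable_real_powr_iff[of e] by simp

text \<open>The exponent -Re s - M of the termwise bound is below -1 precisely on this half-plane,
  which moves left by one with each further Taylor term.\<close>

lemma zeta_taylor_rem_series:
  fixes M :: nat
  defines "S \<equiv> {s. Re s > 1 - real M}"
  shows "(\<lambda>s. \<Sum>n. zeta_taylor_rem M n s) holomorphic_on S"
    and "\<And>s. s \<in> S \<Longrightarrow> summable (\<lambda>n. zeta_taylor_rem M n s)"
proof -
  have S: "open S" unfolding S_def by (simp add: open_halfspace_Re_gt)
  have hol: "zeta_taylor_rem M n holomorphic_on S" for n
    unfolding zeta_taylor_rem_def gbinomial_pochhammer pochhammer_prod
    by (intro holomorphic_intros) auto
  have bd: "\<exists>d h. 0 < d \<and> summable h \<and> (\<forall>\<^sub>F n in sequentially. \<forall>y\<in>ball x d \<inter> S. norm (zeta_taylor_rem M n y) \<le> h n)"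
    if "x \<in> S" for x
  proof -
    have "1 - real M < Re x" using that by (simp add: S_def)
    from ball_locally[OF this]
    obtain d e where d: "d > 0" "e > 1 - real M" "\<And>y. y \<in> ball x d \<Longrightarrow> Re y \<ge> e"
      by metis
    define A where "A = norm (1 - x) + d"
    have A: "norm (1 - y) \<le> A" if "y \<in> ball x d" for y
      using norm_triangle_ineq[of "1 - x" "x - y"] that by (simp add: A_def dist_norm)
    have "A \<ge> 0" using d by (simp add: A_def)
    then obtain C where C: "C \<ge> 0" "\<And>n s. norm (1 - s) \<le> A \<Longrightarrow> n \<ge> 1 \<Longrightarrow>
        norm (zeta_taylor_rem M n s) \<le> C * real (Suc n) powr (- Re s - real M)"
      using zeta_taylor_rem_bound[of A M] by metis
    have "\<forall>\<^sub>F n in sequentially. \<forall>y\<in>ball x d \<inter> S. norm (zeta_taylor_rem M n y) \<le> C * real (Suc n) powr (- e - real M)"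
      using eventually_ge_at_top[of 1]
    proof eventually_elim
      case (elim n)
      show ?case
      proof
        fix y assume y: "y \<in> ball x d \<inter> S"
        have "norm (zeta_taylor_rem M n y) \<le> C * real (Suc n) powr (- Re y - real M)"
          using y elim by (intro C A) auto
        also have "\<dots> \<le> C * real (Suc n) powr (- e - real M)"
          using d(3)[of y] y C(1) by (intro mult_left_mono powr_mono) auto
        finally show "norm (zeta_taylor_rem M n y) \<le> C * real (Suc n) powr (- e - real M)" .
      qed
    qed
    moreover have "summable (\<lambda>n. C * real (Suc n) powr (- e - real M))"
      using d by (intro summable_mult summable_Suc_powr) auto
    ultimately show ?thesis using d(1) by blast
  qed
  show "(\<lambda>s. \<Sum>n. zeta_taylor_rem M n s) holomorphic_on S"
    and "\<And>s. s \<in> S \<Longrightarrow> summable (\<lambda>n. zeta_taylor_rem M n s)"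
    using holomorphic_series[OF S hol bd] by blast+
qed

section \<open>The Dirichlet series, its recurrence and the continuation\<close>

definition zeta_series :: "complex \<Rightarrow> complex" where
  "zeta_series s = (\<Sum>n. of_nat (Suc n) powr (- s))"

lemma norm_Suc_powr: "norm (of_nat (Suc n) powr (- s) :: complex) = real (Suc n) powr (- Re s)"
  by (subst of_real_of_nat_eq[symmetric], subst norm_powr_real_powr) auto

lemma
  shows holomorphic_zeta_series: "zeta_series holomorphic_on {s. Re s > 1}"
    and summable_zeta_series: "\<And>s. Re s > 1 \<Longrightarrow> summable (\<lambda>n. of_nat (Suc n) powr (- s) :: complex)"
proof -
  let ?S = "{s :: complex. Re s > 1}"
  have S: "open ?S" by (simp add: open_halfspace_Re_gt)
  have bd: "\<exists>d h. 0 < d \<and> summable h \<and> (\<forall>\<^sub>F n in sequentially. \<forall>y\<in>ball x d \<inter> ?S. norm (of_nat (Suc n) powr (- y) :: complex) \<le> h n)"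
    if "x \<in> ?S" for x
  proof -
    obtain d e where d: "d > 0" "e > 1" "\<And>y. y \<in> ball x d \<Longrightarrow> Re y \<ge> e"
      using ball_locally[of 1 x] \<open>x \<in> ?S\<close> by blast
    have "summable (\<lambda>n. real (Suc n) powr (- e))"
      using d by (intro summable_Suc_powr) auto
    moreover have "norm (of_nat (Suc n) powr (- y) :: complex) \<le> real (Suc n) powr (- e)" if "y \<in> ball x d" for y n
      unfolding norm_Suc_powr using d(3)[OF that] by (intro powr_mono) auto
    ultimately show ?thesis using d(1) by (intro exI[of _ d] exI) auto
  qed
  have hol: "(\<lambda>s. of_nat (Suc n) powr (- s) :: complex) holomorphic_on ?S" for n
    by (intro holomorphic_intros) (auto simp del: of_nat_Suc)
  show "zeta_series holomorphic_on {s. Re s > 1}"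
    and "\<And>s. Re s > 1 \<Longrightarrow> summable (\<lambda>n. of_nat (Suc n) powr (- s) :: complex)"
    using holomorphic_series[OF S hol bd] unfolding zeta_series_def by blast+
qed

text \<open>The factor \<open>s + k - 1\<close> split off here cancels the pole of \<open>\<zeta>(s + k)\<close> at \<open>s = 1 - k\<close>.\<close>

lemma gbinomial_mult_factor:
  fixes s :: complex
  shows "((1 - s) gchoose Suc k) * z = - (((1 - s) gchoose k) / of_nat (Suc k)) * ((s + of_nat k - 1) * z)"
  by (simp add: gbinomial_Suc prod.lessThan_Suc gbinomial_prod_rev atLeast0LessThan divide_simps
      flip: atLeastLessThanSuc_atLeastAtMost) (simp add: algebra_simps)

text \<open>After the index shift the term k = 0 is (1 - s) zeta(s), which is moved to the left;
  only arguments s + k with k >= 1 remain on the right.\<close>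

lemma zeta_series_recurrence:
  assumes s: "Re s > 1"
  shows "(s - 1) * zeta_series s = 1 - (\<Sum>k\<in>{1..M}. ((1 - s) gchoose k) / of_nat (Suc k) *
      ((s + of_nat k - 1) * zeta_series (s + of_nat k))) + (\<Sum>n. zeta_taylor_rem (Suc M) n s)"
proof -
  have R: "summable (\<lambda>n. zeta_taylor_rem (Suc M) n s)"
    using zeta_taylor_rem_series(2)[of s "Suc M"] s by simp
  have trm: "(\<lambda>n. ((1 - s) gchoose Suc k) * of_nat (Suc n) powr (1 - s - of_nat (Suc k))) sums
      (((1 - s) gchoose Suc k) * zeta_series (s + of_nat k))" for k
  proof -
    have "(\<lambda>n. of_nat (Suc n) powr (- (s + of_nat k)) :: complex) sums zeta_series (s + of_nat k)"
      unfolding zeta_series_def by (intro summable_sums summable_zeta_series) (use s in auto)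
    moreover have "- (s + of_nat k) = 1 - s - of_nat (Suc k)" by simp
    ultimately show ?thesis by (simp only: sums_mult)
  qed
  have "(\<lambda>n. (\<Sum>k\<le>M. ((1 - s) gchoose Suc k) * of_nat (Suc n) powr (1 - s - of_nat (Suc k))) +
       zeta_taylor_rem (Suc M) n s) sums
       ((\<Sum>k\<le>M. ((1 - s) gchoose Suc k) * zeta_series (s + of_nat k)) + (\<Sum>n. zeta_taylor_rem (Suc M) n s))"
    by (intro sums_add sums_sum trm summable_sums R)
  also have "(\<lambda>n. (\<Sum>k\<le>M. ((1 - s) gchoose Suc k) * of_nat (Suc n) powr (1 - s - of_nat (Suc k))) +
       zeta_taylor_rem (Suc M) n s) = (\<lambda>n. of_nat (Suc (Suc n)) powr (1 - s) - of_nat (Suc n) powr (1 - s))"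
    unfolding zeta_taylor_rem_def
    by (simp add: sum.atMost_Suc_shift del: of_nat_Suc sum.atMost_Suc)
  finally have 1: "(\<lambda>n. of_nat (Suc (Suc n)) powr (1 - s) - of_nat (Suc n) powr (1 - s)) sums
      ((\<Sum>k\<le>M. ((1 - s) gchoose Suc k) * zeta_series (s + of_nat k)) + (\<Sum>n. zeta_taylor_rem (Suc M) n s))" .
  have "(\<lambda>n. of_nat (Suc (Suc n)) powr (1 - s) - of_nat (Suc n) powr (1 - s)) sums (0 - of_nat (Suc 0) powr (1 - s))"
  proof (rule telescope_sums)
    have "(\<lambda>n. real (Suc n) powr (1 - Re s)) \<longlonglongrightarrow> 0"
      by (intro tendsto_neg_powr filterlim_compose[OF filterlim_real_sequentially filterlim_Suc]) (use s in auto)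
    moreover have "norm (of_nat (Suc n) powr (1 - s) :: complex) = real (Suc n) powr (1 - Re s)" for n
      using norm_Suc_powr[of n "s - 1"] by simp
    ultimately show "(\<lambda>n. of_nat (Suc n) powr (1 - s) :: complex) \<longlonglongrightarrow> 0"
      by (intro tendsto_norm_zero_cancel[of "\<lambda>n. of_nat (Suc n) powr (1 - s)"]) simp
  qed
  from sums_unique2[OF 1 this]
  have "(\<Sum>k\<le>M. ((1 - s) gchoose Suc k) * zeta_series (s + of_nat k)) = - 1 - (\<Sum>n. zeta_taylor_rem (Suc M) n s)"
    by (simp add: eq_diff_eq)
  moreover have "(\<Sum>k\<le>M. ((1 - s) gchoose Suc k) * zeta_series (s + of_nat k)) =
      (1 - s) * zeta_series s + (\<Sum>k\<in>{1..M}. ((1 - s) gchoose Suc k) * zeta_series (s + of_nat k))"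
    by (simp add: atMost_atLeast0 sum.atLeast_Suc_atMost)
  moreover have "(\<Sum>k\<in>{1..M}. ((1 - s) gchoose Suc k) * zeta_series (s + of_nat k)) =
      - (\<Sum>k\<in>{1..M}. ((1 - s) gchoose k) / of_nat (Suc k) * ((s + of_nat k - 1) * zeta_series (s + of_nat k)))"
    unfolding gbinomial_mult_factor by (simp add: sum_negf)
  moreover have "(s - 1) * z = 1 - d + r" if "a = - 1 - r" "a = (1 - s) * z + c" "c = - d" for a c d r z
    using that by algebra
  ultimately show ?thesis by blast
qed

text \<open>Each step gains a strip of width one: for Re s > -K the points s + k with k >= 1 lie in
  the half-plane already reached, and the remainder of order K + 1 converges. Continuing (s - 1)
  zeta(s) instead of zeta(s) avoids the pole throughout.\<close>

lemma zeta_continuation_step: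
  "\<exists>g. g holomorphic_on {s. Re s > 1 - real K} \<and> (\<forall>s. Re s > 1 \<longrightarrow> g s = (s - 1) * zeta_series s)"
proof (induction K)
  case 0
  show ?case
    by (rule exI[of _ "\<lambda>s. (s - 1) * zeta_series s"]) (auto intro!: holomorphic_intros holomorphic_zeta_series)
next
  case (Suc K)
  then obtain g where g: "g holomorphic_on {s. Re s > 1 - real K}" "\<And>s. Re s > 1 \<Longrightarrow> g s = (s - 1) * zeta_series s"
    by blast
  define h where "h s = 1 - (\<Sum>k\<in>{1..K}. ((1 - s) gchoose k) / of_nat (Suc k) * g (s + of_nat k))
     + (\<Sum>n. zeta_taylor_rem (Suc K) n s)" for s
  have "h holomorphic_on {s. Re s > 1 - real (Suc K)}"
  proof -
    have "(\<lambda>s. g (s + of_nat k)) holomorphic_on {s. Re s > 1 - real (Suc K)}" if "k \<in> {1..K}" for k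
    proof -
      have "(g \<circ> (\<lambda>s. s + of_nat k)) holomorphic_on {s. Re s > 1 - real (Suc K)}"
        using that by (intro holomorphic_on_compose_gen[OF _ g(1)] holomorphic_intros) auto
      thus ?thesis by (simp add: o_def)
    qed
    thus ?thesis
      unfolding h_def gbinomial_pochhammer pochhammer_prod
      by (intro holomorphic_intros zeta_taylor_rem_series(1)) (auto simp del: of_nat_Suc)
  qed
  moreover have "h s = (s - 1) * zeta_series s" if "Re s > 1" for s
    unfolding zeta_series_recurrence[OF that, of K] h_def using that
    by (auto intro!: sum.cong simp: g(2) algebra_simps)
  ultimately show ?case by blast
qed

lemma zeta_continuation:
  obtains f where "f holomorphic_on (UNIV - {1})" "\<And>s. Re s > 1 \<Longrightarrow> f s = zeta_series s" "f 1 = 0"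
proof -
  define H where "H K = {s. Re s > 1 - real K}" for K
  have opH: "open (H K)" for K by (simp add: H_def open_halfspace_Re_gt)
  from zeta_continuation_step obtain g where g: "\<And>K. g K holomorphic_on H K"
       "\<And>K s. Re s > 1 \<Longrightarrow> g K s = (s - 1) * zeta_series s"
    unfolding H_def by metis
  have eq: "g K s = g L s" if "K \<le> L" "s \<in> H K" for K L s
  proof (rule analytic_continuation_open[of "{s. Re s > 1}" "H K" "g K" "g L"])
    show "connected (H K)"
      unfolding H_def by (intro convex_connected convex_halfspace_Re_gt)
    have "complex_of_real 2 \<in> {s. Re s > 1}" by simp
    thus "{s. Re s > 1} \<noteq> {}" by blast
    show "g L holomorphic_on H K"
      by (rule holomorphic_on_subset[OF g(1)]) (use that in \<open>auto simp: H_def\<close>)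
    show "g K holomorphic_on H K" by (rule g(1))
    show "{s. Re s > 1} \<subseteq> H K" by (auto simp: H_def)
  qed (use that opH in \<open>auto simp: g open_halfspace_Re_gt\<close>)
  \<comment> \<open>Any K with 1 - K < Re s would do, since two of the functions \<open>g K\<close>
    agree wherever both are holomorphic.\<close>
  define k where "k s = nat \<lceil>2 - Re s\<rceil>" for s :: complex
  have k: "s \<in> H (k s)" for s
    unfolding H_def k_def by simp linarith
  define G where "G s = g (k s) s" for s
  have G_eq: "G s = g K s" if "s \<in> H K" for s K
  proof (cases "K \<le> k s")
    case True
    thus ?thesis using eq[OF True that] by (simp add: G_def)
  next
    case False
    thus ?thesis using eq[of "k s" K s] k by (simp add: G_def)
  qed
  have hol: "G holomorphic_on UNIV"
  proof -
    have "G field_differentiable at s" for s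
    proof -
      have "g (k s) field_differentiable at s"
        using g(1) opH k by (metis holomorphic_on_imp_differentiable_at)
      thus ?thesis
        unfolding field_differentiable_def
        by (metis has_field_derivative_transform_within_open opH k G_eq)
    qed
    thus ?thesis by (simp add: holomorphic_on_def field_differentiable_at_within)
  qed
  show ?thesis
  proof (rule that[of "\<lambda>s. if s = 1 then 0 else G s / (s - 1)"])
    have "(\<lambda>s. G s / (s - 1)) holomorphic_on (UNIV - {1})"
      by (intro holomorphic_intros holomorphic_on_subset[OF hol]) auto
    thus "(\<lambda>s. if s = 1 then 0 else G s / (s - 1)) holomorphic_on (UNIV - {1})"
      by (rule holomorphic_transform) auto
  next
    fix s :: complex assume s: "Re s > 1"
    have "G s = (s - 1) * zeta_series s"
      using G_eq[of s 0] g(2)[OF s] s by (simp add: H_def)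
    thus "(if s = 1 then 0 else G s / (s - 1)) = zeta_series s" using s by auto
  qed auto
qed

text \<open>\<open>riemann_zeta\<close> is a definite description over the punctured plane, so even
  its values for Re s > 1 become accessible only after existence (\<open>zeta_continuation\<close>)
  and uniqueness (identity theorem on a connected set).\<close>

lemma riemann_zeta_eq_series:
  assumes "Re s > 1"
  shows "riemann_zeta s = zeta_series s"
proof -
  let ?P = "\<lambda>f. f holomorphic_on (UNIV - {1}) \<and>
      (\<forall>s. 1 < Re s \<longrightarrow> (\<lambda>k. inverse (of_nat (Suc k) powr s)) sums f s) \<and> f 1 = 0"
  have sums: "(\<lambda>k. inverse (of_nat (Suc k) powr s)) sums w \<longleftrightarrow> w = zeta_series s" if "Re s > 1" for s w :: complex
    using summable_zeta_series[OF that] unfolding zeta_series_def powr_minus by (auto simp: sums_iff)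
  obtain f where f: "f holomorphic_on (UNIV - {1})" "\<And>s. Re s > 1 \<Longrightarrow> f s = zeta_series s" "f 1 = 0"
    using zeta_continuation by metis
  have "?P riemann_zeta"
    unfolding riemann_zeta_def
  proof (rule theI[of ?P f])
    show "?P f" using f sums by auto
    fix h assume h: "?P h"
    show "h = f"
    proof
      fix z
      show "h z = f z"
      proof (cases "z = 1")
        case False
        show ?thesis
        proof (rule analytic_continuation_open[of "{s. Re s > 1}" "UNIV - {1}" h f])
          have "complex_of_real 2 \<in> {s. Re s > 1}" by simp
          thus "{s. Re s > 1} \<noteq> {}" by blast
          show "connected (UNIV - {1 :: complex})"
            by (intro connected_open_delete) auto
          fix z :: complex assume "z \<in> {s. Re s > 1}"
          thus "h z = f z" using h f(2)[of z] sums[of z "h z"] by auto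
        qed (use h f False in \<open>auto simp: open_halfspace_Re_gt\<close>)
      qed (use h f in auto)
    qed
  qed
  thus ?thesis using sums[OF assms] assms by blast
qed

subsection \<open>Enumeration of the primes\<close>

text \<open>Numbering from index 0, where the prime is 2, turns sums over primes into ordinary
  series and places neighbouring primes at 2 i and 2 i + 1.\<close>

definition nth_prime :: "nat \<Rightarrow> nat" where
  "nth_prime = enumerate {p. prime p}"

lemma prime_nth_prime [simp]: "prime (nth_prime k)"
  using enumerate_in_set[OF primes_infinite, of k] by (simp add: nth_prime_def)

lemma strict_mono_nth_prime: "strict_mono nth_prime"
  by (simp add: strict_mono_def nth_prime_def enumerate_mono primes_infinite)

lemma nth_prime_less_iff [simp]: "nth_prime i < nth_prime j \<longleftrightarrow> i < j"
  by (simp add: strict_mono_less strict_mono_nth_prime)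

lemma nth_prime_le_iff [simp]: "nth_prime i \<le> nth_prime j \<longleftrightarrow> i \<le> j"
  by (simp add: strict_mono_less_eq strict_mono_nth_prime)

lemma nth_prime_eq_iff [simp]: "nth_prime i = nth_prime j \<longleftrightarrow> i = j"
  by (simp add: strict_mono_eq strict_mono_nth_prime)

lemma ex_nth_prime:
  assumes "prime p"
  obtains k where "p = nth_prime k"
  using enumerate_Ex[of "{p. prime p}" p] assms by (auto simp: nth_prime_def primes_infinite)

lemma nth_prime_ge: "nth_prime k \<ge> Suc (Suc k)"
proof (induction k)
  case (Suc k)
  have "nth_prime k < nth_prime (Suc k)" by simp
  with Suc show ?case by linarith
qed (simp add: prime_ge_2_nat numeral_2_eq_2[symmetric])

lemma nth_prime_ge_2: "nth_prime k \<ge> 2"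
  by (simp add: prime_ge_2_nat)

lemma nth_prime_neq [simp]: "nth_prime k \<noteq> 0" "nth_prime k \<noteq> Suc 0" "nth_prime k > 0"
  using nth_prime_ge_2[of k] by auto

definition ppow :: "nat \<Rightarrow> complex \<Rightarrow> complex" where
  "ppow k s = of_nat (nth_prime k) powr (- s)"

lemma norm_ppow: "norm (ppow k s) = real (nth_prime k) powr (- Re s)"
  unfolding ppow_def by (subst of_real_of_nat_eq[symmetric], subst norm_powr_real_powr) auto

lemma norm_ppow_le_half: "Re s \<ge> 1 \<Longrightarrow> norm (ppow k s) \<le> 1 / 2"
proof -
  assume s: "Re s \<ge> 1"
  have "norm (ppow k s) \<le> real (nth_prime k) powr (- 1)"
    unfolding norm_ppow using s nth_prime_ge_2[of k] by (intro powr_mono) auto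
  also have "\<dots> \<le> 1 / 2"
    using nth_prime_ge_2[of k] by (simp add: powr_minus field_simps)
  finally show ?thesis .
qed

subsection \<open>Euler product\<close>

text \<open>The sieve of Eratosthenes: raising K by one removes one Euler factor from the sum of
  n^(-s), and 1 is the only number that survives all stages.\<close>

definition sieve :: "nat \<Rightarrow> nat set" where
  "sieve K = {n. n \<ge> 1 \<and> (\<forall>k<K. \<not> nth_prime k dvd n)}"

lemma of_nat_powr_summable_on:
  assumes "Re s > 1"
  shows "(\<lambda>n. norm (of_nat n powr (- s) :: complex)) summable_on A"
    and "(\<lambda>n. of_nat n powr (- s) :: complex) summable_on A"
proof -
  have n: "norm (of_nat n powr (- s) :: complex) = real n powr (- Re s)" for n
    by (subst of_real_of_nat_eq[symmetric], subst norm_powr_real_powr) auto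
  have "summable (\<lambda>n. norm (of_nat n powr (- s) :: complex))"
    unfolding n using assms by (simp add: summable_real_powr_iff)
  hence "(\<lambda>n. norm (of_nat n powr (- s) :: complex)) summable_on UNIV"
    by (subst summable_on_UNIV_nonneg_real_iff) auto
  thus 1: "(\<lambda>n. norm (of_nat n powr (- s) :: complex)) summable_on A"
    by (rule summable_on_subset) auto
  thus "(\<lambda>n. of_nat n powr (- s) :: complex) summable_on A"
    by (rule abs_summable_summable)
qed

lemma zeta_series_infsum:
  assumes "Re s > 1"
  shows "zeta_series s = infsum (\<lambda>n. of_nat n powr (- s)) (sieve 0)"
proof -
  have bij: "bij_betw Suc UNIV (sieve 0)"
    by (auto simp: bij_betw_def sieve_def image_iff intro: Suc_le_D)
  have "((\<lambda>n. of_nat n powr (- s) :: complex) has_sum infsum (\<lambda>n. of_nat n powr (- s)) (sieve 0)) (sieve 0)"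
    by (intro has_sum_infsum of_nat_powr_summable_on assms)
  hence "((\<lambda>n. of_nat (Suc n) powr (- s) :: complex) has_sum infsum (\<lambda>n. of_nat n powr (- s)) (sieve 0)) UNIV"
    using has_sum_reindex_bij_betw[OF bij, of "\<lambda>n. of_nat n powr (- s) :: complex"] by simp
  from has_sum_imp_sums[OF this] show ?thesis
    by (simp add: zeta_series_def sums_iff)
qed

text \<open>Multiplying by the prime of index K introduces no earlier prime factor, and dividing by
  it violates no sieve condition.\<close>

lemma sieve_Suc:
  "sieve K = sieve (Suc K) \<union> (\<lambda>n. nth_prime K * n) ` sieve K"
  "sieve (Suc K) \<inter> (\<lambda>n. nth_prime K * n) ` sieve K = {}"
proof -
  have ndvd: "\<not> nth_prime k dvd nth_prime K" if "k < K" for k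
    using that by (metis nat_neq_iff nth_prime_eq_iff prime_nth_prime primes_dvd_imp_eq)
  show "sieve K = sieve (Suc K) \<union> (\<lambda>n. nth_prime K * n) ` sieve K"
  proof (intro equalityI subsetI)
    fix n assume n: "n \<in> sieve K"
    show "n \<in> sieve (Suc K) \<union> (\<lambda>n. nth_prime K * n) ` sieve K"
    proof (cases "nth_prime K dvd n")
      case True
      then obtain m where m: "n = nth_prime K * m" by blast
      have "m \<in> sieve K" using n unfolding m by (auto simp: sieve_def)
      thus ?thesis using m by blast
    next
      case False
      thus ?thesis using n by (auto simp: sieve_def less_Suc_eq)
    qed
  next
    fix n assume "n \<in> sieve (Suc K) \<union> (\<lambda>n. nth_prime K * n) ` sieve K"
    thus "n \<in> sieve K"
      using ndvd by (auto simp: sieve_def less_Suc_eq prime_dvd_mult_iff prime_gt_0_nat Suc_le_eq)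
  qed
  show "sieve (Suc K) \<inter> (\<lambda>n. nth_prime K * n) ` sieve K = {}"
    by (auto simp: sieve_def)
qed

text \<open>Splitting along \<open>sieve_Suc\<close> and pulling p^(-s) out of the multiples gives
  S_K = S_(K+1) + p^(-s) S_K, where p is the prime of index K.\<close>

lemma infsum_sieve_Suc:
  assumes "Re s > 1"
  shows "infsum (\<lambda>n. of_nat n powr (- s)) (sieve (Suc K)) =
         (1 - ppow K s) * infsum (\<lambda>n. of_nat n powr (- s)) (sieve K)"
proof -
  let ?f = "\<lambda>n. of_nat n powr (- s) :: complex"
  let ?h = "\<lambda>n. nth_prime K * n"
  have "infsum ?f (sieve K) = infsum ?f (sieve (Suc K)) + infsum ?f (?h ` sieve K)"
    by (subst sieve_Suc(1), rule infsum_Un_disjoint)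
       (intro of_nat_powr_summable_on assms sieve_Suc(2))+
  also have "infsum ?f (?h ` sieve K) = infsum (?f \<circ> ?h) (sieve K)"
    by (rule infsum_reindex) (auto simp: inj_on_def)
  also have "?f \<circ> ?h = (\<lambda>n. ppow K s * ?f n)"
  proof
    fix n
    have "of_real (real (nth_prime K) * real n) powr (- s) = of_real (real (nth_prime K)) powr (- s) * of_real (real n) powr (- s)"
      unfolding of_real_mult by (intro powr_times_real) auto
    thus "(?f \<circ> ?h) n = ppow K s * ?f n" by (simp add: ppow_def)
  qed
  also have "infsum (\<lambda>n. ppow K s * ?f n) (sieve K) = ppow K s * infsum ?f (sieve K)"
    by (rule infsum_cmult_right')
  finally show ?thesis by (simp add: algebra_simps)
qed

lemma infsum_sieve_prod:
  assumes "Re s > 1"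
  shows "infsum (\<lambda>n. of_nat n powr (- s)) (sieve K) = zeta_series s * (\<Prod>k<K. 1 - ppow k s)"
  by (induction K) (use assms in \<open>auto simp: zeta_series_infsum infsum_sieve_Suc mult_ac\<close>)

lemma sieve_ge:
  assumes "n \<in> sieve K" "n \<noteq> Suc 0"
  shows "n \<ge> K"
proof -
  from assms obtain p where p: "prime p" "p dvd n"
    using prime_factor_nat[of n] by auto
  obtain k where k: "p = nth_prime k" using ex_nth_prime[OF p(1)] .
  with p assms have "k \<ge> K" by (auto simp: sieve_def not_less[symmetric])
  moreover have "n \<ge> p" using p assms by (auto simp: sieve_def dvd_imp_le)
  ultimately show ?thesis using nth_prime_ge[of k] k by linarith
qed

text \<open>Apart from 1 the sieve contains only n >= K, so the distance to 1 is at most a tail of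
  an absolutely convergent series.\<close>

lemma infsum_sieve_tendsto:
  assumes "Re s > 1"
  shows "(\<lambda>K. infsum (\<lambda>n. of_nat n powr (- s) :: complex) (sieve K)) \<longlonglongrightarrow> 1"
proof -
  let ?f = "\<lambda>n. of_nat n powr (- s) :: complex"
  let ?g = "\<lambda>n. norm (?f n)"
  let ?t = "\<lambda>K. infsum ?g UNIV - sum ?g {..<K}"
  note sm = of_nat_powr_summable_on[OF assms]
  have "(?g has_sum infsum ?g UNIV) UNIV"
    by (intro has_sum_infsum sm)
  hence "(\<lambda>K. sum ?g {..<K}) \<longlonglongrightarrow> infsum ?g UNIV"
    using has_sum_imp_sums sums_def by blast
  hence lim: "?t \<longlonglongrightarrow> 0"
    using tendsto_diff[OF tendsto_const, of "\<lambda>K. sum ?g {..<K}" "infsum ?g UNIV" sequentially "infsum ?g UNIV"] by simp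
  have bd: "norm (infsum ?f (sieve K) - 1) \<le> ?t K" for K
  proof -
    have 1: "1 \<in> sieve K" by (auto simp: sieve_def)
    have "infsum ?f (sieve K) = infsum ?f ({1} \<union> (sieve K - {1}))"
      using 1 by (simp add: insert_absorb)
    also have "\<dots> = infsum ?f {1} + infsum ?f (sieve K - {1})"
      by (rule infsum_Un_disjoint) (intro sm | simp)+
    finally have "infsum ?f (sieve K) - 1 = infsum ?f (sieve K - {1})" by simp
    also have "norm \<dots> \<le> infsum ?g (sieve K - {1})"
      by (rule norm_infsum_bound) (rule sm)
    also have "\<dots> \<le> infsum ?g (UNIV - {..<K})"
      by (rule infsum_mono2) (auto intro!: sm dest: sieve_ge)
    also have "\<dots> = ?t K"
      by (subst infsum_Diff) (auto intro!: sm)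
    finally show ?thesis .
  qed
  have "(\<lambda>K. infsum ?f (sieve K) - 1) \<longlonglongrightarrow> 0"
    by (rule Lim_null_comparison[OF _ lim]) (use bd in auto)
  thus ?thesis by (simp add: LIM_zero_iff)
qed

lemma euler_product:
  assumes "Re s > 1"
  shows "(\<lambda>K. zeta_series s * (\<Prod>k<K. 1 - ppow k s)) \<longlonglongrightarrow> 1"
  using infsum_sieve_tendsto[OF assms] unfolding infsum_sieve_prod[OF assms] .

subsection \<open>The logarithm of the zeta function\<close>

text \<open>\<open>plog j\<close> is \<open>(x d/dx)\<^sup>j\<close> applied to \<open>- Ln (1 - x)\<close>; composed with \<open>x = p\<^sup>-\<^sup>s\<close> it gives the \<open>j\<close>-th derivative of
  the local factor of \<open>log \<zeta>\<close> up to \<open>(- log p)\<^sup>j\<close>.\<close>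

fun plog :: "nat \<Rightarrow> complex \<Rightarrow> complex" where
  "plog 0 x = - Ln (1 - x)"
| "plog (Suc j) x = x * deriv (plog j) x"

lemma plog_holomorphic: "plog j holomorphic_on ball 0 1"
proof (induction j)
  case 0
  have "1 - x \<notin> \<real>\<^sub>\<le>\<^sub>0" if "norm x < 1" for x :: complex
    using that complex_Re_le_cmod[of x] by (auto simp: complex_nonpos_Reals_iff)
  thus ?case
    unfolding plog.simps[abs_def] by (intro holomorphic_intros) auto
next
  case (Suc j)
  thus ?case unfolding plog.simps(2)[abs_def] by (intro holomorphic_intros) auto
qed

text \<open>The operator x d/dx fixes the monomial x, so every \<open>plog j\<close> starts with x
  and only the error of second order depends on j.\<close>

lemma plog_0: "plog j 0 = 0 \<and> deriv (plog j) 0 = 1"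
proof (induction j)
  case 0
  have "((\<lambda>x. - Ln (1 - x)) has_field_derivative 1) (at 0)"
    by (auto intro!: derivative_eq_intros)
  thus ?case by (simp add: plog.simps[abs_def] DERIV_imp_deriv)
next
  case (Suc j)
  have "(deriv (plog j) has_field_derivative deriv (deriv (plog j)) 0) (at 0)"
    by (rule holomorphic_derivI[of _ "ball 0 1"]) (auto intro!: holomorphic_deriv plog_holomorphic)
  hence "((\<lambda>x. x * deriv (plog j) x) has_field_derivative 1) (at 0)"
    by (auto intro!: derivative_eq_intros simp: Suc)
  thus ?case by (simp add: plog.simps(2)[abs_def] DERIV_imp_deriv)
qed

text \<open>First-order Taylor expansion; the second derivative is bounded by compactness of the
  disc of radius 1/2, well inside the domain of holomorphy.\<close>

lemma plog_Taylor:
  obtains C where "C \<ge> 0" "\<And>x. norm x \<le> 1/2 \<Longrightarrow> norm (plog j x - x) \<le> C * norm x ^ 2"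
proof -
  let ?S = "cball (0 :: complex) (1/2)"
  define f where "f i = (deriv ^^ i) (plog j)" for i
  have hol: "f i holomorphic_on ball 0 1" for i
    unfolding f_def by (intro holomorphic_higher_deriv plog_holomorphic) auto
  have "continuous_on ?S (f 2)"
    by (rule holomorphic_on_imp_continuous_on, rule holomorphic_on_subset[OF hol]) auto
  hence "bounded (f 2 ` ?S)"
    by (intro compact_imp_bounded compact_continuous_image) auto
  then obtain B where B: "B > 0" "\<And>x. x \<in> ?S \<Longrightarrow> norm (f 2 x) \<le> B"
    by (auto simp: bounded_pos)
  show ?thesis
  proof (rule that)
    fix x :: complex assume x: "norm x \<le> 1/2"
    have "cmod (f 0 x - (\<Sum>i\<le>1. f i 0 * (x - 0) ^ i / (fact i))) \<le> B * cmod (x - 0) ^ Suc 1 / fact 1"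
    proof (rule complex_Taylor[of ?S])
      fix i and y :: complex assume y: "y \<in> ?S"
      have "(f i has_field_derivative deriv (f i) y) (at y)"
        by (rule holomorphic_derivI[OF hol]) (use y in auto)
      thus "(f i has_field_derivative f (Suc i) y) (at y within ?S)"
        by (simp add: f_def has_field_derivative_at_within)
    qed (use x B in \<open>auto simp: numeral_2_eq_2\<close>)
    thus "norm (plog j x - x) \<le> B * norm x ^ 2"
      using plog_0[of j] by (simp add: f_def numeral_2_eq_2)
  qed (use B in auto)
qed

lemma plog_bound:
  obtains C where "C \<ge> 0" "\<And>x. norm x \<le> 1/2 \<Longrightarrow> norm (plog j x) \<le> C * norm x"
proof -
  obtain C where C: "C \<ge> 0" "\<And>x. norm x \<le> 1/2 \<Longrightarrow> norm (plog j x - x) \<le> C * norm x ^ 2"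
    using plog_Taylor[of j] by metis
  show ?thesis
  proof (rule that[of "C + 1"])
    fix x :: complex assume x: "norm x \<le> 1/2"
    have "norm (plog j x) \<le> norm (plog j x - x) + norm x"
      using norm_triangle_ineq[of "plog j x - x" x] by simp
    also have "norm (plog j x - x) \<le> C * norm x ^ 2" by (rule C(2)[OF x])
    also have "C * norm x ^ 2 \<le> C * norm x"
      using x C(1) by (intro mult_left_mono) (simp_all add: power2_eq_square mult_left_le)
    finally show "norm (plog j x) \<le> (C + 1) * norm x"
      by (simp add: algebra_simps)
  qed (use C in auto)
qed

definition plog_term :: "nat \<Rightarrow> nat \<Rightarrow> complex \<Rightarrow> complex" where
  "plog_term j k s = of_real (- ln (nth_prime k)) ^ j * plog j (ppow k s)"

text \<open>Built from the sum over primes, not from a branch of the logarithm of zeta;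
  \<open>higher_deriv_log_zeta\<close> confirms j as the order of differentiation.\<close>

definition log_zeta :: "nat \<Rightarrow> complex \<Rightarrow> complex" where
  "log_zeta j s = (\<Sum>k. plog_term j k s)"

lemma norm_ppow_less_1: "Re s > 0 \<Longrightarrow> norm (ppow k s) < 1"
  unfolding norm_ppow using nth_prime_ge_2[of k] powr_less_mono[of "- Re s" 0 "real (nth_prime k)"] by simp

lemma plog_term_deriv:
  assumes "Re s > 0"
  shows "(plog_term j k has_field_derivative plog_term (Suc j) k s) (at s)"
proof -
  have 1: "(plog j has_field_derivative deriv (plog j) (ppow k s)) (at (ppow k s))"
    by (rule holomorphic_derivI[OF plog_holomorphic]) (use norm_ppow_less_1[OF assms] in auto)
  have 2: "(ppow k has_field_derivative of_real (- ln (nth_prime k)) * ppow k s) (at s)"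
  proof -
    have "((\<lambda>s. of_nat (nth_prime k) powr - s) has_field_derivative
        (Ln (of_nat (nth_prime k)) * of_nat (nth_prime k) powr - s) * (- 1)) (at s)"
      by (rule DERIV_chain2[OF has_field_derivative_powr_right]) (auto intro!: derivative_eq_intros)
    thus ?thesis by (simp add: ppow_def[abs_def] Ln_of_nat)
  qed
  show ?thesis
    unfolding plog_term_def[abs_def]
    using DERIV_cmult[OF DERIV_chain2[OF 1 2], of "of_real (- ln (nth_prime k)) ^ j"]
    by (simp add: mult_ac)
qed

lemma plog_term_holomorphic: "plog_term j k holomorphic_on {s. Re s > 0}"
  using plog_term_deriv by (auto simp: holomorphic_on_open open_halfspace_Re_gt)

lemma ln_power_bound:
  fixes a :: real
  assumes "a > 0"
  obtains C where "C \<ge> 0" "\<And>x :: real. x \<ge> 1 \<Longrightarrow> ln x ^ j \<le> C * x powr a"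
proof (cases "j = 0")
  case True
  show ?thesis
    by (rule that[of 1]) (use True assms in \<open>auto intro: ge_one_powr_ge_zero\<close>)
next
  case False
  \<comment> \<open>The j-th power of ln x <= x powr b / b then has exponent
    \<open>a\<close>.\<close>
  define b where "b = a / j"
  have b: "b > 0" using assms False by (simp add: b_def)
  show ?thesis
  proof (rule that[of "(1 / b) ^ j"])
    fix x :: real assume x: "x \<ge> 1"
    have "ln x ^ j \<le> (x powr b / b) ^ j"
      using x b by (intro power_mono ln_powr_bound) auto
    also have "\<dots> = (1 / b) ^ j * x powr a"
    proof -
      have "(x powr b) ^ j = x powr a"
        using x False by (subst powr_power) (auto simp: b_def)
      thus ?thesis by (simp add: power_divide)
    qed
    finally show "ln x ^ j \<le> (1 / b) ^ j * x powr a" .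
  qed (use b in auto)
qed

lemma ln_prime_power_summable:
  assumes "e > 1"
  shows "summable (\<lambda>k. ln (nth_prime k) ^ j * real (nth_prime k) powr (- e))"
proof -
  \<comment> \<open>Half of the excess of \<open>e\<close> over 1 absorbs the logarithms; the
    remaining exponent \<open>e - a\<close> still exceeds 1.\<close>
  define a where "a = (e - 1) / 2"
  have a: "a > 0" "e - a > 1" using assms by (auto simp: a_def field_simps)
  obtain C where C: "C \<ge> 0" "\<And>x :: real. x \<ge> 1 \<Longrightarrow> ln x ^ j \<le> C * x powr a"
    using ln_power_bound[OF a(1), of j] by metis
  have "summable (\<lambda>k. C * real (Suc k) powr (- (e - a)))"
    using a by (intro summable_mult summable_Suc_powr) auto
  thus ?thesis
  proof (rule summable_comparison_test_ev[rotated], intro always_eventually allI)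
    fix k
    let ?p = "real (nth_prime k)"
    have p: "?p \<ge> real (Suc k)" using nth_prime_ge[of k] by linarith
    have "norm (ln ?p ^ j * ?p powr (- e)) = ln ?p ^ j * ?p powr (- e)"
      using p by simp
    also have "\<dots> \<le> C * ?p powr a * ?p powr (- e)"
      using p by (intro mult_right_mono C) auto
    also have "\<dots> = C * ?p powr (- (e - a))"
      by (simp add: powr_add[symmetric])
    also have "\<dots> \<le> C * real (Suc k) powr (- (e - a))"
      using p a C(1) by (intro mult_left_mono powr_mono2') auto
    finally show "norm (ln ?p ^ j * ?p powr (- e)) \<le> C * real (Suc k) powr (- (e - a))" .
  qed
qed

lemma norm_plog_term_le:
  obtains C where "C \<ge> 0" "\<And>k s. Re s \<ge> 1 \<Longrightarrow> norm (plog_term j k s) \<le> C * (ln (nth_prime k) ^ j * real (nth_prime k) powr (- Re s))"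
proof -
  obtain C where C: "C \<ge> 0" "\<And>x. norm x \<le> 1/2 \<Longrightarrow> norm (plog j x) \<le> C * norm x"
    using plog_bound[of j] by metis
  show ?thesis
  proof (rule that[OF C(1)])
    fix k and s :: complex assume s: "Re s \<ge> 1"
    have "norm (plog_term j k s) = ln (nth_prime k) ^ j * norm (plog j (ppow k s))"
      using nth_prime_ge_2[of k] by (simp add: plog_term_def norm_mult norm_power)
    also have "\<dots> \<le> ln (nth_prime k) ^ j * (C * norm (ppow k s))"
      using nth_prime_ge_2[of k] norm_ppow_le_half[OF s] by (intro mult_left_mono C) auto
    also have "\<dots> = C * (ln (nth_prime k) ^ j * real (nth_prime k) powr (- Re s))"
      by (simp add: norm_ppow)
    finally show "norm (plog_term j k s) \<le> C * (ln (nth_prime k) ^ j * real (nth_prime k) powr (- Re s))" .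
  qed
qed

lemma log_zeta_series:
  shows log_zeta_holomorphic: "log_zeta j holomorphic_on {s. Re s > 1}"
    and log_zeta_sums: "\<And>s. Re s > 1 \<Longrightarrow> (\<lambda>k. plog_term j k s) sums log_zeta j s"
    and deriv_log_zeta: "\<And>s. Re s > 1 \<Longrightarrow> deriv (log_zeta j) s = log_zeta (Suc j) s"
proof -
  let ?S = "{s :: complex. Re s > 1}"
  have S: "open ?S" by (simp add: open_halfspace_Re_gt)
  have hol: "plog_term j k holomorphic_on ?S" for k
    by (rule holomorphic_on_subset[OF plog_term_holomorphic]) auto
  have bd: "\<exists>d h. 0 < d \<and> summable h \<and> (\<forall>\<^sub>F n in sequentially. \<forall>y\<in>ball x d \<inter> ?S. norm (plog_term j n y) \<le> h n)"
    if "x \<in> ?S" for x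
  proof -
    obtain d e where d: "d > 0" "e > 1" "\<And>y. y \<in> ball x d \<Longrightarrow> Re y \<ge> e"
      using ball_locally[of 1 x] \<open>x \<in> ?S\<close> by blast
    obtain C where C: "C \<ge> 0" "\<And>k s. Re s \<ge> 1 \<Longrightarrow> norm (plog_term j k s) \<le> C * (ln (nth_prime k) ^ j * real (nth_prime k) powr (- Re s))"
      using norm_plog_term_le[of j] by metis
    have "summable (\<lambda>k. C * (ln (nth_prime k) ^ j * real (nth_prime k) powr (- e)))"
      using d by (intro summable_mult ln_prime_power_summable) auto
    moreover have le: "norm (plog_term j k y) \<le> C * (ln (nth_prime k) ^ j * real (nth_prime k) powr (- e))" if "y \<in> ball x d" for y k
    proof -
      have "norm (plog_term j k y) \<le> C * (ln (nth_prime k) ^ j * real (nth_prime k) powr (- Re y))"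
        using d(2) d(3)[OF that] by (intro C) auto
      also have "\<dots> \<le> C * (ln (nth_prime k) ^ j * real (nth_prime k) powr (- e))"
        using d(3)[OF that] C(1) nth_prime_ge_2[of k] by (intro mult_left_mono powr_mono) auto
      finally show ?thesis .
    qed
    hence "\<forall>\<^sub>F k in sequentially. \<forall>y\<in>ball x d \<inter> ?S.
        norm (plog_term j k y) \<le> C * (ln (nth_prime k) ^ j * real (nth_prime k) powr (- e))"
      by (intro always_eventually) blast
    ultimately show ?thesis using d(1) by blast
  qed
  note * = holomorphic_series[OF S hol bd]
  show "log_zeta j holomorphic_on {s. Re s > 1}"
    using *(1) by (simp add: log_zeta_def[abs_def])
  show "(\<lambda>k. plog_term j k s) sums log_zeta j s" if "Re s > 1" for s
    unfolding log_zeta_def using *(2)[of s] that by (simp add: summable_sums)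
  show "deriv (log_zeta j) s = log_zeta (Suc j) s" if "Re s > 1" for s
  proof -
    have "deriv (plog_term j k) s = plog_term (Suc j) k s" for k
      using plog_term_deriv[of s j k] that by (simp add: DERIV_imp_deriv)
    thus ?thesis
      using *(3)[of s] that unfolding log_zeta_def[abs_def] by (simp add: sums_iff)
  qed
qed

text \<open>Each Euler factor is the exponential of - \<open>plog_term 0 k s\<close>, so the limit
  in \<open>euler_product\<close> reads zeta(s) exp(- \<open>log_zeta 0 s\<close>) = 1.\<close>

lemma zeta_series_eq_exp:
  assumes "Re s > 1"
  shows "zeta_series s = exp (log_zeta 0 s)"
proof -
  have "1 - ppow k s = exp (- plog_term 0 k s)" for k
  proof -
    have "ppow k s \<noteq> 1" using norm_ppow_less_1[of s k] assms by auto
    thus ?thesis by (simp add: plog_term_def)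
  qed
  hence eq: "(\<Prod>k<K. 1 - ppow k s) = exp (- (\<Sum>k<K. plog_term 0 k s))" for K
    by (simp add: exp_sum sum_negf[symmetric])
  have "(\<lambda>K. zeta_series s * exp (- (\<Sum>k<K. plog_term 0 k s))) \<longlonglongrightarrow> zeta_series s * exp (- log_zeta 0 s)"
    using log_zeta_sums[OF assms, of 0] unfolding sums_def by (intro tendsto_intros)
  moreover have "(\<lambda>K. zeta_series s * exp (- (\<Sum>k<K. plog_term 0 k s))) \<longlonglongrightarrow> 1"
    using euler_product[OF assms] unfolding eq .
  ultimately have "zeta_series s * exp (- log_zeta 0 s) = 1"
    using LIMSEQ_unique by blast
  thus ?thesis by (simp add: exp_minus field_simps)
qed

lemma higher_deriv_log_zeta:
  "Re s > 1 \<Longrightarrow> (deriv ^^ i) (log_zeta 0) s = log_zeta i s"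
proof (induction i arbitrary: s)
  case (Suc i)
  have "deriv ((deriv ^^ i) (log_zeta 0)) s = deriv (log_zeta i) s"
    by (rule complex_derivative_transform_within_open[of _ "{s. Re s > 1}"])
       (use Suc in \<open>auto intro!: holomorphic_higher_deriv log_zeta_holomorphic open_halfspace_Re_gt\<close>)
  thus ?case using Suc.prems by (simp add: deriv_log_zeta)
qed auto

lemma higher_deriv_riemann_zeta:
  assumes "Re s > 1"
  shows "(deriv ^^ i) riemann_zeta s = (deriv ^^ i) (\<lambda>s. exp (log_zeta 0 s)) s"
proof (rule higher_deriv_transform_within_open[of _ "{s. Re s > 1}"])
  show "(\<lambda>s. exp (log_zeta 0 s)) holomorphic_on {s. Re s > 1}"
    by (intro holomorphic_intros log_zeta_holomorphic)
  thus "riemann_zeta holomorphic_on {s. Re s > 1}"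
    by (rule holomorphic_transform) (simp add: riemann_zeta_eq_series zeta_series_eq_exp)
qed (use assms in \<open>auto simp: open_halfspace_Re_gt riemann_zeta_eq_series zeta_series_eq_exp\<close>)

text \<open>Euler's argument: a convergent sum would bound \<open>log_zeta 0\<close>, hence zeta,
  uniformly for real x > 1, and letting x tend to 1 would bound the harmonic series.\<close>

lemma not_summable_inverse_primes: "\<not> summable (\<lambda>k. 1 / real (nth_prime k))"
proof
  assume sm: "summable (\<lambda>k. 1 / real (nth_prime k))"
  obtain C where C: "C \<ge> 0" "\<And>k s. Re s \<ge> 1 \<Longrightarrow> norm (plog_term 0 k s) \<le> C * (ln (nth_prime k) ^ 0 * real (nth_prime k) powr (- Re s))"
    using norm_plog_term_le[of 0] by metis
  define S where "S = (\<Sum>k. C * (1 / real (nth_prime k)))"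
  have bd: "(\<Sum>n<N. real (Suc n) powr (- x)) \<le> exp S" if "x > 1" for x N
  proof -
    define s where "s = complex_of_real x"
    have s: "Re s > 1" using that by (simp add: s_def)
    have "norm (plog_term 0 k s) \<le> C * (1 / real (nth_prime k))" for k
    proof -
      have "norm (plog_term 0 k s) \<le> C * real (nth_prime k) powr (- Re s)"
        using C(2)[of s k] s by simp
      also have "\<dots> \<le> C * real (nth_prime k) powr (- 1)"
        using s C(1) nth_prime_ge_2[of k] by (intro mult_left_mono powr_mono) auto
      finally show ?thesis by (simp add: powr_minus field_simps)
    qed
    hence "norm (log_zeta 0 s) \<le> S"
      unfolding log_zeta_def S_def by (intro norm_suminf_le summable_mult sm)
    hence 1: "norm (zeta_series s) \<le> exp S"
      unfolding zeta_series_eq_exp[OF s] norm_exp_eq_Re using complex_Re_le_cmod[of "log_zeta 0 s"] by simp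
    have eq: "of_nat (Suc n) powr (- s) = complex_of_real (real (Suc n) powr (- x))" for n
      unfolding s_def by (subst powr_of_real[symmetric]) auto
    have "summable (\<lambda>n. complex_of_real (real (Suc n) powr (- x)))"
      using summable_zeta_series[OF s] unfolding eq .
    hence sm': "summable (\<lambda>n. real (Suc n) powr (- x))"
      unfolding summable_of_real_iff .
    have "zeta_series s = of_real (\<Sum>n. real (Suc n) powr (- x))"
      unfolding zeta_series_def eq by (rule suminf_of_real[symmetric, OF sm'])
    with 1 have "(\<Sum>n. real (Suc n) powr (- x)) \<le> exp S" by simp
    moreover have "(\<Sum>n<N. real (Suc n) powr (- x)) \<le> (\<Sum>n. real (Suc n) powr (- x))"
      by (rule sum_le_suminf[OF sm']) auto
    ultimately show ?thesis by linarith
  qed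
  have "(\<Sum>n<N. inverse (real (Suc n))) \<le> exp S" for N
  proof (rule tendsto_upperbound)
    show "((\<lambda>x. \<Sum>n<N. real (Suc n) powr (- x)) \<longlongrightarrow> (\<Sum>n<N. inverse (real (Suc n)))) (at_right 1)"
      by (rule tendsto_eq_intros | simp)+ (simp add: powr_minus inverse_eq_divide)
    show "\<forall>\<^sub>F x in at_right 1. (\<Sum>n<N. real (Suc n) powr (- x)) \<le> exp S"
      using eventually_at_right_less[of 1] by eventually_elim (rule bd)
  qed auto
  hence "summable (\<lambda>n. inverse (real (Suc n)))"
    by (intro bounded_imp_summable[of _ "exp S"]) (simp_all add: lessThan_Suc_atMost[symmetric] del: of_nat_Suc sum.lessThan_Suc)
  thus False using not_summable_harmonic[where 'a = real] summable_Suc_iff[of "\<lambda>n. inverse (real n)"] by simp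
qed

subsection \<open>Prescribed moments of a divergent weight\<close>

text \<open>In the application \<open>d\<close> is 2/p and \<open>x\<close> is log p for the primes
  p of even index, the factor 2 standing for a pair of primes. Up to sign, moment j is then a
  weighted prime sum from the j-th derivative of log zeta at s = 1.\<close>

definition moment :: "(nat \<Rightarrow> real) \<Rightarrow> (nat \<Rightarrow> real) \<Rightarrow> (nat \<Rightarrow> 'a :: real_normed_field) \<Rightarrow> nat \<Rightarrow> nat \<Rightarrow> 'a" where
  "moment d x a Y j = (\<Sum>k<Y. a k * of_real (d k * x k ^ j))"

text \<open>The window N <= k < Y is part of the notion so that families on disjoint windows can be
  combined without leaving the unit disc.\<close>

definition weights :: "nat \<Rightarrow> nat \<Rightarrow> (nat \<Rightarrow> 'a :: real_normed_field) \<Rightarrow> bool" where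
  "weights N Y a \<longleftrightarrow> (\<forall>k. norm (a k) \<le> 1) \<and> (\<forall>k. k < N \<or> k \<ge> Y \<longrightarrow> a k = 0)"

lemma weights_le: "weights N Y a \<Longrightarrow> norm (a k) \<le> 1"
  and weights_0: "weights N Y a \<Longrightarrow> k < N \<or> k \<ge> Y \<Longrightarrow> a k = 0"
  by (auto simp: weights_def)

lemma moment_extend:
  assumes "weights N Y a" "Y \<le> Y'"
  shows "moment d x a Y' j = moment d x a Y j"
  unfolding moment_def by (rule sum.mono_neutral_right) (use assms in \<open>auto dest: weights_0\<close>)

lemma moment_lincomb:
  "moment d x (\<lambda>k. c * a k + e * b k) Y j = c * moment d x a Y j + e * moment d x b Y j"
  by (simp add: moment_def sum.distrib sum_distrib_left algebra_simps)

lemma weights_lincomb: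
  assumes "weights N Y a" "weights N' Y' b" "N \<le> Y" "Y \<le> N'" "N' \<le> Y'" "norm c \<le> 1" "norm e \<le> 1"
  shows "weights N Y' (\<lambda>k. c * a k + e * b k)"
proof -
  have "norm (c * a k + e * b k) \<le> 1" for k
  proof (cases "k < Y")
    case True
    hence "b k = 0" using assms weights_0[OF assms(2), of k] by auto
    thus ?thesis using assms(6) weights_le[OF assms(1), of k] by (simp add: norm_mult mult_le_one)
  next
    case False
    hence "a k = 0" using weights_0[OF assms(1), of k] by auto
    thus ?thesis using assms(7) weights_le[OF assms(2), of k] by (simp add: norm_mult mult_le_one)
  qed
  moreover have "c * a k + e * b k = 0" if "k < N \<or> k \<ge> Y'" for k
    using weights_0[OF assms(1), of k] weights_0[OF assms(2), of k] that assms by auto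
  ultimately show ?thesis by (auto simp: weights_def)
qed

context
  fixes d x :: "nat \<Rightarrow> real"
  assumes d: "\<And>k. d k \<ge> 0" and div: "\<not> summable d" and x: "filterlim x at_top sequentially"
begin

lemma tail_sum_unbounded: "\<exists>Y>N. (\<Sum>k\<in>{N..<Y}. d k) \<ge> C"
proof (rule ccontr)
  assume "\<not> ?thesis"
  hence *: "(\<Sum>k\<in>{N..<Y}. d k) < C" if "Y > N" for Y using that by (auto simp: not_le)
  have "(\<Sum>k\<le>n. d k) \<le> (\<Sum>k<N. d k) + C" for n
  proof -
    have "(\<Sum>k\<le>n. d k) \<le> (\<Sum>k<Suc (n + N). d k)"
      by (rule sum_mono2) (auto simp: d)
    also have "\<dots> = (\<Sum>k<N. d k) + (\<Sum>k\<in>{N..<Suc (n + N)}. d k)"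
    proof -
      have "{..<Suc (n + N)} = {..<N} \<union> {N..<Suc (n + N)}" by auto
      then show ?thesis by (metis finite_atLeastLessThan finite_lessThan ivl_disj_int_one(2) sum.union_disjoint)
    qed
    also have "(\<Sum>k\<in>{N..<Suc (n + N)}. d k) < C" by (rule *) auto
    finally show ?thesis by simp
  qed
  hence "summable d" by (intro bounded_imp_summable[OF d])
  with div show False ..
qed

text \<open>The growth condition on the higher moments carries the induction: two solutions for \<open>m\<close>, the second supported so
  far out that its moments grow much faster, combine to one whose \<open>m\<close>-th moment vanishes as well.\<close>

lemma vanishing_moments:
  assumes "R \<ge> 1" "C \<ge> 1"
  shows "\<exists>Y>N. \<exists>a :: nat \<Rightarrow> real. weights N Y a \<and> (\<forall>j<m. moment d x a Y j = 0) \<and>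
      moment d x a Y m \<ge> C \<and> (\<forall>j. m \<le> j \<and> j < J \<longrightarrow> moment d x a Y (Suc j) \<ge> R * moment d x a Y j)"
  using assms
proof (induction m arbitrary: N R C J)
  case 0
  \<comment> \<open>Base case: the indicator of a block on which x >= R, long enough to have total
    weight C. Each further factor x raises the moment by at least the factor R.\<close>
  from x have "eventually (\<lambda>k. x k \<ge> R) sequentially"
    by (simp add: filterlim_at_top)
  then obtain N' where N': "\<And>k. k \<ge> N' \<Longrightarrow> x k \<ge> R"
    by (auto simp: eventually_sequentially)
  define N'' where "N'' = max N N'"
  obtain Y where Y: "Y > N''" "(\<Sum>k\<in>{N''..<Y}. d k) \<ge> C"
    using tail_sum_unbounded by blast
  define a where "a k = (if k \<in> {N''..<Y} then 1 else 0 :: real)" for k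
  have m: "moment d x a Y j = (\<Sum>k\<in>{N''..<Y}. d k * x k ^ j)" for j
  proof -
    have "moment d x a Y j = (\<Sum>k<Y. if k \<in> {N''..<Y} then d k * x k ^ j else 0)"
      unfolding moment_def by (rule sum.cong) (auto simp: a_def)
    also have "\<dots> = (\<Sum>k\<in>{..<Y} \<inter> {N''..<Y}. d k * x k ^ j)"
      by (rule sum.inter_restrict[symmetric]) auto
    also have "{..<Y} \<inter> {N''..<Y} = {N''..<Y}" by auto
    finally show ?thesis .
  qed
  have "R * moment d x a Y j \<le> moment d x a Y (Suc j)" for j
    unfolding m sum_distrib_left
  proof (rule sum_mono)
    fix k assume "k \<in> {N''..<Y}"
    hence "x k \<ge> R" by (intro N') (auto simp: N''_def)
    hence "R * (d k * x k ^ j) \<le> x k * (d k * x k ^ j)"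
      using d[of k] 0 by (intro mult_right_mono mult_nonneg_nonneg zero_le_power) auto
    thus "R * (d k * x k ^ j) \<le> d k * x k ^ Suc j" by (simp add: mult_ac)
  qed
  moreover have "weights N Y a" by (auto simp: weights_def a_def N''_def)
  moreover have "moment d x a Y 0 \<ge> C" using Y by (simp add: m)
  ultimately show ?case using Y by (intro exI[of _ Y]) (auto simp: N''_def)
next
  case (Suc m)
  \<comment> \<open>Besides the requested range up to J, control of the moments of index m and m + 1
    is needed.\<close>
  define J' where "J' = max J (m + 2)"
  have "(1 :: real) \<le> 1" by simp
  from Suc.IH[OF this this, of N J'] obtain Y1 and a1 :: "nat \<Rightarrow> real" where 1: "Y1 > N" "weights N Y1 a1"
      "\<And>j. j < m \<Longrightarrow> moment d x a1 Y1 j = 0" "moment d x a1 Y1 m \<ge> 1"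
      "\<And>j. m \<le> j \<Longrightarrow> j < J' \<Longrightarrow> moment d x a1 Y1 (Suc j) \<ge> moment d x a1 Y1 j"
    by auto
  define M1 where "M1 = moment d x a1 Y1"
  define B where "B = (\<Sum>j\<le>J'. \<bar>M1 j\<bar>)"
  have B: "M1 j \<le> B" if "j \<le> J'" for j
  proof -
    have "\<bar>M1 j\<bar> \<le> B" unfolding B_def by (rule member_le_sum) (use that in auto)
    thus ?thesis by simp
  qed
  have B0: "B \<ge> 0" unfolding B_def by (intro sum_nonneg) auto
  \<comment> \<open>B outweighs the moments of the first family, C yields the lower bound for the
    moment of index m + 1, and R preserves the growth rate.\<close>
  define R2 where "R2 = R + B + C"
  have R2: "R2 \<ge> 1" using Suc.prems B0 by (simp add: R2_def)
  from Suc.IH[OF R2, of 1 Y1 J'] obtain Y2 a2 where 2: "Y2 > Y1" "weights Y1 Y2 a2"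
      "\<And>j. j < m \<Longrightarrow> moment d x a2 Y2 j = 0" "moment d x a2 Y2 m \<ge> 1"
      "\<And>j. m \<le> j \<Longrightarrow> j < J' \<Longrightarrow> moment d x a2 Y2 (Suc j) \<ge> R2 * moment d x a2 Y2 j"
    by auto
  define M2 where "M2 = moment d x a2 Y2"
  note M = 1(3-5)[folded M1_def] 2(3-5)[folded M2_def]
  have M1_ge: "j \<le> J' \<Longrightarrow> M1 j \<ge> 1" if "m \<le> j" for j
    using that
  proof (induction j rule: dec_induct)
    case (step j)
    thus ?case using M(3)[of j] by auto
  qed (use M(2,5) in auto)
  have M2_ge: "j \<le> J' \<Longrightarrow> M2 j \<ge> M2 m" if "m \<le> j" for j
    using that
  proof (induction j rule: dec_induct)
    case (step j)
    hence "M2 j \<ge> 0" using M(5) by auto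
    hence "R2 * M2 j \<ge> M2 j" using R2 by (simp add: mult_le_cancel_right1)
    thus ?case using M(6)[of j] step by auto
  qed auto
  \<comment> \<open>Using each family's m-th moment as coefficient of the other cancels the moment
    of index m. Division by the larger one keeps both coefficients within 1; as both moments are at
    least 1, K does not exceed their product, so the lower bounds survive.\<close>
  define K where "K = max (M1 m) (M2 m)"
  have K: "K \<ge> 1" "K \<le> M1 m * M2 m" "M1 m \<le> K" "M2 m \<le> K"
    using M(2,5) by (auto simp: K_def max_def mult_le_cancel_left1 mult_le_cancel_right1)
  define a where "a k = (- M2 m / K) * a1 k + (M1 m / K) * a2 k" for k
  have wt: "weights N Y2 a"
    unfolding a_def[abs_def]
    by (rule weights_lincomb[OF 1(2) 2(2)]) (use 1(1) 2(1) K M(2,5) in auto)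
  have mom: "moment d x a Y2 j = (M1 m * M2 j - M2 m * M1 j) / K" for j
  proof -
    have "moment d x a Y2 j = (- M2 m / K) * moment d x a1 Y2 j + (M1 m / K) * M2 j"
      unfolding a_def[abs_def] M2_def by (rule moment_lincomb)
    also have "moment d x a1 Y2 j = M1 j"
      unfolding M1_def by (rule moment_extend[OF 1(2)]) (use 2(1) in simp)
    finally show ?thesis by (simp add: diff_divide_distrib)
  qed
  have v1: "moment d x a Y2 j = 0" if "j < Suc m" for j
    unfolding mom using that M(1,4)[of j] by (cases "j = m") auto
  have v2: "moment d x a Y2 (Suc m) \<ge> C"
  proof -
    have "C * K \<le> C * (M1 m * M2 m)"
      using K Suc.prems by (intro mult_left_mono) auto
    also have "\<dots> \<le> (R2 - B) * (M1 m * M2 m)"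
      unfolding R2_def using K Suc.prems by (intro mult_right_mono) auto
    also have "\<dots> = M1 m * (R2 * M2 m) - (B * M1 m) * M2 m" by (simp add: algebra_simps)
    also have "\<dots> \<le> M1 m * M2 (Suc m) - M1 (Suc m) * M2 m"
    proof (intro diff_mono mult_left_mono mult_right_mono)
      show "R2 * M2 m \<le> M2 (Suc m)" by (rule M(6)) (auto simp: J'_def)
      have "M1 (Suc m) \<le> B" by (rule B) (auto simp: J'_def)
      also have "B \<le> B * M1 m" using B0 M(2) by (simp add: mult_le_cancel_left1)
      finally show "M1 (Suc m) \<le> B * M1 m" .
    qed (use M(2,5) in auto)
    finally show ?thesis unfolding mom using K by (simp add: field_simps)
  qed
  have v3: "moment d x a Y2 (Suc j) \<ge> R * moment d x a Y2 j" if "Suc m \<le> j" "j < J" for j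
  proof -
    have jJ: "m \<le> j" "Suc j \<le> J'" "j < J'" "j \<le> J'" using that by (auto simp: J'_def)
    have "R * (M1 m * M2 j - M2 m * M1 j) \<le> R * (M1 m * M2 j)"
      using Suc.prems M(2,5) jJ M1_ge[of j] by (intro mult_left_mono) (auto intro!: mult_nonneg_nonneg)
    also have "\<dots> = M1 m * (R2 * M2 j) - (R2 - R) * (M1 m * M2 j)" by (simp add: algebra_simps)
    also have "\<dots> \<le> M1 m * M2 (Suc j) - B * (M1 m * M2 m)"
    proof (intro diff_mono mult_left_mono mult_mono M(6))
      show "M2 m \<le> M2 j" using M2_ge jJ by auto
    qed (use M(2,5) jJ B0 Suc.prems in \<open>auto simp: R2_def\<close>)
    also have "\<dots> \<le> M1 m * M2 (Suc j) - M1 (Suc j) * M2 m"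
    proof -
      have "M1 (Suc j) \<le> B" by (rule B) (use jJ in auto)
      also have "B \<le> B * M1 m" using B0 M(2) by (simp add: mult_le_cancel_left1)
      finally have "M1 (Suc j) * M2 m \<le> B * M1 m * M2 m" using M(2,5) by (intro mult_right_mono) auto
      thus ?thesis by simp
    qed
    finally show ?thesis
      unfolding mom using K by (simp add: divide_right_mono mult_ac)
  qed
  have "Y2 > N" using 1(1) 2(1) by (rule less_trans)
  thus ?case
    by (intro exI[of _ Y2] exI[of _ a] conjI allI impI wt v1 v2) (assumption, assumption, elim conjE, rule v3)
qed

text \<open>Induction on the number of moments: a family beyond the previous window, with vanishing
  lower moments, corrects moment m without disturbing the earlier ones.\<close>

lemma prescribed_moments:
  "\<exists>Y\<ge>N. \<exists>a :: nat \<Rightarrow> complex. weights N Y a \<and> (\<forall>j<m. moment d x a Y j = w j)"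
proof (induction m)
  case 0
  have "weights N N (\<lambda>_. 0 :: complex)" by (simp add: weights_def)
  thus ?case by blast
next
  case (Suc m)
  then obtain Y0 and a0 :: "nat \<Rightarrow> complex" where 0: "Y0 \<ge> N" "weights N Y0 a0" "\<forall>j<m. moment d x a0 Y0 j = w j"
    by (elim exE conjE) (rule that)
  define r where "r = w m - moment d x a0 Y0 m"
  \<comment> \<open>A moment of at least norm r keeps the correcting coefficient within the unit
    disc; the maximum with 1 keeps its denominator away from 0.\<close>
  have "max 1 (norm r) \<ge> 1" by simp
  from vanishing_moments[OF order_refl this, of Y0 m 0]
  obtain Y1 and a1 :: "nat \<Rightarrow> real" where 1: "Y1 > Y0" "weights Y0 Y1 a1" "\<forall>j<m. moment d x a1 Y1 j = 0"
       "moment d x a1 Y1 m \<ge> max 1 (norm r)"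
    by (elim exE conjE) (rule that)
  define a1' where "a1' k = complex_of_real (a1 k)" for k
  have 2: "weights Y0 Y1 a1'" using 1(2) by (auto simp: weights_def a1'_def)
  have m: "moment d x a1' Y1 j = of_real (moment d x a1 Y1 j)" for j
    by (simp add: moment_def a1'_def)
  define c where "c = r / of_real (moment d x a1 Y1 m)"
  have c: "norm c \<le> 1"
  proof -
    have "norm c = norm r / \<bar>moment d x a1 Y1 m\<bar>" by (simp add: c_def norm_divide)
    also have "\<dots> \<le> 1" by (rule divide_le_eq_1[THEN iffD2]) (use 1(4) in linarith)
    finally show ?thesis .
  qed
  have wt: "weights N Y1 (\<lambda>k. 1 * a0 k + c * a1' k)"
    by (rule weights_lincomb[OF 0(2) 2]) (use 0(1) 1(1) c in auto)
  have mom: "moment d x (\<lambda>k. 1 * a0 k + c * a1' k) Y1 j = w j" if "j < Suc m" for j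
  proof -
    have "moment d x (\<lambda>k. 1 * a0 k + c * a1' k) Y1 j = moment d x a0 Y0 j + c * of_real (moment d x a1 Y1 j)"
      unfolding moment_lincomb m moment_extend[OF 0(2) less_imp_le[OF 1(1)]] by simp
    also have "\<dots> = w j"
    proof (cases "j = m")
      case True
      thus ?thesis using 1(4) by (auto simp: c_def r_def)
    next
      case False
      thus ?thesis using that 0(3) 1(3) by simp
    qed
    finally show ?thesis .
  qed
  have "Y1 \<ge> N" using 0(1) 1(1) by simp
  with wt mom show ?case by blast
qed

end

subsection \<open>Kronecker approximation for the primes\<close>

text \<open>Unique factorisation: exponentiating and moving negative coefficients to the other side
  equates two products of primes, and a prime with nonzero coefficient divides exactly one of
  them.\<close>

lemma ln_primes_independent:
  assumes "finite A" "(\<Sum>k\<in>A. real_of_int (c k) * ln (nth_prime k)) = 0" "k \<in> A"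
  shows "c k = 0"
proof (rule ccontr)
  assume "c k \<noteq> 0"
  \<comment> \<open>\<open>nat\<close> truncates negative exponents to 0, so \<open>pos c\<close>
    and \<open>pos (\<lambda>k. - c k)\<close> are the two sides.\<close>
  define pos where "pos = (\<lambda>e :: nat \<Rightarrow> int. \<Prod>k\<in>A. nth_prime k ^ nat (e k))"
  have ln_pos: "ln (real (pos e)) = (\<Sum>k\<in>A. real (nat (e k)) * ln (nth_prime k))" for e
    unfolding pos_def of_nat_prod by (subst ln_prod) (auto simp: ln_realpow assms(1))
  have "ln (real (pos c)) - ln (real (pos (\<lambda>k. - c k))) = (\<Sum>k\<in>A. real_of_int (c k) * ln (nth_prime k))"
    unfolding ln_pos sum_subtractf[symmetric] by (intro sum.cong refl) (auto simp: left_diff_distrib[symmetric])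
  hence "ln (real (pos c)) = ln (real (pos (\<lambda>k. - c k)))"
    using assms by simp
  moreover have "pos e > 0" for e by (auto simp: pos_def intro!: prod_pos)
  ultimately have eq: "pos c = pos (\<lambda>k. - c k)" by simp
  have dvd: "nth_prime k dvd pos e \<longleftrightarrow> e k > 0" for e
  proof
    assume "nth_prime k dvd pos e"
    then obtain i where i: "i \<in> A" "nth_prime k dvd nth_prime i ^ nat (e i)"
      unfolding pos_def using prime_dvd_prod_iff[OF assms(1) prime_nth_prime, of k "\<lambda>k. nth_prime k ^ nat (e k)"] by blast
    hence "nth_prime k dvd nth_prime i" "nat (e i) \<noteq> 0"
      using prime_dvd_power[OF prime_nth_prime] by (auto intro!: Nat.gr0I)
    moreover from this have "k = i"
      by (metis nth_prime_eq_iff prime_nth_prime primes_dvd_imp_eq)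
    ultimately show "e k > 0" by auto
  next
    assume "e k > 0"
    hence "nth_prime k dvd nth_prime k ^ nat (e k)" by (intro dvd_power) auto
    also have "\<dots> dvd pos e" unfolding pos_def using assms by (intro dvd_prodI) auto
    finally show "nth_prime k dvd pos e" .
  qed
  show False using dvd[of c] dvd[of "\<lambda>k. - c k"] \<open>c k \<noteq> 0\<close> unfolding eq by linarith
qed

lemma norm_cis_diff_le: "norm (cis a - cis b) \<le> \<bar>a - b\<bar>"
proof -
  have "norm (cis a - cis b) = norm (cis b * (cis (a - b) - 1))"
    by (simp add: cis_mult right_diff_distrib)
  also have "\<dots> = norm (cis (a - b) - 1)" by (simp add: norm_mult)
  also have "\<dots> = 2 * \<bar>sin ((a - b) / 2)\<bar>"
    using dist_exp_i_1[of "a - b"] by (simp add: cis_conv_exp)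
  also have "\<dots> \<le> 2 * \<bar>(a - b) / 2\<bar>"
    by (intro mult_left_mono abs_sin_x_le_abs_x) auto
  finally show ?thesis by simp
qed

text \<open>Kronecker's theorem alone gives no lower bound on t. A simultaneous Dirichlet
  approximation supplies a large almost-period \<tau> that is added to it.\<close>

lemma kronecker_primes:
  fixes \<theta> :: "nat \<Rightarrow> complex"
  assumes \<theta>: "\<And>k. k < K \<Longrightarrow> norm (\<theta> k) = 1" and e: "e > 0"
  shows "\<exists>t. \<bar>t\<bar> \<ge> T \<and> (\<forall>k<K. norm (cis (- t * ln (nth_prime k)) - \<theta> k) < e)"
proof -
  \<comment> \<open>Angles are counted in full turns; the minus sign in \<alpha> matches the
    exponent - t ln p.\<close>
  define b where "b k = ln (nth_prime k) / (2 * pi)" for k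
  define \<alpha> where "\<alpha> k = - Arg (\<theta> k) / (2 * pi)" for k
  have b_inj: "inj b"
    by (auto simp: inj_def b_def ln_inj_iff)
  interpret Modules.module "(\<lambda>r. (*) (real_of_int r))"
    by (simp add: Modules.module.intro distrib_left mult.commute)
  have ind: "independent (b ` {..<K})"
    unfolding dependent_explicit
  proof safe
    fix S u v assume S: "finite S" "S \<subseteq> b ` {..<K}" "(\<Sum>v\<in>S. real_of_int (u v) * v) = 0" "v \<in> S" "u v \<noteq> 0"
    then obtain A where A: "A \<subseteq> {..<K}" "S = b ` A" by (meson subset_image_iff)
    have fin: "finite A" using A(1) finite_subset by blast
    have "(\<Sum>v\<in>S. real_of_int (u v) * v) = (\<Sum>k\<in>A. real_of_int (u (b k)) * b k)"
      unfolding A(2) by (subst sum.reindex) (auto intro: inj_on_subset[OF b_inj])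
    also have "\<dots> = (\<Sum>k\<in>A. real_of_int (u (b k)) * ln (nth_prime k)) / (2 * pi)"
      by (simp add: b_def sum_divide_distrib)
    finally have "(\<Sum>k\<in>A. real_of_int (u (b k)) * ln (nth_prime k)) = 0" using S(3) by simp
    from ln_primes_independent[OF fin this] S(4,5) A(2) show False by auto
  qed
  \<comment> \<open>Two errors below e', one from Kronecker and one from Dirichlet, are multiplied
    by 2 pi.\<close>
  define e' where "e' = e / (4 * pi)"
  have e': "e' > 0" using e by (simp add: e'_def)
  obtain t h where t: "\<And>i. i < K \<Longrightarrow> \<bar>t * b i - of_int (h i) - \<alpha> i\<bar> < e'"
    using Kronecker_thm_1[OF ind inj_on_subset[OF b_inj] e', of \<alpha>] by auto
  define T' where "T' = max T 1"
  obtain N :: nat where N: "N > 0" "1 / real N < e'"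
    using real_arch_inverse[of e'] e' by (auto simp: inverse_eq_divide)
  obtain q p where q: "0 < q" "\<And>i. i < K \<Longrightarrow> \<bar>of_int q * (T' * b i) - of_int (p i)\<bar> < 1 / real N"
    using Dirichlet_approx_simult[OF N(1), of K "\<lambda>i. T' * b i"] by metis
  \<comment> \<open>\<tau> takes the sign of t, so the two cannot cancel each other.\<close>
  define \<tau> where "\<tau> = (if t \<ge> 0 then of_int q * T' else - of_int q * T')"
  define g where "g i = (if t \<ge> 0 then p i else - p i)" for i
  have tau: "\<bar>\<tau> * b i - of_int (g i)\<bar> < e'" if "i < K" for i
    using q(2)[OF that] N(2) by (auto simp: \<tau>_def g_def mult.assoc)
  have qT: "real_of_int q * T' \<ge> T'"
    using q(1) by (simp add: T'_def mult_le_cancel_right1)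
  have "\<bar>t + \<tau>\<bar> \<ge> T"
    using qT by (auto simp: \<tau>_def T'_def)
  moreover have "norm (cis (- (t + \<tau>) * ln (nth_prime k)) - \<theta> k) < e" if k: "k < K" for k
  proof -
    define n where "n = h k + g k"
    have "- (t + \<tau>) * ln (nth_prime k) = - (2 * pi * (t + \<tau>) * b k)" by (simp add: b_def algebra_simps)
    hence "cis (- (t + \<tau>) * ln (nth_prime k)) = cis (- (2 * pi * (t + \<tau>) * b k)) * cis (2 * pi * of_int n)"
      by simp
    also have "\<dots> = cis (- (2 * pi * (t + \<tau>) * b k) + 2 * pi * of_int n)"
      by (rule cis_mult)
    finally have c1: "cis (- (t + \<tau>) * ln (nth_prime k)) = cis (- (2 * pi * (t + \<tau>) * b k) + 2 * pi * of_int n)" .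
    have c2: "\<theta> k = cis (- (2 * pi * \<alpha> k))"
    proof -
      have "\<theta> k \<noteq> 0" using \<theta>[OF k] by auto
      thus ?thesis using \<theta>[OF k] cis_Arg[of "\<theta> k"] by (simp add: \<alpha>_def sgn_eq)
    qed
    have "norm (cis (- (t + \<tau>) * ln (nth_prime k)) - \<theta> k) \<le>
       \<bar>(- (2 * pi * (t + \<tau>) * b k) + 2 * pi * of_int n) - (- (2 * pi * \<alpha> k))\<bar>"
      unfolding c1 c2 by (rule norm_cis_diff_le)
    also have "\<dots> = \<bar>(2 * pi) * (((t * b k - of_int (h k) - \<alpha> k)) + (\<tau> * b k - of_int (g k)))\<bar>"
      by (subst abs_minus_cancel[symmetric]) (simp add: n_def algebra_simps)
    also have "\<dots> = 2 * pi * \<bar>(t * b k - of_int (h k) - \<alpha> k) + (\<tau> * b k - of_int (g k))\<bar>"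
      by (simp add: abs_mult)
    also have "\<dots> < 2 * pi * (e' + e')"
      using t[OF k] tau[OF k] by (intro mult_strict_left_mono) auto
    also have "\<dots> = e" by (simp add: e'_def)
    finally show ?thesis .
  qed
  ultimately show ?thesis by blast
qed

lemma kronecker_primes_seq:
  fixes \<theta> :: "nat \<Rightarrow> complex"
  assumes "\<And>k. k < K \<Longrightarrow> norm (\<theta> k) = 1"
  obtains t :: "nat \<Rightarrow> real" where "\<And>n. \<bar>t n\<bar> \<ge> real n"
     "\<And>k. k < K \<Longrightarrow> (\<lambda>n. cis (- t n * ln (nth_prime k))) \<longlonglongrightarrow> \<theta> k"
proof -
  have "\<forall>n. \<exists>t. \<bar>t\<bar> \<ge> real n \<and> (\<forall>k<K. norm (cis (- t * ln (nth_prime k)) - \<theta> k) < inverse (real (Suc n)))"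
    using kronecker_primes[OF assms] by auto
  then obtain t where t: "\<And>n. \<bar>t n\<bar> \<ge> real n" "\<And>n k. k < K \<Longrightarrow> norm (cis (- t n * ln (nth_prime k)) - \<theta> k) < inverse (real (Suc n))"
    by metis
  show ?thesis
  proof (rule that[OF t(1)])
    fix k assume k: "k < K"
    have "(\<lambda>n. cis (- t n * ln (nth_prime k)) - \<theta> k) \<longlonglongrightarrow> 0"
      by (rule Lim_null_comparison[OF _ LIMSEQ_inverse_real_of_nat])
         (use t(2)[OF k] in \<open>auto intro!: always_eventually less_imp_le simp del: of_nat_Suc\<close>)
    thus "(\<lambda>n. cis (- t n * ln (nth_prime k))) \<longlonglongrightarrow> \<theta> k" by (simp add: LIM_zero_iff)
  qed
qed

subsection \<open>Density of the jets\<close>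

text \<open>Take the unit vectors at angle arccos |a| on either side of the direction of a.\<close>

lemma unit_pair:
  fixes a :: complex
  assumes "norm a \<le> 1"
  obtains \<theta> \<theta>' where "norm \<theta> = 1" "norm \<theta>' = 1" "\<theta> + \<theta>' = 2 * a"
proof -
  obtain r \<phi> where a: "a = rcis r \<phi>" "r \<ge> 0" by (metis rcis_Ex norm_ge_zero rcis_cmod_Arg)
  with assms have r: "0 \<le> r" "r \<le> 1" by auto
  have "cis (\<phi> + arccos r) + cis (\<phi> - arccos r) = cis \<phi> * (cis (arccos r) + cis (- arccos r))"
    by (simp add: distrib_left cis_mult)
  also have "cis (arccos r) + cis (- arccos r) = of_real (2 * r)"
    using r by (simp add: complex_eq_iff cos_arccos_abs)
  finally have "cis (\<phi> + arccos r) + cis (\<phi> - arccos r) = 2 * a"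
    by (simp add: a rcis_def)
  thus ?thesis by (intro that) auto
qed

text \<open>A relative increase \<delta> of the logarithm costs a factor (1 + \<delta>)^j <= exp(j
  \<delta>), which the decay of the power outweighs because ln x >= m >= j and \<sigma> >=
  1.\<close>

lemma ln_power_powr_antimono:
  fixes x y \<sigma> :: real
  assumes "x \<ge> exp (real m)" "x \<le> y" "\<sigma> \<ge> 1" "j \<le> m"
  shows "ln y ^ j * y powr (- \<sigma>) \<le> ln x ^ j * x powr (- \<sigma>)"
proof (cases "j = 0")
  case True
  have "x > 0" using assms(1) exp_gt_zero[of "real m"] by linarith
  thus ?thesis using True assms by (simp add: powr_mono2')
next
  case False
  have x0: "x > 0" using assms(1) exp_gt_zero[of "real m"] by linarith
  hence lnx: "ln x \<ge> real m" using assms(1) by (simp add: ln_ge_iff)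
  have m: "real m > 0" "real j \<le> real m" using False assms(4) by auto
  define \<delta> where "\<delta> = (ln y - ln x) / ln x"
  have ly: "ln y = ln x * (1 + \<delta>)" using lnx m by (simp add: \<delta>_def field_simps)
  have "ln x \<le> ln y" using assms x0 by simp
  hence \<delta>: "\<delta> \<ge> 0" using lnx m by (auto simp: \<delta>_def intro!: divide_nonneg_nonneg)
  have "(1 + \<delta>) ^ j \<le> exp \<delta> ^ j" using \<delta> by (intro power_mono) auto
  also have "\<dots> = exp (real j * \<delta>)" by (simp add: exp_of_nat_mult)
  also have "\<dots> \<le> exp (\<sigma> * (ln x * \<delta>))"
  proof -
    have "real j * \<delta> \<le> 1 * (ln x * \<delta>)"
      using m lnx \<delta> by (auto intro!: mult_right_mono)
    also have "\<dots> \<le> \<sigma> * (ln x * \<delta>)"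
      using assms m lnx \<delta> by (intro mult_right_mono) auto
    finally show ?thesis by simp
  qed
  also have "ln x * \<delta> = ln y - ln x" using ly by (simp add: algebra_simps)
  finally have "(1 + \<delta>) ^ j * y powr (- \<sigma>) \<le> exp (\<sigma> * (ln y - ln x)) * y powr (- \<sigma>)"
    by (intro mult_right_mono) auto
  also have "\<dots> = x powr (- \<sigma>)"
    using x0 assms by (simp add: powr_def exp_add[symmetric] algebra_simps)
  finally have "ln x ^ j * ((1 + \<delta>) ^ j * y powr (- \<sigma>)) \<le> ln x ^ j * x powr (- \<sigma>)"
    using lnx m by (intro mult_left_mono) auto
  thus ?thesis by (simp add: ly power_mult_distrib mult_ac)
qed

text \<open>Modulus of the leading part of \<open>plog_term j k\<close> on the line Re s =
  \<sigma>.\<close>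

definition vterm :: "real \<Rightarrow> nat \<Rightarrow> nat \<Rightarrow> real" where
  "vterm \<sigma> j k = ln (nth_prime k) ^ j * real (nth_prime k) powr (- \<sigma>)"

lemma vterm_nonneg: "vterm \<sigma> j k \<ge> 0"
  using nth_prime_ge_2[of k] by (auto simp: vterm_def)

lemma vterm_antimono:
  assumes "real (nth_prime K) \<ge> exp (real m)" "K \<le> k" "k \<le> k'" "\<sigma> \<ge> 1" "j \<le> m"
  shows "vterm \<sigma> j k' \<le> vterm \<sigma> j k"
  unfolding vterm_def
proof (rule ln_power_powr_antimono[where m = m])
  have "nth_prime K \<le> nth_prime k" using assms by simp
  thus "exp (real m) \<le> real (nth_prime k)" using assms(1) by linarith
qed (use assms in auto)

lemma vterm_1_tendsto: "(\<lambda>k. vterm 1 j k) \<longlonglongrightarrow> 0"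
proof -
  obtain C where C: "C \<ge> 0" "\<And>x :: real. x \<ge> 1 \<Longrightarrow> ln x ^ j \<le> C * x powr (1/2)"
    using ln_power_bound[of "1/2" j] by auto
  have "(\<lambda>k. C * real (Suc k) powr (- (1/2))) \<longlonglongrightarrow> C * 0"
    by (intro tendsto_mult tendsto_const tendsto_neg_powr filterlim_compose[OF filterlim_real_sequentially filterlim_Suc]) auto
  moreover have "norm (vterm 1 j k) \<le> C * real (Suc k) powr (- (1/2))" for k
  proof -
    let ?p = "real (nth_prime k)"
    have p: "?p \<ge> real (Suc k)" "?p \<ge> 1" using nth_prime_ge[of k] by linarith+
    have "vterm 1 j k \<le> (C * ?p powr (1/2)) * ?p powr (- 1)"
      unfolding vterm_def using p by (intro mult_right_mono C) auto
    also have "\<dots> = C * ?p powr (- (1/2))"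
      using powr_add[of ?p "1/2" "-1"] by simp
    also have "\<dots> \<le> C * real (Suc k) powr (- (1/2))"
      using p C(1) by (intro mult_left_mono powr_mono2') auto
    finally show ?thesis using vterm_nonneg[of 1 j k] by simp
  qed
  ultimately show ?thesis
    by (intro Lim_null_comparison[of "\<lambda>k. vterm 1 j k"]) (auto intro: always_eventually)
qed

lemma summable_tail_less:
  fixes f :: "nat \<Rightarrow> real"
  assumes "summable f" "e > 0"
  shows "eventually (\<lambda>K. (\<Sum>k. f (k + K)) < e) sequentially"
proof -
  have "(\<lambda>K. suminf f - (\<Sum>k<K. f k)) \<longlonglongrightarrow> suminf f - suminf f"
    by (intro tendsto_diff tendsto_const summable_LIMSEQ assms)
  hence "(\<lambda>K. \<Sum>k. f (k + K)) \<longlonglongrightarrow> 0"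
    by (simp add: suminf_minus_initial_segment[OF assms(1)])
  thus ?thesis using assms(2) by (auto dest: order_tendstoD(2))
qed

lemma even_odd_sum: "(\<Sum>k<2 * n. f k) = (\<Sum>i<n. f (2 * i) + f (2 * i + 1 :: nat) :: 'a :: comm_monoid_add)"
  by (induction n) (simp_all add: add_ac)

text \<open>In each pair the reciprocal at the odd index is the smaller one, so doubling the even
  terms dominates the full sum over primes.\<close>

lemma not_summable_even_primes: "\<not> summable (\<lambda>i. 2 / real (nth_prime (2 * i)))"
proof
  assume sm: "summable (\<lambda>i. 2 / real (nth_prime (2 * i)))"
  let ?f = "\<lambda>k. 1 / real (nth_prime k)"
  have "(\<Sum>k\<le>n. ?f k) \<le> (\<Sum>i. 2 / real (nth_prime (2 * i)))" for n
  proof -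
    have "(\<Sum>k\<le>n. ?f k) \<le> (\<Sum>k<2 * Suc n. ?f k)"
      by (rule sum_mono2) auto
    also have "\<dots> = (\<Sum>i<Suc n. ?f (2 * i) + ?f (2 * i + 1))"
      by (rule even_odd_sum)
    also have "\<dots> \<le> (\<Sum>i<Suc n. 2 / real (nth_prime (2 * i)))"
    proof (rule sum_mono)
      fix i
      have "?f (2 * i + 1) \<le> ?f (2 * i)"
        by (intro divide_left_mono) auto
      thus "?f (2 * i) + ?f (2 * i + 1) \<le> 2 / real (nth_prime (2 * i))" by simp
    qed
    also have "\<dots> \<le> (\<Sum>i. 2 / real (nth_prime (2 * i)))"
      by (rule sum_le_suminf[OF sm]) auto
    finally show ?thesis .
  qed
  hence "summable ?f" by (intro bounded_imp_summable) auto
  thus False using not_summable_inverse_primes by blast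
qed

lemma ln_even_prime_at_top: "filterlim (\<lambda>i. ln (real (nth_prime (2 * i)))) at_top sequentially"
proof (rule filterlim_compose[OF ln_at_top])
  show "filterlim (\<lambda>i. real (nth_prime (2 * i))) at_top sequentially"
  proof (rule filterlim_at_top_mono[OF filterlim_real_sequentially], intro always_eventually allI)
    fix i show "real i \<le> real (nth_prime (2 * i))" using nth_prime_ge[of "2 * i"] by simp
  qed
qed

lemma ppow_line: "ppow k (Complex \<sigma> t) = of_real (real (nth_prime k) powr (- \<sigma>)) * cis (- t * ln (nth_prime k))"
proof -
  have "ppow k (Complex \<sigma> t) = exp (- Complex \<sigma> t * of_real (ln (nth_prime k)))"
    by (simp add: ppow_def powr_def Ln_of_nat mult.commute)
  also have "- Complex \<sigma> t * of_real (ln (nth_prime k)) = of_real (- \<sigma> * ln (nth_prime k)) + \<i> * of_real (- t * ln (nth_prime k))"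
    by (simp add: complex_eq_iff)
  also have "exp \<dots> = of_real (exp (- \<sigma> * ln (nth_prime k))) * cis (- t * ln (nth_prime k))"
    by (simp only: exp_add cis_conv_exp exp_of_real)
  finally show ?thesis by (simp add: powr_def)
qed

text \<open>The nonlinear part is dominated by a convergent series that does not depend on s, even
  up to the line Re s = 1. Beyond finitely many primes only the linear part p^(-s) has to be
  steered.\<close>

lemma norm_plog_term_remainder:
  "\<exists>C\<ge>0. \<forall>k s. Re s \<ge> 1 \<longrightarrow>
    norm (plog_term j k s - of_real (- ln (nth_prime k)) ^ j * ppow k s) \<le> C * vterm 2 j k"
proof -
  obtain C where C: "C \<ge> 0" "\<And>x. norm x \<le> 1/2 \<Longrightarrow> norm (plog j x - x) \<le> C * norm x ^ 2"
    using plog_Taylor[of j] by metis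
  show ?thesis
  proof (intro exI[of _ C] conjI C(1) allI impI)
    fix k and s :: complex assume s: "Re s \<ge> 1"
    have ln: "ln (real (nth_prime k)) \<ge> 0" using nth_prime_ge_2[of k] by simp
    have "norm (ppow k s) \<le> real (nth_prime k) powr (- 1)"
      unfolding norm_ppow using s nth_prime_ge_2[of k] by (intro powr_mono) auto
    hence "norm (ppow k s) ^ 2 \<le> (real (nth_prime k) powr (- 1)) ^ 2"
      by (intro power_mono) auto
    also have "\<dots> = real (nth_prime k) powr (- 2)" by (subst powr_power) auto
    finally have x2: "norm (ppow k s) ^ 2 \<le> real (nth_prime k) powr (- 2)" .
    have "norm (plog_term j k s - of_real (- ln (nth_prime k)) ^ j * ppow k s) =
        ln (nth_prime k) ^ j * norm (plog j (ppow k s) - ppow k s)"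
      unfolding plog_term_def right_diff_distrib[symmetric] using ln by (simp add: norm_mult norm_power)
    also have "\<dots> \<le> ln (nth_prime k) ^ j * (C * norm (ppow k s) ^ 2)"
      using ln norm_ppow_le_half[OF s] by (intro mult_left_mono C) auto
    also have "\<dots> \<le> ln (nth_prime k) ^ j * (C * real (nth_prime k) powr (- 2))"
      using ln C(1) by (intro mult_left_mono x2) auto
    finally show "norm (plog_term j k s - of_real (- ln (nth_prime k)) ^ j * ppow k s) \<le> C * vterm 2 j k"
      by (simp add: vterm_def mult_ac)
  qed
qed

text \<open>Primes are used in consecutive pairs: the two unimodular factors of a pair sum to twice a prescribed
  number of the closed unit disc, and the error of treating the two primes as equal telescopes.\<close>

lemma pair_error:
  fixes \<theta> a :: "nat \<Rightarrow> complex"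
  assumes \<theta>: "\<And>k. norm (\<theta> k) = 1" "\<And>i. i \<ge> N \<Longrightarrow> \<theta> (2 * i) + \<theta> (2 * i + 1) = 2 * a i"
    and anti: "real (nth_prime (2 * N)) \<ge> exp (real m)" "\<sigma> \<ge> 1" "j \<le> m" and "N \<le> Y"
  shows "norm ((\<Sum>k\<in>{2*N..<2*Y}. \<theta> k * of_real (vterm \<sigma> j k)) -
           (\<Sum>i\<in>{N..<Y}. 2 * a i * of_real (vterm \<sigma> j (2 * i)))) \<le> vterm \<sigma> j (2 * N) - vterm \<sigma> j (2 * Y)"
  using \<open>N \<le> Y\<close>
proof (induction Y rule: dec_induct)
  case (step Y)
  let ?v = "vterm \<sigma> j" and ?V = "\<lambda>k. complex_of_real (vterm \<sigma> j k)"
  have "{2*N..<2*Suc Y} = insert (2*Y+1) (insert (2*Y) {2*N..<2*Y})" using step by auto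
  hence "(\<Sum>k\<in>{2*N..<2*Suc Y}. \<theta> k * ?V k) = (\<Sum>k\<in>{2*N..<2*Y}. \<theta> k * ?V k) + \<theta> (2*Y) * ?V (2*Y) + \<theta> (2*Y+1) * ?V (2*Y+1)"
    by simp
  moreover have "(\<Sum>i\<in>{N..<Suc Y}. 2 * a i * ?V (2*i)) = (\<Sum>i\<in>{N..<Y}. 2 * a i * ?V (2*i)) + 2 * a Y * ?V (2*Y)"
    using step by simp
  moreover have "\<theta> (2*Y) * ?V (2*Y) + \<theta> (2*Y+1) * ?V (2*Y+1) = 2 * a Y * ?V (2*Y) - \<theta> (2*Y+1) * (?V (2*Y) - ?V (2*Y+1))"
    unfolding \<theta>(2)[OF step(1), symmetric] by (simp add: algebra_simps)
  ultimately have "(\<Sum>k\<in>{2*N..<2*Suc Y}. \<theta> k * ?V k) - (\<Sum>i\<in>{N..<Suc Y}. 2 * a i * ?V (2*i)) =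
     ((\<Sum>k\<in>{2*N..<2*Y}. \<theta> k * ?V k) - (\<Sum>i\<in>{N..<Y}. 2 * a i * ?V (2*i))) - \<theta> (2*Y+1) * (?V (2*Y) - ?V (2*Y+1))"
    by (simp add: algebra_simps)
  also have "norm \<dots> \<le> (?v (2*N) - ?v (2*Y)) + (?v (2*Y) - ?v (2*Y+1))"
  proof (rule order_trans[OF norm_triangle_ineq4], rule add_mono[OF step.IH])
    have "?v (2*Y+1) \<le> ?v (2*Y)"
      by (rule vterm_antimono[OF anti(1)]) (use step anti in auto)
    thus "norm (\<theta> (2*Y+1) * (?V (2*Y) - ?V (2*Y+1))) \<le> ?v (2*Y) - ?v (2*Y+1)"
      unfolding norm_mult \<theta>(1) of_real_diff[symmetric] norm_of_real by simp
  qed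
  also have "\<dots> \<le> ?v (2*N) - ?v (2 * Suc Y)"
    using vterm_antimono[OF anti(1), of "2*Y+1" "2 * Suc Y" \<sigma> j] step anti by simp
  finally show ?case .
qed simp

text \<open>The order of choices matters. N makes nonlinear tails and pair errors small for every
  abscissa; the moment problem is solved at \<sigma> = 1, which fixes Y; then \<sigma> > 1 is taken
  so close to 1 that the finite sums hardly move; only then is the cutoff Z known beyond which the
  prime sum at \<sigma> is negligible; t comes last.\<close>

lemma log_zeta_jets_dense:
  fixes l :: "nat \<Rightarrow> complex"
  assumes "e > 0"
  shows "\<exists>z. 1 < Re z \<and> Re z \<le> 2 \<and> \<bar>Im z\<bar> \<ge> T \<and> (\<forall>j\<le>m. norm (log_zeta j z - l j) < e)"
proof -
  \<comment> \<open>Seven errors below \<eta> are collected at the end.\<close>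
  define \<eta> where "\<eta> = e / 8"
  have \<eta>: "\<eta> > 0" using assms by (simp add: \<eta>_def)
  let ?c = "\<lambda>j. (- 1 :: complex) ^ j"
  have sgn: "of_real (- ln (nth_prime k)) ^ j = ?c j * of_real (ln (nth_prime k)) ^ j" for j k
    by (simp add: power_mult_distrib[symmetric])

  have "\<forall>j. \<exists>C\<ge>0. \<forall>k s. Re s \<ge> 1 \<longrightarrow>
    norm (plog_term j k s - of_real (- ln (nth_prime k)) ^ j * ppow k s) \<le> C * vterm 2 j k"
    using norm_plog_term_remainder by blast
  then obtain C where C: "\<And>j. C j \<ge> 0" "\<And>j k s. Re s \<ge> 1 \<Longrightarrow>
    norm (plog_term j k s - of_real (- ln (nth_prime k)) ^ j * ppow k s) \<le> C j * vterm 2 j k"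
    by metis
  have smv: "summable (vterm \<sigma> j)" if "\<sigma> > 1" for \<sigma> j
    using ln_prime_power_summable[OF that] by (simp add: vterm_def[abs_def])
  have "eventually (\<lambda>K. (\<Sum>k. C j * vterm 2 j (k + K)) < \<eta>) sequentially" for j
    using smv[of 2 j] \<eta> by (intro summable_tail_less[of "\<lambda>k. C j * vterm 2 j k"] summable_mult) auto
  moreover have "eventually (\<lambda>K. vterm 1 j K < \<eta>) sequentially" for j
    using vterm_1_tendsto \<eta> by (rule order_tendstoD)
  moreover have "eventually (\<lambda>K. exp (real m) \<le> real (nth_prime K)) sequentially"
  proof -
    have "filterlim (\<lambda>K. real (nth_prime K)) at_top sequentially"
      by (rule filterlim_at_top_mono[OF filterlim_real_sequentially], intro always_eventually allI)
         (use nth_prime_ge in \<open>auto intro: le_trans[OF _ nth_prime_ge]\<close>)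
    thus ?thesis by (simp add: filterlim_at_top)
  qed
  ultimately have "eventually (\<lambda>K. (\<forall>j\<in>{..m}. (\<Sum>k. C j * vterm 2 j (k + K)) < \<eta>) \<and> (\<forall>j\<in>{..m}. vterm 1 j K < \<eta>) \<and>
      exp (real m) \<le> real (nth_prime K)) sequentially"
    by (intro eventually_conj eventually_ball_finite) auto
  then obtain N where N': "\<And>K. K \<ge> N \<Longrightarrow> (\<forall>j\<in>{..m}. (\<Sum>k. C j * vterm 2 j (k + K)) < \<eta>) \<and> (\<forall>j\<in>{..m}. vterm 1 j K < \<eta>) \<and>
      exp (real m) \<le> real (nth_prime K)"
    by (auto simp: eventually_sequentially)
  have N: "\<And>j. j \<le> m \<Longrightarrow> (\<Sum>k. C j * vterm 2 j (k + 2 * N)) < \<eta>" "\<And>j. j \<le> m \<Longrightarrow> vterm 1 j (2 * N) < \<eta>"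
     "exp (real m) \<le> real (nth_prime (2 * N))"
    using N'[of "2 * N"] by auto

  \<comment> \<open>The target less the contribution of the first 2 N primes, taken with \<theta> =
    1; the sign comes from (- log p)^j.\<close>
  define w where "w j = ?c j * (l j - (\<Sum>k<2*N. plog_term j k 1))" for j
  obtain Y and a :: "nat \<Rightarrow> complex" where Y: "Y \<ge> N" "weights N Y a"
    "\<And>j. j < Suc m \<Longrightarrow> moment (\<lambda>i. 2 / real (nth_prime (2 * i))) (\<lambda>i. ln (real (nth_prime (2 * i)))) a Y j = w j"
    using prescribed_moments[OF _ not_summable_even_primes ln_even_prime_at_top, of N "Suc m" w] by auto
  define W where "W \<sigma> j = (\<Sum>i\<in>{N..<Y}. 2 * a i * of_real (vterm \<sigma> j (2 * i)))" for \<sigma> j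
  have W1: "W 1 j = w j" if "j \<le> m" for j
  proof -
    have "w j = (\<Sum>i<Y. a i * of_real (2 / real (nth_prime (2 * i)) * ln (real (nth_prime (2 * i))) ^ j))"
      using Y(3)[of j] that by (simp add: moment_def)
    also have "\<dots> = (\<Sum>i\<in>{N..<Y}. a i * of_real (2 / real (nth_prime (2 * i)) * ln (real (nth_prime (2 * i))) ^ j))"
      by (rule sum.mono_neutral_right) (use weights_0[OF Y(2)] in auto)
    also have "\<dots> = W 1 j"
      unfolding W_def by (intro sum.cong refl) (simp add: vterm_def powr_minus field_simps)
    finally show ?thesis ..
  qed
  have "\<forall>i. \<exists>p. norm (fst p) = 1 \<and> norm (snd p) = 1 \<and> fst p + snd p = 2 * a i"
    using unit_pair weights_le[OF Y(2)] by (metis fst_conv snd_conv)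
  then obtain p where p: "\<And>i. norm (fst (p i)) = 1" "\<And>i. norm (snd (p i)) = 1" "\<And>i. fst (p i) + snd (p i) = 2 * a i"
    by metis
  \<comment> \<open>The first 2 N primes act as at the real point \<sigma>, with their full local
    factors. For pairs from Y on \<open>a\<close> is 0, so the two factors of a pair are
    opposite.\<close>
  define \<theta> where "\<theta> k = (if k < 2 * N then 1 else if even k then fst (p (k div 2)) else snd (p (k div 2)))" for k
  have \<theta>: "norm (\<theta> k) = 1" for k by (simp add: \<theta>_def p)
  have \<theta>_pair: "\<theta> (2 * i) + \<theta> (2 * i + 1) = 2 * a i" if "i \<ge> N" for i
    using that p(3)[of i] by (simp add: \<theta>_def)

  have "eventually (\<lambda>\<sigma>. dist (W \<sigma> j) (W 1 j) < \<eta>) (at_right 1)" for j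
  proof (rule tendstoD[OF _ \<eta>])
    show "((\<lambda>\<sigma>. W \<sigma> j) \<longlongrightarrow> W 1 j) (at_right 1)"
      unfolding W_def vterm_def by (auto intro!: tendsto_eq_intros)
  qed
  moreover have "eventually (\<lambda>\<sigma>. dist (\<Sum>k<2*N. plog_term j k (of_real \<sigma>)) (\<Sum>k<2*N. plog_term j k 1) < \<eta>) (at_right 1)" for j
  proof (rule tendstoD[OF _ \<eta>], rule tendsto_sum)
    fix k
    have "isCont (plog_term j k) 1"
      using plog_term_deriv[of 1 j k] DERIV_isCont by auto
    moreover have "((\<lambda>\<sigma>. complex_of_real \<sigma>) \<longlongrightarrow> 1) (at_right 1)"
      by (auto intro!: tendsto_eq_intros)
    ultimately show "((\<lambda>\<sigma>. plog_term j k (of_real \<sigma>)) \<longlongrightarrow> plog_term j k 1) (at_right 1)"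
      by (rule isCont_tendsto_compose)
  qed
  moreover have "eventually (\<lambda>\<sigma>. \<sigma> \<in> {1<..<2}) (at_right (1 :: real))"
    by (rule eventually_at_right_real) simp
  ultimately have "eventually (\<lambda>\<sigma>. (\<forall>j\<in>{..m}. dist (W \<sigma> j) (W 1 j) < \<eta>) \<and>
      (\<forall>j\<in>{..m}. dist (\<Sum>k<2*N. plog_term j k (of_real \<sigma>)) (\<Sum>k<2*N. plog_term j k 1) < \<eta>) \<and> \<sigma> \<in> {1<..<2}) (at_right 1)"
    by (intro eventually_conj eventually_ball_finite) auto
  then obtain \<sigma> where \<sigma>: "1 < \<sigma>" "\<sigma> < 2" "\<And>j. j \<le> m \<Longrightarrow> dist (W \<sigma> j) (W 1 j) < \<eta>"
     "\<And>j. j \<le> m \<Longrightarrow> dist (\<Sum>k<2*N. plog_term j k (of_real \<sigma>)) (\<Sum>k<2*N. plog_term j k 1) < \<eta>"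
    by (auto dest!: eventually_happens)

  have "eventually (\<lambda>K. (\<Sum>k. vterm \<sigma> j (k + K)) < \<eta>) sequentially" for j
    using smv[OF \<sigma>(1)] \<eta> by (rule summable_tail_less)
  hence "eventually (\<lambda>K. \<forall>j\<in>{..m}. (\<Sum>k. vterm \<sigma> j (k + K)) < \<eta>) sequentially"
    by (intro eventually_ball_finite) auto
  then obtain Y' where Y': "\<And>K. K \<ge> Y' \<Longrightarrow> \<forall>j\<in>{..m}. (\<Sum>k. vterm \<sigma> j (k + K)) < \<eta>"
    by (auto simp: eventually_sequentially)
  define Z where "Z = max Y Y'"
  have Z: "Z \<ge> Y" "Z \<ge> N" "\<And>j. j \<le> m \<Longrightarrow> (\<Sum>k. vterm \<sigma> j (k + 2 * Z)) < \<eta>"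
    using Y'[of "2 * Z"] Y(1) by (auto simp: Z_def)

  obtain t :: "nat \<Rightarrow> real" where t: "\<And>n. \<bar>t n\<bar> \<ge> real n"
     "\<And>k. k < 2 * Z \<Longrightarrow> (\<lambda>n. cis (- t n * ln (nth_prime k))) \<longlonglongrightarrow> \<theta> k"
    using kronecker_primes_seq[of "2 * Z" \<theta>] \<theta> by metis
  have pp: "(\<lambda>n. ppow k (Complex \<sigma> (t n))) \<longlonglongrightarrow> \<theta> k * of_real (real (nth_prime k) powr (- \<sigma>))" if "k < 2 * Z" for k
    unfolding ppow_line mult.commute[of "\<theta> k"] by (intro tendsto_mult tendsto_const t(2) that)
  have "eventually (\<lambda>n. dist (\<Sum>k<2*N. plog_term j k (Complex \<sigma> (t n))) (\<Sum>k<2*N. plog_term j k (of_real \<sigma>)) < \<eta>) sequentially" for j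
  proof (rule tendstoD[OF _ \<eta>], rule tendsto_sum)
    fix k assume k: "k \<in> {..<2*N}"
    have eq: "ppow k (of_real \<sigma>) = \<theta> k * of_real (real (nth_prime k) powr (- \<sigma>))"
      using ppow_line[of k \<sigma> 0] k by (simp add: \<theta>_def Complex_eq)
    have "isCont (plog j) (ppow k (of_real \<sigma>))"
      by (rule continuous_on_interior[of "ball 0 1"])
         (use norm_ppow_less_1[of "of_real \<sigma>" k] \<sigma>(1) in \<open>auto intro!: holomorphic_on_imp_continuous_on plog_holomorphic\<close>)
    from isCont_tendsto_compose[OF this] pp[of k] k Z
    have "(\<lambda>n. plog j (ppow k (Complex \<sigma> (t n)))) \<longlonglongrightarrow> plog j (ppow k (of_real \<sigma>))" unfolding eq by auto
    thus "(\<lambda>n. plog_term j k (Complex \<sigma> (t n))) \<longlonglongrightarrow> plog_term j k (of_real \<sigma>)"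
      unfolding plog_term_def by (intro tendsto_intros)
  qed
  moreover have "eventually (\<lambda>n. dist (\<Sum>k\<in>{2*N..<2*Z}. of_real (- ln (nth_prime k)) ^ j * ppow k (Complex \<sigma> (t n)))
       (\<Sum>k\<in>{2*N..<2*Z}. of_real (- ln (nth_prime k)) ^ j * (\<theta> k * of_real (real (nth_prime k) powr (- \<sigma>)))) < \<eta>) sequentially" for j
    by (rule tendstoD[OF _ \<eta>], intro tendsto_sum tendsto_mult tendsto_const pp) auto
  ultimately have "eventually (\<lambda>n. (\<forall>j\<in>{..m}. dist (\<Sum>k<2*N. plog_term j k (Complex \<sigma> (t n))) (\<Sum>k<2*N. plog_term j k (of_real \<sigma>)) < \<eta>) \<and>
      (\<forall>j\<in>{..m}. dist (\<Sum>k\<in>{2*N..<2*Z}. of_real (- ln (nth_prime k)) ^ j * ppow k (Complex \<sigma> (t n)))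
       (\<Sum>k\<in>{2*N..<2*Z}. of_real (- ln (nth_prime k)) ^ j * (\<theta> k * of_real (real (nth_prime k) powr (- \<sigma>)))) < \<eta>) \<and> n \<ge> nat \<lceil>T\<rceil>) sequentially"
    by (intro eventually_conj eventually_ball_finite eventually_ge_at_top) auto
  then obtain n where n: "n \<ge> nat \<lceil>T\<rceil>"
    "\<And>j. j \<le> m \<Longrightarrow> dist (\<Sum>k<2*N. plog_term j k (Complex \<sigma> (t n))) (\<Sum>k<2*N. plog_term j k (of_real \<sigma>)) < \<eta>"
    "\<And>j. j \<le> m \<Longrightarrow> dist (\<Sum>k\<in>{2*N..<2*Z}. of_real (- ln (nth_prime k)) ^ j * ppow k (Complex \<sigma> (t n)))
       (\<Sum>k\<in>{2*N..<2*Z}. of_real (- ln (nth_prime k)) ^ j * (\<theta> k * of_real (real (nth_prime k) powr (- \<sigma>)))) < \<eta>"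
    by (auto dest!: eventually_happens)
  define z where "z = Complex \<sigma> (t n)"
  have Rez: "Re z = \<sigma>" by (simp add: z_def)
  have "\<bar>Im z\<bar> \<ge> T" using t(1)[of n] n(1) by (simp add: z_def)
  moreover have "norm (log_zeta j z - l j) < e" if j: "j \<le> m" for j
  proof -
    define P where "P k = of_real (- ln (nth_prime k)) ^ j * ppow k z" for k
    define L where "L k = plog_term j k z" for k
    have nP: "norm (P k) = vterm \<sigma> j k" for k
      using nth_prime_ge_2[of k] by (simp add: P_def norm_mult norm_power norm_ppow Rez vterm_def)
    have smP: "summable P" by (rule summable_norm_cancel) (simp add: nP smv \<sigma>(1))
    have smL: "summable L" using log_zeta_sums[of z j] \<sigma>(1) by (simp add: L_def[abs_def] sums_iff Rez)
    have "log_zeta j z = (\<Sum>k. L k)" by (simp add: log_zeta_def L_def)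
    also have "\<dots> = (\<Sum>k. L (k + 2*N)) + (\<Sum>k<2*N. L k)"
      by (rule suminf_split_initial_segment[OF smL])
    also have "(\<Sum>k. L (k + 2*N)) = (\<Sum>k. L (k + 2*N) - P (k + 2*N)) + (\<Sum>k. P (k + 2*N))"
      by (subst suminf_diff[symmetric]) (use smL smP in \<open>auto simp: summable_iff_shift\<close>)
    also have "(\<Sum>k. P (k + 2*N)) = (\<Sum>k. P (k + 2*Z)) + (\<Sum>k\<in>{2*N..<2*Z}. P k)"
    proof -
      have "(\<Sum>k. P (k + 2*N)) + (\<Sum>k<2*N. P k) = (\<Sum>k. P (k + 2*Z)) + (\<Sum>k<2*Z. P k)"
        by (simp only: suminf_split_initial_segment[OF smP, symmetric])
      moreover have "(\<Sum>k<2*Z. P k) = (\<Sum>k<2*N. P k) + (\<Sum>k\<in>{2*N..<2*Z}. P k)"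
        using Z(2) by (simp add: lessThan_atLeast0 sum.atLeastLessThan_concat)
      ultimately show ?thesis by (simp add: algebra_simps)
    qed
    finally have split: "log_zeta j z = (\<Sum>k. L (k + 2*N) - P (k + 2*N)) + ((\<Sum>k. P (k + 2*Z)) + (\<Sum>k\<in>{2*N..<2*Z}. P k)) + (\<Sum>k<2*N. L k)" .
    have lj: "l j = ?c j * W 1 j + (\<Sum>k<2*N. plog_term j k 1)"
      unfolding W1[OF j] w_def by (simp add: power_mult_distrib[symmetric] mult.assoc[symmetric])
    define \<Theta> where "\<Theta> = (\<Sum>k\<in>{2*N..<2*Z}. of_real (- ln (nth_prime k)) ^ j * (\<theta> k * of_real (real (nth_prime k) powr (- \<sigma>))))"
    have 1: "norm (\<Sum>k. L (k + 2*N) - P (k + 2*N)) < \<eta>"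
    proof -
      have sm: "summable (\<lambda>k. C j * vterm 2 j (k + 2*N))"
        by (intro summable_mult summable_ignore_initial_segment smv) auto
      have "norm (\<Sum>k. L (k + 2*N) - P (k + 2*N)) \<le> (\<Sum>k. C j * vterm 2 j (k + 2*N))"
        by (rule norm_suminf_le[OF _ sm]) (use C(2)[of z j] \<sigma>(1) in \<open>auto simp: L_def P_def Rez\<close>)
      also have "\<dots> < \<eta>" by (rule N(1)[OF j])
      finally show ?thesis .
    qed
    have 2: "norm (\<Sum>k. P (k + 2*Z)) < \<eta>"
    proof -
      have "norm (\<Sum>k. P (k + 2*Z)) \<le> (\<Sum>k. vterm \<sigma> j (k + 2*Z))"
        by (rule norm_suminf_le) (auto simp: nP intro!: summable_ignore_initial_segment smv \<sigma>(1))
      also have "\<dots> < \<eta>" by (rule Z(3)[OF j])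
      finally show ?thesis .
    qed
    have 3: "norm ((\<Sum>k\<in>{2*N..<2*Z}. P k) - \<Theta>) < \<eta>"
      using n(3)[OF j] by (simp add: P_def \<Theta>_def dist_norm z_def)
    have 4: "norm (\<Theta> - ?c j * W \<sigma> j) < \<eta>"
    proof -
      have "\<Theta> = ?c j * (\<Sum>k\<in>{2*N..<2*Z}. \<theta> k * of_real (vterm \<sigma> j k))"
        unfolding \<Theta>_def sgn sum_distrib_left by (intro sum.cong refl) (simp add: vterm_def mult_ac)
      moreover have "W \<sigma> j = (\<Sum>i\<in>{N..<Z}. 2 * a i * of_real (vterm \<sigma> j (2 * i)))"
        unfolding W_def by (rule sum.mono_neutral_left) (use Z weights_0[OF Y(2)] in auto)
      ultimately have "norm (\<Theta> - ?c j * W \<sigma> j) = norm ((\<Sum>k\<in>{2*N..<2*Z}. \<theta> k * of_real (vterm \<sigma> j k)) -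
           (\<Sum>i\<in>{N..<Z}. 2 * a i * of_real (vterm \<sigma> j (2 * i))))"
        by (simp only: right_diff_distrib[symmetric] norm_mult norm_power) simp
      also have "\<dots> \<le> vterm \<sigma> j (2 * N) - vterm \<sigma> j (2 * Z)"
        by (rule pair_error[OF \<theta> \<theta>_pair N(3)]) (use \<sigma> j Z in auto)
      also have "\<dots> \<le> vterm \<sigma> j (2 * N)" using vterm_nonneg by simp
      also have "\<dots> \<le> vterm 1 j (2 * N)"
        unfolding vterm_def using nth_prime_ge_2[of "2*N"] \<sigma>(1) by (intro mult_left_mono powr_mono) auto
      also have "\<dots> < \<eta>" by (rule N(2)[OF j])
      finally show ?thesis .
    qed
    have 5: "norm (?c j * W \<sigma> j - ?c j * W 1 j) < \<eta>"
      using \<sigma>(3)[OF j] by (simp only: right_diff_distrib[symmetric] norm_mult norm_power dist_norm) simp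
    have 6: "norm ((\<Sum>k<2*N. L k) - (\<Sum>k<2*N. plog_term j k (of_real \<sigma>))) < \<eta>"
      using n(2)[OF j] by (simp add: L_def dist_norm z_def)
    have 7: "norm ((\<Sum>k<2*N. plog_term j k (of_real \<sigma>)) - (\<Sum>k<2*N. plog_term j k 1)) < \<eta>"
      using \<sigma>(4)[OF j] by (simp add: dist_norm)
    have tri: "norm (x1 + ((x2 + x3) + x4) - (y1 + y2)) < 7 * \<eta>"
      if "norm x1 < \<eta>" "norm x2 < \<eta>" "norm (x3 - h) < \<eta>" "norm (h - h') < \<eta>" "norm (h' - y1) < \<eta>"
         "norm (x4 - g) < \<eta>" "norm (g - y2) < \<eta>" for x1 x2 x3 x4 y1 y2 h h' g :: complex
    proof -
      have "x1 + ((x2 + x3) + x4) - (y1 + y2) = x1 + x2 + (x3 - h) + (h - h') + (h' - y1) + (x4 - g) + (g - y2)"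
        by simp
      also have "norm \<dots> \<le> norm x1 + norm x2 + norm (x3 - h) + norm (h - h') + norm (h' - y1) + norm (x4 - g) + norm (g - y2)"
        by (intro norm_triangle_mono order_refl)
      finally show ?thesis using that by linarith
    qed
    have "norm (log_zeta j z - l j) < 7 * \<eta>"
      unfolding split lj using tri[OF 1 2 3 4 5 6 7] by (simp only: add.assoc)
    thus ?thesis using assms by (simp add: \<eta>_def)
  qed
  ultimately show ?thesis using \<sigma> Rez by (intro exI[of _ z]) auto
qed

section \<open>From jets of log zeta to jets of zeta\<close>

text \<open>\<open>exp_jet l\<close> is the sequence of derivatives of \<open>exp \<circ> f\<close> at a point where \<open>f\<close> has derivatives \<open>l\<close>.\<close>

fun exp_jet :: "(nat \<Rightarrow> complex) \<Rightarrow> nat \<Rightarrow> complex" where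
  "exp_jet l 0 = exp (l 0)"
| "exp_jet l (Suc j) = (\<Sum>i\<le>j. of_nat (j choose i) * exp_jet l i * l (Suc (j - i)))"

text \<open>One differentiation gives exp(f) f'; the Leibniz rule for this product reproduces the
  recursion, which refers to all lower orders.\<close>

lemma higher_deriv_exp:
  assumes "f holomorphic_on S" "open S" "z \<in> S"
  shows "(deriv ^^ j) (\<lambda>z. exp (f z)) z = exp_jet (\<lambda>i. (deriv ^^ i) f z) j"
proof (induction j rule: less_induct)
  case (less j)
  show ?case
  proof (cases j)
    case (Suc k)
    have der: "deriv (\<lambda>z. exp (f z)) w = exp (f w) * deriv f w" if "w \<in> S" for w
      using holomorphic_derivI[OF assms(1,2) that] by (auto intro!: DERIV_imp_deriv derivative_eq_intros)
    have hol: "(\<lambda>z. exp (f z)) holomorphic_on S" by (intro holomorphic_intros assms)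
    have "(deriv ^^ Suc k) (\<lambda>z. exp (f z)) z = (deriv ^^ k) (deriv (\<lambda>z. exp (f z))) z"
      by (simp add: funpow_swap1)
    also have "\<dots> = (deriv ^^ k) (\<lambda>w. exp (f w) * deriv f w) z"
      by (rule higher_deriv_transform_within_open[where S = S])
         (use assms hol der in \<open>auto intro!: holomorphic_intros holomorphic_deriv\<close>)
    also have "\<dots> = (\<Sum>i = 0..k. of_nat (k choose i) * (deriv ^^ i) (\<lambda>z. exp (f z)) z * (deriv ^^ (k - i)) (deriv f) z)"
      by (rule higher_deriv_mult[where S = S]) (use assms hol in \<open>auto intro!: holomorphic_deriv\<close>)
    also have "\<dots> = (\<Sum>i\<le>k. of_nat (k choose i) * exp_jet (\<lambda>i. (deriv ^^ i) f z) i * (deriv ^^ Suc (k - i)) f z)"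
      by (intro sum.cong) (auto simp: less Suc funpow_swap1)
    finally show ?thesis by (simp add: Suc)
  qed simp
qed

lemma exp_jet_tendsto:
  assumes "\<And>i. i \<le> j \<Longrightarrow> ((\<lambda>n. l n i) \<longlongrightarrow> l' i) F"
  shows "((\<lambda>n. exp_jet (l n) j) \<longlongrightarrow> exp_jet l' j) F"
  using assms
proof (induction j rule: less_induct)
  case (less j)
  show ?case
  proof (cases j)
    case 0
    thus ?thesis using less.prems by (auto intro!: tendsto_intros)
  next
    case (Suc k)
    have "((\<lambda>n. \<Sum>i\<le>k. of_nat (k choose i) * exp_jet (l n) i * l n (Suc (k - i))) \<longlongrightarrow>
       (\<Sum>i\<le>k. of_nat (k choose i) * exp_jet l' i * l' (Suc (k - i)))) F"
      by (intro tendsto_sum tendsto_mult tendsto_const less) (auto simp: Suc)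
    thus ?thesis by (simp add: Suc)
  qed
qed

text \<open>Continuity applied to constant sequences: \<open>exp_jet_tendsto\<close> asks for
  convergence of the entries up to j only, so no other entry can matter.\<close>

lemma exp_jet_cong: "(\<And>i. i \<le> j \<Longrightarrow> l i = l' i) \<Longrightarrow> exp_jet l j = exp_jet l' j"
  using exp_jet_tendsto[of j "\<lambda>_::nat. l" l' sequentially] by (simp add: LIMSEQ_const_iff)

text \<open>The entry of index m + 1 enters order m + 1 linearly with factor exp (l 0) = u 0 and
  leaves lower orders alone, so the entries are solved for one at a time.\<close>

lemma exp_jet_surj:
  assumes "u 0 \<noteq> 0"
  shows "\<exists>l. \<forall>j\<le>m. exp_jet l j = u j"
proof (induction m)
  case 0
  show ?case by (rule exI[of _ "\<lambda>_. Ln (u 0)"]) (use assms in auto)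
next
  case (Suc m)
  then obtain l where l: "\<And>j. j \<le> m \<Longrightarrow> exp_jet l j = u j" by blast
  define r where "r = (\<Sum>i\<in>{1..m}. of_nat (m choose i) * exp_jet l i * l (Suc (m - i)))"
  define l' where "l' = l(Suc m := (u (Suc m) - r) / u 0)"
  have old: "exp_jet l' j = exp_jet l j" if "j \<le> m" for j
    by (rule exp_jet_cong) (use that in \<open>auto simp: l'_def\<close>)
  have "exp_jet l' (Suc m) = (\<Sum>i\<le>m. of_nat (m choose i) * exp_jet l i * l' (Suc (m - i)))"
    by (simp add: old)
  also have "\<dots> = exp_jet l 0 * l' (Suc m) + (\<Sum>i\<in>{1..m}. of_nat (m choose i) * exp_jet l i * l' (Suc (m - i)))"
    by (simp add: atMost_atLeast0 sum.atLeast_Suc_atMost)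
  also have "(\<Sum>i\<in>{1..m}. of_nat (m choose i) * exp_jet l i * l' (Suc (m - i))) = r"
    unfolding r_def by (intro sum.cong) (auto simp: l'_def)
  also have "exp_jet l 0 * l' (Suc m) + r = u (Suc m)"
    using assms l[of 0] by (simp add: l'_def del: exp_jet.simps)
  finally show ?case
    using l old by (intro exI[of _ l']) (auto simp: le_Suc_eq simp del: exp_jet.simps)
qed

theorem zeta_jets_dense:
  fixes u :: "nat \<Rightarrow> complex"
  assumes "e > 0"
  shows "\<exists>z. 1 < Re z \<and> Re z \<le> 2 \<and> \<bar>Im z\<bar> \<ge> T \<and> (\<forall>j\<le>m. norm ((deriv ^^ j) riemann_zeta z - u j) < e)"
proof -
  \<comment> \<open>The exponential never vanishes, so a target value 0 for zeta itself is first
    moved to e / 2, which uses half of the tolerance.\<close>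
  define u' where "u' = (if u 0 = 0 then u(0 := of_real (e / 2)) else u)"
  have u': "u' 0 \<noteq> 0" "norm (u' j - u j) \<le> e / 2" for j
    using assms by (auto simp: u'_def norm_divide)
  obtain l where l: "\<And>j. j \<le> m \<Longrightarrow> exp_jet l j = u' j"
    using exp_jet_surj[of u' m] u'(1) by blast
  have "\<forall>n. \<exists>z. 1 < Re z \<and> Re z \<le> 2 \<and> \<bar>Im z\<bar> \<ge> T \<and> (\<forall>j\<le>m. norm (log_zeta j z - l j) < inverse (real (Suc n)))"
    by (intro allI log_zeta_jets_dense) simp
  then obtain z where z: "\<And>n. 1 < Re (z n)" "\<And>n. Re (z n) \<le> 2" "\<And>n. \<bar>Im (z n)\<bar> \<ge> T"
     "\<And>n j. j \<le> m \<Longrightarrow> norm (log_zeta j (z n) - l j) < inverse (real (Suc n))"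
    by metis
  have lim: "(\<lambda>n. log_zeta j (z n)) \<longlonglongrightarrow> l j" if j: "j \<le> m" for j
  proof -
    have "(\<lambda>n. log_zeta j (z n) - l j) \<longlonglongrightarrow> 0"
      by (rule Lim_null_comparison[OF _ LIMSEQ_inverse_real_of_nat])
         (use z(4)[OF j] in \<open>auto intro!: always_eventually less_imp_le simp del: of_nat_Suc\<close>)
    thus ?thesis by (simp add: LIM_zero_iff)
  qed
  have eq: "(deriv ^^ j) riemann_zeta (z n) = exp_jet (\<lambda>i. log_zeta i (z n)) j" for j n
  proof -
    have "(deriv ^^ j) riemann_zeta (z n) = exp_jet (\<lambda>i. (deriv ^^ i) (log_zeta 0) (z n)) j"
      unfolding higher_deriv_riemann_zeta[OF z(1)]
      by (rule higher_deriv_exp[OF log_zeta_holomorphic]) (use z(1) in \<open>auto simp: open_halfspace_Re_gt\<close>)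
    thus ?thesis by (simp add: higher_deriv_log_zeta z(1))
  qed
  have "eventually (\<lambda>n. dist ((deriv ^^ j) riemann_zeta (z n)) (u' j) < e / 2) sequentially" if "j \<le> m" for j
  proof (rule tendstoD)
    show "(\<lambda>n. (deriv ^^ j) riemann_zeta (z n)) \<longlonglongrightarrow> u' j"
      unfolding eq l[OF that, symmetric] by (intro exp_jet_tendsto lim) (use that in auto)
  qed (use assms in auto)
  hence "eventually (\<lambda>n. \<forall>j\<in>{..m}. dist ((deriv ^^ j) riemann_zeta (z n)) (u' j) < e / 2) sequentially"
    by (intro eventually_ball_finite) auto
  then obtain n where n: "\<And>j. j \<le> m \<Longrightarrow> dist ((deriv ^^ j) riemann_zeta (z n)) (u' j) < e / 2"
    by (auto dest!: eventually_happens)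
  have "norm ((deriv ^^ j) riemann_zeta (z n) - u j) < e" if "j \<le> m" for j
    using norm_triangle_ineq[of "(deriv ^^ j) riemann_zeta (z n) - u' j" "u' j - u j"] n[OF that] u'(2)[of j]
    by (simp add: dist_norm)
  thus ?thesis using z by blast
qed

subsection \<open>The gamma function in a vertical strip\<close>

text \<open>The mean of the lower bounds norm z and k; it makes series over k comparable with real
  series in norm z + k.\<close>

lemma norm_add_nat_ge:
  assumes "Re z \<ge> 1"
  shows "norm (z + of_nat k) \<ge> (norm z + real k) / 2"
proof -
  have "norm z \<le> norm (z + of_nat k)"
    using assms by (auto simp: cmod_def intro!: real_sqrt_le_mono add_mono power_mono)
  moreover have "real k \<le> norm (z + of_nat k)"
    using complex_Re_le_cmod[of "z + of_nat k"] assms by simp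
  ultimately show ?thesis by simp
qed

text \<open>Two of the powers are compared with the telescoping 2 (1/x - 1/(x + 1)); the other n - 1
  are bounded by their value at r.\<close>

lemma inverse_power_series_bound:
  assumes "r \<ge> (1 :: real)" "n \<ge> 1"
  shows "summable (\<lambda>k. 1 / (r + real k) ^ Suc n)" "(\<Sum>k. 1 / (r + real k) ^ Suc n) \<le> 2 / r ^ n"
proof -
  have tel: "(\<lambda>k. 1 / (r + real k) - 1 / (r + real (Suc k))) sums (1 / (r + real 0) - 0)"
  proof (rule telescope_sums')
    have "filterlim (\<lambda>k. r + real k) at_top sequentially"
      by (intro filterlim_tendsto_add_at_top[OF tendsto_const] filterlim_real_sequentially)
    thus "(\<lambda>k. 1 / (r + real k)) \<longlonglongrightarrow> 0"
      by (rule real_tendsto_divide_at_top[OF tendsto_const])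
  qed
  have s: "(\<lambda>k. 2 / r ^ (n - 1) * (1 / (r + real k) - 1 / (r + real (Suc k)))) sums (2 / r ^ (n - 1) * (1 / r))"
    using sums_mult[OF tel, of "2 / r ^ (n - 1)"] by simp
  have le: "1 / (r + real k) ^ Suc n \<le> 2 / r ^ (n - 1) * (1 / (r + real k) - 1 / (r + real (Suc k)))" for k
  proof -
    define x where "x = r + real k"
    have x: "x \<ge> r" "x \<ge> 1" using assms by (auto simp: x_def)
    have "Suc n = (n - 1) + 2" using assms by simp
    hence "1 / x ^ Suc n = 1 / x ^ (n - 1) * (1 / x ^ 2)" by (simp only: power_add) simp
    also have "\<dots> \<le> 1 / r ^ (n - 1) * (2 * (1 / x - 1 / (x + 1)))"
    proof (rule mult_mono)
      show "1 / x ^ (n - 1) \<le> 1 / r ^ (n - 1)"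
        using x assms by (intro divide_left_mono power_mono mult_pos_pos zero_less_power) auto
      have "1 / x - 1 / (x + 1) = 1 / (x * (x + 1))" using x by (simp add: field_simps)
      moreover have "1 / x ^ 2 \<le> 2 / (x * (x + 1))"
      proof -
        have "x * (x + 1) \<le> x * (2 * x)" using x by (intro mult_left_mono) auto
        hence "2 / (x * (2 * x)) \<le> 2 / (x * (x + 1))"
          using x by (intro divide_left_mono mult_pos_pos) auto
        thus ?thesis by (simp add: power2_eq_square)
      qed
      ultimately show "1 / x ^ 2 \<le> 2 * (1 / x - 1 / (x + 1))" by simp
    qed (use x assms in auto)
    finally show ?thesis by (simp add: x_def add_ac)
  qed
  show sm: "summable (\<lambda>k. 1 / (r + real k) ^ Suc n)"
    by (rule summable_comparison_test'[OF sums_summable[OF s], of 0]) (use le assms in auto)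
  have "(\<Sum>k. 1 / (r + real k) ^ Suc n) \<le> (\<Sum>k. 2 / r ^ (n - 1) * (1 / (r + real k) - 1 / (r + real (Suc k))))"
    by (rule suminf_le[OF le sm sums_summable[OF s]])
  also have "\<dots> = 2 / r ^ n"
    using s assms by (simp add: sums_iff power_eq_if)
  finally show "(\<Sum>k. 1 / (r + real k) ^ Suc n) \<le> 2 / r ^ n" .
qed

lemma norm_ge_1: "Re z \<ge> 1 \<Longrightarrow> norm z \<ge> 1"
  using complex_Re_le_cmod[of z] by linarith

lemma norm_inverse_power_le:
  assumes "Re z \<ge> 1"
  shows "norm (inverse ((z + of_nat k) ^ n)) \<le> 2 ^ n * (1 / (norm z + real k) ^ n)"
proof -
  have "norm (inverse ((z + of_nat k) ^ n)) = 1 / norm (z + of_nat k) ^ n"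
    by (simp add: norm_inverse norm_power inverse_eq_divide norm_divide)
  also have "\<dots> \<le> 1 / ((norm z + real k) / 2) ^ n"
    using norm_ge_1[OF assms] norm_add_nat_ge[OF assms, of k]
    by (intro divide_left_mono power_mono mult_pos_pos zero_less_power) auto
  also have "\<dots> = 2 ^ n * (1 / (norm z + real k) ^ n)" by (simp add: power_divide)
  finally show ?thesis .
qed

lemma Polygamma_bound:
  assumes "n \<ge> 1" "Re z \<ge> 1"
  shows "norm (Polygamma n z) \<le> (2 * fact n * 2 ^ Suc n) / norm z ^ n"
proof -
  have z: "z \<noteq> 0" "norm z \<ge> 1" using assms norm_ge_1[of z] by auto
  note b = inverse_power_series_bound[OF z(2) assms(1)]
  have s: "(\<lambda>k. inverse ((z + of_nat k)^Suc n)) sums ((-1) ^ Suc n * Polygamma n z / fact n)"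
    by (rule Polygamma_LIMSEQ) (use z assms in auto)
  have "norm (Polygamma n z) / fact n = norm ((-1) ^ Suc n * Polygamma n z / fact n)"
    by (simp add: norm_mult norm_divide norm_power)
  also have "\<dots> = norm (\<Sum>k. inverse ((z + of_nat k)^Suc n))" using s by (simp add: sums_iff)
  also have "\<dots> \<le> (\<Sum>k. 2 ^ Suc n * (1 / (norm z + real k) ^ Suc n))"
    by (rule norm_suminf_le[OF norm_inverse_power_le[OF assms(2)] summable_mult[OF b(1)]])
  also have "\<dots> = 2 ^ Suc n * (\<Sum>k. 1 / (norm z + real k) ^ Suc n)"
    by (rule suminf_mult[OF b(1)])
  also have "\<dots> \<le> 2 ^ Suc n * (2 / norm z ^ n)"
    by (intro mult_left_mono b) auto
  finally show ?thesis by (simp add: field_simps)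
qed

text \<open>1/z is the telescoping sum of 1/(w (w + 1)) over w = z + k, and 1/w^2 differs from this
  by 1/(w^2 (w + 1)), a cubic term with sum O(1/|z|^2).\<close>

lemma trigamma_approx:
  assumes "Re z \<ge> 1"
  shows "norm (Polygamma 1 z - 1 / z) \<le> 16 / norm z ^ 2"
proof -
  have z: "z \<noteq> 0" "norm z \<ge> 1" using assms norm_ge_1[of z] by auto
  have nz: "z + of_nat k \<noteq> 0" for k
    using norm_add_nat_ge[OF assms, of k] z by auto
  have s: "(\<lambda>k. inverse ((z + of_nat k)^2)) sums Polygamma 1 z"
    using Polygamma_LIMSEQ[OF z(1), of 1] by (simp add: numeral_2_eq_2)
  have tel: "(\<lambda>k. inverse (z + of_nat k) - inverse (z + of_nat (Suc k))) sums (inverse (z + of_nat 0) - 0)"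
    by (intro telescope_sums' filterlim_compose[OF tendsto_inverse_0]
              tendsto_add_filterlim_at_infinity[OF tendsto_const] tendsto_of_nat)
  have eq: "inverse ((z + of_nat k)^2) - (inverse (z + of_nat k) - inverse (z + of_nat (Suc k))) =
     inverse ((z + of_nat k) ^ 2) * inverse (z + of_nat (Suc k))" for k
  proof -
    define w where "w = z + of_nat k"
    have w: "z + of_nat (Suc k) = w + 1" "w \<noteq> 0" "w + 1 \<noteq> 0"
      using nz[of k] nz[of "Suc k"] by (auto simp: w_def add_ac)
    have "inverse w - inverse (w + 1) = inverse w * inverse (w + 1)"
      using division_ring_inverse_diff[OF w(2,3)] by simp
    moreover have "inverse (w^2) = (w + 1) * inverse (w^2) * inverse (w + 1)"
      by (metis mult.assoc mult.commute mult.left_neutral right_inverse w(3))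
    moreover have "inverse w = w * inverse (w^2)" using w(2) by (simp add: power2_eq_square)
    moreover have "a - (c - b) = a * b" if "c - b = c * b" "a = (w + 1) * a * b" "c = w * a" for a b c
      using that by algebra
    ultimately show ?thesis unfolding w(1) w_def[symmetric] by blast
  qed
  have s2: "(\<lambda>k. inverse ((z + of_nat k) ^ 2) * inverse (z + of_nat (Suc k))) sums (Polygamma 1 z - 1 / z)"
    using sums_diff[OF s tel] unfolding eq by (simp add: inverse_eq_divide)
  have three: "Suc 2 = (3 :: nat)" "(1 :: nat) \<le> 2" by auto
  note b = inverse_power_series_bound[OF z(2) three(2), unfolded three(1)]
  have le: "norm (inverse ((z + of_nat k) ^ 2) * inverse (z + of_nat (Suc k))) \<le> 8 * (1 / (norm z + real k) ^ 3)" for k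
  proof -
    have "norm (inverse (z + of_nat (Suc k))) \<le> 2 ^ 1 * (1 / (norm z + real (Suc k)) ^ 1)"
      using norm_inverse_power_le[OF assms, of "Suc k" 1] by (simp only: power_one_right)
    also have "\<dots> \<le> 2 * (1 / (norm z + real k))"
      using z by (simp add: field_simps)
    finally have "norm (inverse ((z + of_nat k) ^ 2) * inverse (z + of_nat (Suc k))) \<le>
      (2 ^ 2 * (1 / (norm z + real k) ^ 2)) * (2 * (1 / (norm z + real k)))"
      unfolding norm_mult by (intro mult_mono norm_inverse_power_le assms) auto
    also have "\<dots> = 8 * (1 / (norm z + real k) ^ 3)" by (simp add: power3_eq_cube power2_eq_square)
    finally show ?thesis .
  qed
  have "norm (Polygamma 1 z - 1 / z) = norm (\<Sum>k. inverse ((z + of_nat k) ^ 2) * inverse (z + of_nat (Suc k)))"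
    using s2 by (simp only: sums_iff)
  also have "\<dots> \<le> (\<Sum>k. 8 * (1 / (norm z + real k) ^ 3))"
    by (rule norm_suminf_le[OF le]) (intro summable_mult b)
  also have "\<dots> = 8 * (\<Sum>k. 1 / (norm z + real k) ^ 3)"
    by (rule suminf_mult[OF b(1)])
  also have "\<dots> \<le> 8 * (2 / norm z ^ 2)"
    by (intro mult_left_mono b) auto
  finally show ?thesis by simp
qed

lemma nonpos_Ints_Re: "Re z > 0 \<Longrightarrow> z \<notin> \<int>\<^sub>\<le>\<^sub>0"
  by (auto elim!: nonpos_Ints_cases)

text \<open>The derivative of the difference is O(1/|z|^2) by \<open>trigamma_approx\<close>, hence
  integrable along vertical lines; the real segment from 1 to 2 is handled by compactness.\<close>

lemma Digamma_minus_Ln_bounded: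
  obtains C where "\<And>z. 1 \<le> Re z \<Longrightarrow> Re z \<le> 2 \<Longrightarrow> norm (Digamma z - Ln z) \<le> C"
proof -
  define D where "D z = Digamma z - Ln z" for z :: complex
  have der: "(D has_field_derivative Polygamma 1 z - 1 / z) (at z)" if "Re z \<ge> 1" for z
    unfolding D_def using that nonpos_Ints_Re[of z]
    by (auto intro!: derivative_eq_intros simp: complex_nonpos_Reals_iff inverse_eq_divide)
  have "bounded ((\<lambda>x. D (of_real x)) ` {1..2})"
  proof (intro compact_imp_bounded compact_continuous_image continuous_at_imp_continuous_on ballI)
    fix x :: real assume x: "x \<in> {1..2}"
    have "isCont D (of_real x)" using der[of "of_real x"] x DERIV_isCont by auto
    thus "isCont (\<lambda>x. D (of_real x)) x"
      by (intro isCont_o2[where f = complex_of_real and g = D]) auto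
  qed auto
  then obtain B where "\<forall>y\<in>(\<lambda>x. D (of_real x)) ` {1..2}. norm y \<le> B"
    unfolding bounded_iff by blast
  hence B: "\<And>x. x \<in> {1..2} \<Longrightarrow> norm (D (of_real x)) \<le> B" by blast
  \<comment> \<open>16 arctan is a primitive of the bound 16 / (1 + t^2); with |arctan| <= 2 it
    leads to the constant 32 below.\<close>
  have line: "norm (D (Complex \<sigma> b) - D (Complex \<sigma> a)) \<le> 16 * arctan b - 16 * arctan a" if "\<sigma> \<ge> 1" "a < b" for \<sigma> a b
  proof -
    have vd: "((\<lambda>t. D (Complex \<sigma> t)) has_vector_derivative \<i> * (Polygamma 1 (Complex \<sigma> t) - 1 / Complex \<sigma> t)) (at t)" for t
    proof -
      have "((\<lambda>t. Complex \<sigma> t) has_vector_derivative \<i>) (at t)"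
        unfolding Complex_eq by (auto intro!: derivative_eq_intros)
      moreover have "(D has_field_derivative Polygamma 1 (Complex \<sigma> t) - 1 / Complex \<sigma> t) (at (Complex \<sigma> t))"
        by (rule der) (use that in auto)
      ultimately show ?thesis
        using field_vector_diff_chain_at[of "\<lambda>t. Complex \<sigma> t"] by (auto simp: o_def)
    qed
    show ?thesis
    proof (rule differentiable_bound_general[OF that(2)])
      show "continuous_on {a..b} (\<lambda>t. D (Complex \<sigma> t))"
        using vd by (intro continuous_at_imp_continuous_on ballI has_vector_derivative_continuous)
      show "continuous_on {a..b} (\<lambda>t. 16 * arctan t)" by (intro continuous_intros)
      fix t :: real
      show "((\<lambda>t. D (Complex \<sigma> t)) has_vector_derivative \<i> * (Polygamma 1 (Complex \<sigma> t) - 1 / Complex \<sigma> t)) (at t)" by (rule vd)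
      show "((\<lambda>t. 16 * arctan t) has_vector_derivative 16 * inverse (1 + t^2)) (at t)"
        unfolding has_real_derivative_iff_has_vector_derivative[symmetric] by (auto intro!: derivative_eq_intros)
      have "norm (\<i> * (Polygamma 1 (Complex \<sigma> t) - 1 / Complex \<sigma> t)) \<le> 16 / norm (Complex \<sigma> t) ^ 2"
        using trigamma_approx[of "Complex \<sigma> t"] that by (simp add: norm_mult)
      also have "norm (Complex \<sigma> t) ^ 2 = \<sigma>^2 + t^2" by (simp add: cmod_def)
      also have "16 / (\<sigma>^2 + t^2) \<le> 16 / (1 + t^2)"
        using that by (intro divide_left_mono add_mono mult_pos_pos add_pos_nonneg) (auto simp: one_le_power)
      finally show "norm (\<i> * (Polygamma 1 (Complex \<sigma> t) - 1 / Complex \<sigma> t)) \<le> 16 * inverse (1 + t^2)"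
        by (simp add: inverse_eq_divide)
    qed
  qed
  have "norm (D z) \<le> B + 32" if z: "1 \<le> Re z" "Re z \<le> 2" for z
  proof -
    have zc: "z = Complex (Re z) (Im z)" by simp
    have r: "D (of_real (Re z)) = D (Complex (Re z) 0)" by (simp add: complex_of_real_def)
    have at: "\<bar>arctan x\<bar> \<le> 2" for x
      using arctan_bounded[of x] pi_less_4 by auto
    have "norm (D z - D (of_real (Re z))) \<le> 32"
    proof (cases "Im z" "0 :: real" rule: linorder_cases)
      case less
      have "norm (D z - D (of_real (Re z))) = norm (D (Complex (Re z) 0) - D (Complex (Re z) (Im z)))"
        unfolding r by (subst norm_minus_commute) simp
      also have "\<dots> \<le> 32" using line[OF z(1) less] at[of "Im z"] by simp
      finally show ?thesis .
    next
      case equal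
      have "z = of_real (Re z)" using equal by (simp add: complex_eq_iff)
      thus ?thesis by simp
    next
      case greater
      have "norm (D z - D (of_real (Re z))) = norm (D (Complex (Re z) (Im z)) - D (Complex (Re z) 0))"
        unfolding r by simp
      also have "\<dots> \<le> 32" using line[OF z(1) greater] at[of "Im z"] by simp
      finally show ?thesis .
    qed
    thus ?thesis using norm_triangle_ineq[of "D z - D (of_real (Re z))" "D (of_real (Re z))"] B[of "Re z"] z by simp
  qed
  thus ?thesis using that unfolding D_def by blast
qed

text \<open>Read off from the limit formula \<open>Gamma_series\<close>: each factor z + i of the
  denominator has modulus at least Re z + i.\<close>

lemma norm_Gamma_le:
  assumes "Re z > 0"
  shows "norm (Gamma z) \<le> Gamma (Re z)"
proof (rule LIMSEQ_le)
  show "(\<lambda>n. norm (Gamma_series z n)) \<longlonglongrightarrow> norm (Gamma z)" by (intro tendsto_norm Gamma_series_LIMSEQ)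
  show "(\<lambda>n. Gamma_series (Re z) n) \<longlonglongrightarrow> Gamma (Re z)" by (rule Gamma_series_LIMSEQ)
  have "norm (Gamma_series z n) \<le> Gamma_series (Re z) n" if "n \<ge> 1" for n
  proof -
    have "pochhammer (Re z) (Suc n) \<le> norm (pochhammer z (Suc n))"
      unfolding pochhammer_prod prod_norm[symmetric]
    proof (rule prod_mono, safe)
      fix i show "Re z + real i \<le> norm (z + of_nat i)"
        using complex_Re_le_cmod[of "z + of_nat i"] by simp
    qed (use assms in auto)
    moreover have "pochhammer (Re z) (Suc n) > 0" using assms by (rule pochhammer_pos)
    moreover have "norm (exp (z * of_real (ln (real n)))) = exp (Re z * ln (real n))" by simp
    ultimately show ?thesis
      unfolding Gamma_series_def norm_divide norm_mult
      by (auto intro!: frac_le)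
  qed
  thus "\<exists>N. \<forall>n\<ge>N. norm (Gamma_series z n) \<le> Gamma_series (Re z) n" by blast
qed

text \<open>The functional equation takes the place of Stirling's formula: |z|^N is at most the
  modulus of the Pochhammer symbol, and \<Gamma>(z + N) is bounded on the strip.\<close>

lemma Gamma_rapid_decay:
  obtains C where "\<And>z. 1 \<le> Re z \<Longrightarrow> Re z \<le> 2 \<Longrightarrow> norm (Gamma z) * norm z ^ N \<le> C"
proof -
  have "bounded ((\<lambda>x :: real. Gamma (x + real N)) ` {1..2})"
    by (intro compact_imp_bounded compact_continuous_image continuous_at_imp_continuous_on ballI continuous_intros)
       (auto simp: nonpos_Ints_def)
  then obtain C where "\<forall>y\<in>(\<lambda>x :: real. Gamma (x + real N)) ` {1..2}. norm y \<le> C"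
    unfolding bounded_iff by blast
  hence C: "\<And>x. x \<in> {1..2} \<Longrightarrow> Gamma (x + real N) \<le> C" by force
  show ?thesis
  proof (rule that)
    fix z :: complex assume z: "1 \<le> Re z" "Re z \<le> 2"
    have nz: "z \<notin> \<int>\<^sub>\<le>\<^sub>0" using nonpos_Ints_Re[of z] z by auto
    have "norm z ^ N = (\<Prod>i\<in>{0..<N}. norm z)" by simp
    also have "\<dots> \<le> (\<Prod>i\<in>{0..<N}. norm (z + of_nat i))"
    proof (rule prod_mono, safe)
      fix i show "norm z \<le> norm (z + of_nat i)"
        using z by (auto simp: cmod_def intro!: real_sqrt_le_mono add_mono power_mono)
    qed auto
    also have "\<dots> = norm (pochhammer z N)" by (simp add: pochhammer_prod prod_norm)
    finally have "norm (Gamma z) * norm z ^ N \<le> norm (Gamma z) * norm (pochhammer z N)"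
      by (intro mult_left_mono) auto
    also have "\<dots> = norm (Gamma (z + of_nat N))"
      using Gamma_nonzero[OF nz] by (simp add: pochhammer_Gamma[OF nz] norm_divide)
    also have "\<dots> \<le> Gamma (Re z + real N)"
      using norm_Gamma_le[of "z + of_nat N"] z by simp
    also have "\<dots> \<le> C" using C[of "Re z"] z by simp
    finally show "norm (Gamma z) * norm z ^ N \<le> C" .
  qed
qed

subsection \<open>Derivatives of the gamma function\<close>

text \<open>Polynomials in the polygamma functions, where the \<open>j\<close>-th polygamma function counts with weight \<open>j\<close>;
  differentiation raises the weight by one and a function of weight \<open>w\<close> is \<open>O(|\<psi>|^A / |z|^w)\<close>.\<close>

inductive pgpoly :: "nat \<Rightarrow> (complex \<Rightarrow> complex) \<Rightarrow> bool" where
  const: "pgpoly 0 (\<lambda>_. c)"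
| base: "pgpoly j (Polygamma j)"
| mult: "pgpoly a f \<Longrightarrow> pgpoly b g \<Longrightarrow> pgpoly (a + b) (\<lambda>z. f z * g z)"
| add: "pgpoly a f \<Longrightarrow> pgpoly a g \<Longrightarrow> pgpoly a (\<lambda>z. f z + g z)"
| weaken: "pgpoly a f \<Longrightarrow> b \<le> a \<Longrightarrow> pgpoly b f"

lemma pgpoly_Digamma_power: "pgpoly 0 (\<lambda>z. Digamma z ^ k)"
proof (induction k)
  case (Suc k)
  thus ?case using pgpoly.mult[OF pgpoly.base[of 0] Suc] by simp
qed (use pgpoly.const[of 1] in simp)

lemma pgpoly_cmult: "pgpoly a f \<Longrightarrow> pgpoly a (\<lambda>z. c * f z)"
  using pgpoly.mult[OF pgpoly.const[of c], of a f] by simp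

lemma pgpoly_deriv:
  assumes "pgpoly w f"
  shows "\<exists>f'. pgpoly (Suc w) f' \<and> (\<forall>z. z \<notin> \<int>\<^sub>\<le>\<^sub>0 \<longrightarrow> (f has_field_derivative f' z) (at z))"
  using assms
proof induction
  case (const c)
  \<comment> \<open>Constants enter \<open>pgpoly\<close> with weight 0 only, so a zero function of
    weight 1 is obtained as a multiple of a polygamma function.\<close>
  have "pgpoly (Suc 0) (\<lambda>z. 0 * Polygamma (Suc 0) z)" by (intro pgpoly_cmult pgpoly.base)
  thus ?case by (intro exI[of _ "\<lambda>z. 0 * Polygamma (Suc 0) z"]) auto
next
  case (base j)
  show ?case by (intro exI[of _ "Polygamma (Suc j)"]) (auto intro: pgpoly.base has_field_derivative_Polygamma)
next
  case (mult a f b g)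
  then obtain f' g' where f': "pgpoly (Suc a) f'" "\<And>z. z \<notin> \<int>\<^sub>\<le>\<^sub>0 \<Longrightarrow> (f has_field_derivative f' z) (at z)"
     and g': "pgpoly (Suc b) g'" "\<And>z. z \<notin> \<int>\<^sub>\<le>\<^sub>0 \<Longrightarrow> (g has_field_derivative g' z) (at z)" by blast
  have "pgpoly (Suc (a + b)) (\<lambda>z. f' z * g z + f z * g' z)"
    using pgpoly.mult[OF f'(1) mult.hyps(2)] pgpoly.mult[OF mult.hyps(1) g'(1)] by (intro pgpoly.add) auto
  moreover have "((\<lambda>z. f z * g z) has_field_derivative f' z * g z + f z * g' z) (at z)" if "z \<notin> \<int>\<^sub>\<le>\<^sub>0" for z
    using DERIV_mult[OF f'(2)[OF that] g'(2)[OF that]] by (simp add: mult_ac)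
  ultimately show ?case by blast
next
  case (add a f g)
  then obtain f' g' where f': "pgpoly (Suc a) f'" "\<And>z. z \<notin> \<int>\<^sub>\<le>\<^sub>0 \<Longrightarrow> (f has_field_derivative f' z) (at z)"
     and g': "pgpoly (Suc a) g'" "\<And>z. z \<notin> \<int>\<^sub>\<le>\<^sub>0 \<Longrightarrow> (g has_field_derivative g' z) (at z)" by blast
  show ?case
    by (rule exI[of _ "\<lambda>z. f' z + g' z"]) (auto intro!: pgpoly.add f' g' DERIV_add)
next
  case (weaken a f b)
  thus ?case by (meson Suc_le_mono pgpoly.weaken)
qed

text \<open>Since \<Gamma>' = \<Gamma> \<psi>, differentiation multiplies the bracket by \<psi> or
  acts on it. New terms of weight one come from hitting one \<psi> of the leading power or from the
  old such term times \<psi>; the rest has weight at least 2.\<close>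

lemma higher_deriv_Gamma:
  "\<exists>r. pgpoly 2 r \<and> (\<forall>z. z \<notin> \<int>\<^sub>\<le>\<^sub>0 \<longrightarrow> (deriv ^^ i) Gamma z =
     Gamma z * (Digamma z ^ i + of_nat (i choose 2) * (Digamma z ^ (i - 2) * Polygamma 1 z) + r z))"
proof (induction i)
  case 0
  have "pgpoly 2 (\<lambda>z. 0 * Polygamma 2 z)" by (intro pgpoly_cmult pgpoly.base)
  thus ?case by (intro exI[of _ "\<lambda>z. 0 * Polygamma 2 z"]) auto
next
  case (Suc i)
  then obtain r where r: "pgpoly 2 r" "\<And>z. z \<notin> \<int>\<^sub>\<le>\<^sub>0 \<Longrightarrow> (deriv ^^ i) Gamma z =
     Gamma z * (Digamma z ^ i + of_nat (i choose 2) * (Digamma z ^ (i - 2) * Polygamma 1 z) + r z)" by blast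
  obtain r' where r': "pgpoly 3 r'" "\<And>z. z \<notin> \<int>\<^sub>\<le>\<^sub>0 \<Longrightarrow> (r has_field_derivative r' z) (at z)"
    using pgpoly_deriv[OF r(1)] by (auto simp: numeral_3_eq_3 numeral_2_eq_2)
  have "pgpoly (0 + 1) (\<lambda>z. Digamma z ^ (i - 2) * Polygamma 1 z)"
    by (intro pgpoly.mult pgpoly.base pgpoly_Digamma_power)
  from pgpoly_deriv[OF this] obtain q where q: "pgpoly 2 q" "\<And>z. z \<notin> \<int>\<^sub>\<le>\<^sub>0 \<Longrightarrow>
     ((\<lambda>z. Digamma z ^ (i - 2) * Polygamma 1 z) has_field_derivative q z) (at z)"
    by (auto simp: numeral_2_eq_2)
  define R where "R z = Digamma z * r z + of_nat (i choose 2) * q z + r' z" for z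
  have "pgpoly 2 (\<lambda>z. Digamma z * r z)"
    using pgpoly.mult[OF pgpoly.base[of 0] r(1)] by (simp only: add_0)
  hence "pgpoly 2 R"
    unfolding R_def using pgpoly.weaken[OF r'(1), of 2]
    by (intro pgpoly.add pgpoly_cmult q) auto
  moreover have "(deriv ^^ Suc i) Gamma z = Gamma z * (Digamma z ^ Suc i +
      of_nat (Suc i choose 2) * (Digamma z ^ (Suc i - 2) * Polygamma 1 z) + R z)" if z: "z \<notin> \<int>\<^sub>\<le>\<^sub>0" for z
  proof -
    let ?f = "\<lambda>z. Gamma z * (Digamma z ^ i + of_nat (i choose 2) * (Digamma z ^ (i - 2) * Polygamma 1 z) + r z)"
    define C where "C = (of_nat (i choose 2) :: complex)"
    have "(?f has_field_derivative (Gamma z * Digamma z * (Digamma z ^ i + C * (Digamma z ^ (i - 2) * Polygamma 1 z) + r z)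
        + Gamma z * (of_nat i * Digamma z ^ (i - 1) * Polygamma 1 z + C * q z + r' z))) (at z)"
    proof -
      have d1: "((\<lambda>z. Digamma z ^ i) has_field_derivative of_nat i * Digamma z ^ (i - 1) * Polygamma 1 z) (at z)"
        using z by (auto intro!: derivative_eq_intros)
      note d2 = DERIV_add[OF DERIV_add[OF d1 DERIV_cmult[OF q(2)[OF z], of C]] r'(2)[OF z]]
      show ?thesis
        by (rule DERIV_cong[OF DERIV_mult[OF has_field_derivative_Gamma[OF z] d2[unfolded C_def]]])
           (simp add: C_def algebra_simps)
    qed
    hence 1: "deriv ?f z = (Gamma z * Digamma z * (Digamma z ^ i + C * (Digamma z ^ (i - 2) * Polygamma 1 z) + r z)
        + Gamma z * (of_nat i * Digamma z ^ (i - 1) * Polygamma 1 z + C * q z + r' z))"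
      by (rule DERIV_imp_deriv)
    have 2: "deriv ((deriv ^^ i) Gamma) z = deriv ?f z"
    proof (rule deriv_cong_ev)
      have "eventually (\<lambda>w. w \<in> - \<int>\<^sub>\<le>\<^sub>0) (nhds z)"
        using z by (intro eventually_nhds_in_open) (auto simp: open_Compl)
      thus "eventually (\<lambda>w. (deriv ^^ i) Gamma w = ?f w) (nhds z)"
        by eventually_elim (use r(2) in auto)
    qed auto
    \<comment> \<open>Pascal's rule. For i < 2 the truncated exponent i - 2 is harmless because
      \<open>i choose 2\<close> is 0.\<close>
    have 3: "C * (Digamma z * Digamma z ^ (i - 2)) + of_nat i * Digamma z ^ (i - 1) = of_nat (Suc i choose 2) * Digamma z ^ (Suc i - 2)"
    proof -
      consider "i = 0" | "i = 1" | k where "i = Suc (Suc k)" by (metis One_nat_def not0_implies_Suc)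
      thus ?thesis
        by cases (auto simp: C_def numeral_2_eq_2 algebra_simps)
    qed
    have 4: "of_nat (Suc i choose 2) * (Digamma z ^ (Suc i - 2) * Polygamma 1 z) =
       (C * (Digamma z * Digamma z ^ (i - 2)) + of_nat i * Digamma z ^ (i - 1)) * Polygamma 1 z"
      unfolding 3 by (simp only: mult.assoc)
    show ?thesis
      unfolding funpow.simps o_apply 2 1
      unfolding 4 R_def C_def[symmetric] power_Suc
      by (simp only: distrib_left distrib_right mult_ac add_ac)
  qed
  ultimately show ?case by blast
qed

text \<open>The limit is left in the shape \<open>c * 0\<close> that \<open>tendsto_mult\<close>
  produces.\<close>

lemma null_comparison_mult_0:
  fixes f :: "nat \<Rightarrow> complex"
  assumes "g \<longlonglongrightarrow> c * 0" "eventually (\<lambda>i. norm (f i) \<le> g i) sequentially"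
  shows "f \<longlonglongrightarrow> 0"
  by (rule Lim_null_comparison[OF assms(2)]) (use assms(1) in simp)

section \<open>Growth along sequences tending to infinity in the strip\<close>

locale strip_sequence =
  fixes z :: "nat \<Rightarrow> complex"
  assumes Re_ge: "\<And>i. Re (z i) \<ge> 1" and Re_le: "\<And>i. Re (z i) \<le> 2"
    and infinity: "filterlim (\<lambda>i. norm (z i)) at_top sequentially"
begin

lemma nz: "z i \<noteq> 0" and norm_z: "norm (z i) \<ge> 1" and not_nonpos: "z i \<notin> \<int>\<^sub>\<le>\<^sub>0"
  using Re_ge[of i] norm_ge_1[of "z i"] nonpos_Ints_Re[of "z i"] by auto

lemma Gamma_nz: "Gamma (z i) \<noteq> 0"
  using Gamma_nonzero not_nonpos by blast

lemma norm_inverse_z: "(\<lambda>i. 1 / norm (z i)) \<longlonglongrightarrow> 0"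
  by (rule real_tendsto_divide_at_top[OF tendsto_const infinity])

lemma Digamma_at_top: "filterlim (\<lambda>i. norm (Digamma (z i))) at_top sequentially"
proof -
  obtain C where C: "\<And>w. 1 \<le> Re w \<Longrightarrow> Re w \<le> 2 \<Longrightarrow> norm (Digamma w - Ln w) \<le> C"
    using Digamma_minus_Ln_bounded by blast
  have "filterlim (\<lambda>i. - C + ln (norm (z i))) at_top sequentially"
    by (intro filterlim_tendsto_add_at_top[OF tendsto_const] filterlim_compose[OF ln_at_top infinity])
  moreover have le: "- C + ln (norm (z i)) \<le> norm (Digamma (z i))" for i
  proof -
    have "ln (norm (z i)) \<le> norm (Ln (z i))"
      using abs_Re_le_cmod[of "Ln (z i)"] nz[of i] by simp
    also have "\<dots> \<le> norm (Digamma (z i)) + norm (Digamma (z i) - Ln (z i))"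
      using norm_triangle_ineq4[of "Digamma (z i)" "Digamma (z i) - Ln (z i)"] by simp
    finally show ?thesis using C[OF Re_ge Re_le, of i] by simp
  qed
  ultimately show ?thesis by (rule filterlim_at_top_mono[OF _ always_eventually[OF allI]])
qed

text \<open>Eventually |\<psi>| <= 2 ln |z|, and every power of the logarithm is
  O(|z|^(1/2)).\<close>

lemma Digamma_power_over_z: "(\<lambda>i. Digamma (z i) ^ A / z i) \<longlonglongrightarrow> 0"
proof -
  obtain C where C: "\<And>w. 1 \<le> Re w \<Longrightarrow> Re w \<le> 2 \<Longrightarrow> norm (Digamma w - Ln w) \<le> C"
    using Digamma_minus_Ln_bounded by blast
  have up: "norm (Digamma (z i)) \<le> ln (norm (z i)) + (pi + C)" for i
  proof -
    have "norm (Ln (z i)) \<le> \<bar>Re (Ln (z i))\<bar> + \<bar>Im (Ln (z i))\<bar>" by (rule cmod_le)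
    also have "\<dots> \<le> ln (norm (z i)) + pi"
      using nz[of i] norm_z[of i] mpi_less_Im_Ln[OF nz[of i]] Im_Ln_le_pi[OF nz[of i]] by simp
    finally show ?thesis
      using norm_triangle_ineq[of "Digamma (z i) - Ln (z i)" "Ln (z i)"] C[OF Re_ge Re_le, of i] by simp
  qed
  obtain B where B: "B \<ge> 0" "\<And>x :: real. x \<ge> 1 \<Longrightarrow> ln x ^ A \<le> B * x powr (1/2)"
    using ln_power_bound[of "1/2" A] by auto
  have ev: "eventually (\<lambda>i. ln (norm (z i)) \<ge> pi + C) sequentially"
    using filterlim_compose[OF ln_at_top infinity] by (simp add: filterlim_at_top)
  have "(\<lambda>i. 2 ^ A * B * norm (z i) powr (- (1/2))) \<longlonglongrightarrow> 2 ^ A * B * 0"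
    by (intro tendsto_mult tendsto_const tendsto_neg_powr infinity) auto
  moreover have "eventually (\<lambda>i. norm (Digamma (z i) ^ A / z i) \<le> 2 ^ A * B * norm (z i) powr (- (1/2))) sequentially"
    using ev
  proof eventually_elim
    case (elim i)
    have "norm (Digamma (z i)) ^ A \<le> (2 * ln (norm (z i))) ^ A"
      using up[of i] elim by (intro power_mono) auto
    also have "\<dots> \<le> 2 ^ A * (B * norm (z i) powr (1/2))"
      unfolding power_mult_distrib using norm_z[of i] by (intro mult_left_mono B) auto
    finally have "norm (Digamma (z i)) ^ A / norm (z i) \<le> 2 ^ A * (B * norm (z i) powr (1/2)) / norm (z i)"
      by (intro divide_right_mono) auto
    also have "\<dots> = 2 ^ A * B * (norm (z i) powr (1/2) * norm (z i) powr (- 1))"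
      using nz[of i] by (simp add: powr_minus inverse_eq_divide)
    also have "norm (z i) powr (1/2) * norm (z i) powr (- 1) = norm (z i) powr (- (1/2))"
      using powr_add[of "norm (z i)" "1/2" "- 1"] by simp
    finally show ?case by (simp add: norm_divide norm_power)
  qed
  ultimately show ?thesis by (rule null_comparison_mult_0)
qed

lemma Digamma_ge_1: "eventually (\<lambda>i. norm (Digamma (z i)) \<ge> 1) sequentially"
  using Digamma_at_top by (simp add: filterlim_at_top)

lemma Gamma_times_power: "(\<lambda>i. Gamma (z i) * z i ^ B) \<longlonglongrightarrow> 0"
proof -
  obtain C where C: "\<And>w. 1 \<le> Re w \<Longrightarrow> Re w \<le> 2 \<Longrightarrow> norm (Gamma w) * norm w ^ Suc B \<le> C"
    using Gamma_rapid_decay by blast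
  have "(\<lambda>i. C * (1 / norm (z i))) \<longlonglongrightarrow> C * 0"
    by (intro tendsto_mult tendsto_const norm_inverse_z)
  moreover have "\<forall>i. norm (Gamma (z i) * z i ^ B) \<le> C * (1 / norm (z i))"
  proof
    fix i show "norm (Gamma (z i) * z i ^ B) \<le> C * (1 / norm (z i))"
    using C[OF Re_ge Re_le, of i] norm_z[of i] nz[of i] by (simp add: norm_mult norm_power field_simps)
  qed
  ultimately show ?thesis by (rule null_comparison_mult_0[OF _ always_eventually])
qed

lemma trigamma_times_z: "(\<lambda>i. z i * Polygamma 1 (z i)) \<longlonglongrightarrow> 1"
proof -
  have "(\<lambda>i. 16 * (1 / norm (z i))) \<longlonglongrightarrow> 16 * 0"
    by (intro tendsto_mult tendsto_const norm_inverse_z)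
  moreover have "\<forall>i. norm (z i * Polygamma 1 (z i) - 1) \<le> 16 * (1 / norm (z i))"
  proof
    fix i
    have "z i * Polygamma 1 (z i) - 1 = z i * (Polygamma 1 (z i) - 1 / z i)"
      using nz[of i] by (simp add: algebra_simps)
    also have "norm \<dots> \<le> norm (z i) * (16 / norm (z i) ^ 2)"
      unfolding norm_mult by (intro mult_left_mono trigamma_approx Re_ge) auto
    also have "\<dots> = 16 * (1 / norm (z i))" using nz[of i] by (simp add: power2_eq_square)
    finally show "norm (z i * Polygamma 1 (z i) - 1) \<le> 16 * (1 / norm (z i))" .
  qed
  ultimately have "(\<lambda>i. z i * Polygamma 1 (z i) - 1) \<longlonglongrightarrow> 0"
    by (rule null_comparison_mult_0[OF _ always_eventually])
  thus ?thesis by (simp add: LIM_zero_iff)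
qed

lemma pgpoly_bound:
  assumes "pgpoly w f"
  shows "\<exists>A C. C \<ge> 0 \<and> eventually (\<lambda>i. norm (f (z i)) * norm (z i) ^ w \<le> C * norm (Digamma (z i)) ^ A) sequentially"
  using assms
proof induction
  case (const c)
  show ?case by (intro exI[of _ 0] exI[of _ "norm c"]) auto
next
  case (base j)
  show ?case
  proof (cases "j = 0")
    case True
    thus ?thesis by (intro exI[of _ 1] exI[of _ 1]) auto
  next
    case False
    have "norm (Polygamma j (z i)) * norm (z i) ^ j \<le> 2 * fact j * 2 ^ Suc j" for i
      using Polygamma_bound[of j "z i"] False Re_ge[of i] nz[of i] by (simp add: pos_le_divide_eq)
    thus ?thesis by (intro exI[of _ 0] exI[of _ "2 * fact j * 2 ^ Suc j"]) auto
  qed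
next
  case (mult a f b g)
  then obtain A C A' C' where 1: "C \<ge> 0" "eventually (\<lambda>i. norm (f (z i)) * norm (z i) ^ a \<le> C * norm (Digamma (z i)) ^ A) sequentially"
    and 2: "C' \<ge> 0" "eventually (\<lambda>i. norm (g (z i)) * norm (z i) ^ b \<le> C' * norm (Digamma (z i)) ^ A') sequentially" by blast
  have "eventually (\<lambda>i. norm (f (z i) * g (z i)) * norm (z i) ^ (a + b) \<le> (C * C') * norm (Digamma (z i)) ^ (A + A')) sequentially"
    using 1(2) 2(2)
  proof eventually_elim
    case (elim i)
    have "(norm (f (z i)) * norm (z i) ^ a) * (norm (g (z i)) * norm (z i) ^ b) \<le>
       (C * norm (Digamma (z i)) ^ A) * (C' * norm (Digamma (z i)) ^ A')"
      by (rule mult_mono) (use elim 1(1) 2(1) in auto)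
    thus ?case by (simp add: norm_mult power_add mult_ac)
  qed
  thus ?case using 1(1) 2(1) by (intro exI[of _ "A + A'"] exI[of _ "C * C'"]) auto
next
  case (add a f g)
  then obtain A C A' C' where 1: "C \<ge> 0" "eventually (\<lambda>i. norm (f (z i)) * norm (z i) ^ a \<le> C * norm (Digamma (z i)) ^ A) sequentially"
    and 2: "C' \<ge> 0" "eventually (\<lambda>i. norm (g (z i)) * norm (z i) ^ a \<le> C' * norm (Digamma (z i)) ^ A') sequentially" by blast
  have "eventually (\<lambda>i. norm (f (z i) + g (z i)) * norm (z i) ^ a \<le> (C + C') * norm (Digamma (z i)) ^ (A + A')) sequentially"
    using 1(2) 2(2) Digamma_ge_1
  proof eventually_elim
    case (elim i)
    have "norm (f (z i) + g (z i)) * norm (z i) ^ a \<le> (norm (f (z i)) + norm (g (z i))) * norm (z i) ^ a"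
      by (intro mult_right_mono norm_triangle_ineq) auto
    also have "\<dots> \<le> C * norm (Digamma (z i)) ^ A + C' * norm (Digamma (z i)) ^ A'"
      using elim by (simp add: distrib_right)
    also have "\<dots> \<le> C * norm (Digamma (z i)) ^ (A + A') + C' * norm (Digamma (z i)) ^ (A + A')"
      using elim 1(1) 2(1) by (intro add_mono mult_left_mono power_increasing) auto
    finally show ?case by (simp add: distrib_right)
  qed
  thus ?case using 1(1) 2(1) by (intro exI[of _ "A + A'"] exI[of _ "C + C'"]) auto
next
  case (weaken a f b)
  then obtain A C where 1: "C \<ge> 0" "eventually (\<lambda>i. norm (f (z i)) * norm (z i) ^ a \<le> C * norm (Digamma (z i)) ^ A) sequentially"
    by blast
  from 1(2) have "eventually (\<lambda>i. norm (f (z i)) * norm (z i) ^ b \<le> C * norm (Digamma (z i)) ^ A) sequentially"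
  proof eventually_elim
    case (elim i)
    have "norm (f (z i)) * norm (z i) ^ b \<le> norm (f (z i)) * norm (z i) ^ a"
      using norm_z[of i] weaken by (intro mult_left_mono power_increasing) auto
    with elim show ?case by simp
  qed
  thus ?case using 1(1) by blast
qed

text \<open>Weight 2 leaves a spare factor 1/z, against which any power of \<psi> is
  negligible.\<close>

lemma pgpoly_2_tendsto:
  assumes "pgpoly 2 r"
  shows "(\<lambda>i. z i * Digamma (z i) ^ 2 * r (z i)) \<longlonglongrightarrow> 0"
proof -
  obtain A C where C: "C \<ge> 0" "eventually (\<lambda>i. norm (r (z i)) * norm (z i) ^ 2 \<le> C * norm (Digamma (z i)) ^ A) sequentially"
    using pgpoly_bound[OF assms] by blast
  have "(\<lambda>i. C * norm (Digamma (z i) ^ (A + 2) / z i)) \<longlonglongrightarrow> C * 0"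
    by (intro tendsto_mult tendsto_const tendsto_norm_zero Digamma_power_over_z)
  moreover have "eventually (\<lambda>i. norm (z i * Digamma (z i) ^ 2 * r (z i)) \<le> C * norm (Digamma (z i) ^ (A + 2) / z i)) sequentially"
    using C(2)
  proof eventually_elim
    case (elim i)
    have "norm (z i * Digamma (z i) ^ 2 * r (z i)) = norm (Digamma (z i)) ^ 2 / norm (z i) * (norm (r (z i)) * norm (z i) ^ 2)"
      using nz[of i] by (simp add: norm_mult norm_power power2_eq_square)
    also have "\<dots> \<le> norm (Digamma (z i)) ^ 2 / norm (z i) * (C * norm (Digamma (z i)) ^ A)"
      using elim by (intro mult_left_mono) auto
    finally show ?case by (simp add: norm_divide norm_mult norm_power power_add power2_eq_square mult_ac)
  qed
  ultimately show ?thesis by (rule null_comparison_mult_0)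
qed

text \<open>The constant comes from the trigamma term, since z times trigamma tends to 1; the
  remainder of weight 2 disappears. The limit is nonzero exactly for n >= 2.\<close>

lemma higher_deriv_Gamma_asymp:
  "(\<lambda>i. z i * Digamma (z i) ^ 2 * ((deriv ^^ n) Gamma (z i) / (Gamma (z i) * Digamma (z i) ^ n) - 1)) \<longlonglongrightarrow> of_nat (n choose 2)"
proof -
  obtain r where r: "pgpoly 2 r" "\<And>w. w \<notin> \<int>\<^sub>\<le>\<^sub>0 \<Longrightarrow> (deriv ^^ n) Gamma w =
     Gamma w * (Digamma w ^ n + of_nat (n choose 2) * (Digamma w ^ (n - 2) * Polygamma 1 w) + r w)"
    using higher_deriv_Gamma[of n] by blast
  let ?C = "of_nat (n choose 2) :: complex"
  have "(\<lambda>i. z i * Digamma (z i) ^ 2 * r (z i) / Digamma (z i) ^ n) \<longlonglongrightarrow> 0"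
  proof (rule Lim_null_comparison[OF _ tendsto_norm_zero[OF pgpoly_2_tendsto[OF r(1)]]])
    show "eventually (\<lambda>i. norm (z i * Digamma (z i) ^ 2 * r (z i) / Digamma (z i) ^ n) \<le> norm (z i * Digamma (z i) ^ 2 * r (z i))) sequentially"
      using Digamma_ge_1
    proof eventually_elim
      case (elim i)
      have "norm (Digamma (z i)) ^ n \<ge> 1" using elim by simp
      hence "norm (z i * Digamma (z i) ^ 2 * r (z i)) / norm (Digamma (z i)) ^ n \<le> norm (z i * Digamma (z i) ^ 2 * r (z i)) / 1"
        by (intro divide_left_mono) auto
      thus ?case by (simp add: norm_divide norm_power)
    qed
  qed
  hence "(\<lambda>i. ?C * (z i * Polygamma 1 (z i)) + z i * Digamma (z i) ^ 2 * r (z i) / Digamma (z i) ^ n) \<longlonglongrightarrow> ?C * 1 + 0"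
    by (intro tendsto_add tendsto_mult tendsto_const trigamma_times_z)
  moreover have "eventually (\<lambda>i. ?C * (z i * Polygamma 1 (z i)) + z i * Digamma (z i) ^ 2 * r (z i) / Digamma (z i) ^ n =
     z i * Digamma (z i) ^ 2 * ((deriv ^^ n) Gamma (z i) / (Gamma (z i) * Digamma (z i) ^ n) - 1)) sequentially"
    using Digamma_ge_1
  proof eventually_elim
    case (elim i)
    define \<psi> where "\<psi> = Digamma (z i)"
    have \<psi>: "\<psi> \<noteq> 0" using elim by (auto simp: \<psi>_def)
    \<comment> \<open>For n < 2 the exponent n - 2 is truncated and the powers need not match, but
      then the binomial coefficient is 0.\<close>
    have 1: "?C * (\<psi> ^ 2 * \<psi> ^ (n - 2)) = ?C * \<psi> ^ n"
    proof (cases "n \<ge> 2")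
      case True
      thus ?thesis by (metis le_add_diff_inverse power_add)
    qed (simp add: binomial_eq_0)
    have "(deriv ^^ n) Gamma (z i) / (Gamma (z i) * \<psi> ^ n) - 1 =
        (?C * (\<psi> ^ (n - 2) * Polygamma 1 (z i)) + r (z i)) / \<psi> ^ n"
      unfolding r(2)[OF not_nonpos] \<psi>_def[symmetric] using Gamma_nz[of i] \<psi> by (simp add: field_simps)
    hence "z i * \<psi> ^ 2 * ((deriv ^^ n) Gamma (z i) / (Gamma (z i) * \<psi> ^ n) - 1) =
       (z i * Polygamma 1 (z i) * (?C * (\<psi> ^ 2 * \<psi> ^ (n - 2))) + z i * \<psi> ^ 2 * r (z i)) / \<psi> ^ n"
      by (simp add: algebra_simps)
    also have "\<dots> = ?C * (z i * Polygamma 1 (z i)) + z i * \<psi> ^ 2 * r (z i) / \<psi> ^ n"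
      unfolding 1 using \<psi> by (simp add: field_simps)
    finally show ?case by (simp add: \<psi>_def)
  qed
  ultimately show ?thesis by (auto intro: Lim_transform_eventually)
qed

end

subsection \<open>Elimination of coefficients on different scales\<close>

text \<open>One surplus factor of the dominating kind absorbs the rest: \<gamma> beats all powers of
  \<psi> and of 1/\<epsilon>, \<epsilon> beats all powers of \<psi>, and \<psi> is large, whence the
  reversed comparison for \<open>a\<close>.\<close>

lemma quotient_monomial_tendsto_0:
  fixes \<gamma> \<psi> \<epsilon> :: "nat \<Rightarrow> complex"
  assumes \<gamma>: "eventually (\<lambda>i. \<gamma> i \<noteq> 0) sequentially" and \<epsilon>: "eventually (\<lambda>i. \<epsilon> i \<noteq> 0) sequentially"
    and \<psi>: "filterlim (\<lambda>i. norm (\<psi> i)) at_top sequentially"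
    and small: "\<And>A. (\<lambda>i. \<psi> i ^ A * \<epsilon> i) \<longlonglongrightarrow> 0"
    and tiny: "\<And>A B. (\<lambda>i. \<gamma> i * \<psi> i ^ A / \<epsilon> i ^ B) \<longlonglongrightarrow> 0"
    and lex: "p0 < p \<or> p0 = p \<and> (k0 < k \<or> k0 = k \<and> a < a0)"
  shows "(\<lambda>i. \<gamma> i ^ p * \<psi> i ^ a * \<epsilon> i ^ k / (\<gamma> i ^ p0 * \<psi> i ^ a0 * \<epsilon> i ^ k0)) \<longlonglongrightarrow> 0"
proof -
  have \<psi>0: "eventually (\<lambda>i. \<psi> i \<noteq> 0) sequentially"
    using \<psi>[unfolded filterlim_at_top, rule_format, of 1] by eventually_elim auto
  have inv: "(\<lambda>i. 1 / \<psi> i) \<longlonglongrightarrow> 0"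
  proof (rule tendsto_norm_zero_cancel)
    have "(\<lambda>i. 1 / norm (\<psi> i)) \<longlonglongrightarrow> 0" by (rule real_tendsto_divide_at_top[OF tendsto_const \<psi>])
    thus "(\<lambda>i. norm (1 / \<psi> i)) \<longlonglongrightarrow> 0" by (simp add: norm_divide)
  qed
  have \<epsilon>0: "\<epsilon> \<longlonglongrightarrow> 0" using small[of 0] by simp
  have \<gamma>0: "\<gamma> \<longlonglongrightarrow> 0" using tiny[of 0 0] by simp
  let ?f = "\<lambda>i. \<gamma> i ^ p * \<psi> i ^ a * \<epsilon> i ^ k / (\<gamma> i ^ p0 * \<psi> i ^ a0 * \<epsilon> i ^ k0)"
  from lex consider d where "p = p0 + Suc d" | d where "p = p0" "k = k0 + Suc d" | d where "p = p0" "k = k0" "a0 = a + Suc d"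
    by (metis less_imp_Suc_add add_Suc_right)
  thus ?thesis
  proof cases
    case (1 d)
    have "(\<lambda>i. (\<gamma> i * \<psi> i ^ a / \<epsilon> i ^ k0) * (\<gamma> i ^ d * \<epsilon> i ^ k * (1 / \<psi> i) ^ a0)) \<longlonglongrightarrow> 0 * (0 ^ d * 0 ^ k * 0 ^ a0)"
      by (intro tendsto_mult tendsto_power tiny inv \<epsilon>0 \<gamma>0)
    moreover have "eventually (\<lambda>i. (\<gamma> i * \<psi> i ^ a / \<epsilon> i ^ k0) * (\<gamma> i ^ d * \<epsilon> i ^ k * (1 / \<psi> i) ^ a0) = ?f i) sequentially"
      using \<gamma> by eventually_elim (simp add: 1 power_add power_divide mult_ac)
    ultimately show ?thesis by (simp add: tendsto_cong)
  next
    case (2 d)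
    have "(\<lambda>i. (\<psi> i ^ a * \<epsilon> i) * (\<epsilon> i ^ d * (1 / \<psi> i) ^ a0)) \<longlonglongrightarrow> 0 * (0 ^ d * 0 ^ a0)"
      by (intro tendsto_mult tendsto_power small inv \<epsilon>0)
    moreover have "eventually (\<lambda>i. (\<psi> i ^ a * \<epsilon> i) * (\<epsilon> i ^ d * (1 / \<psi> i) ^ a0) = ?f i) sequentially"
      using \<gamma> \<epsilon> by eventually_elim (simp add: 2 power_add power_divide mult_ac)
    ultimately show ?thesis by (simp add: tendsto_cong)
  next
    case (3 d)
    have "(\<lambda>i. (1 / \<psi> i) ^ Suc d) \<longlonglongrightarrow> 0 ^ Suc d"
      by (intro tendsto_power inv)
    moreover have "eventually (\<lambda>i. (1 / \<psi> i) ^ Suc d = ?f i) sequentially"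
      using \<gamma> \<epsilon> \<psi>0 by eventually_elim (simp add: 3 power_add power_divide mult_ac)
    ultimately show ?thesis by (simp add: tendsto_cong)
  qed
qed

text \<open>\<open>c\<close> is indexed by (p, a) so that all members of a class share it.
  Approximation of u is demanded only through the values of \<open>F\<close>, so the type of u
  carries no topology.\<close>

locale elimination =
  fixes L :: "'l set" and F :: "'l \<Rightarrow> 'u \<Rightarrow> complex" and p a k :: "'l \<Rightarrow> nat"
  assumes fin: "finite L"
    and inj: "\<And>l l'. l \<in> L \<Longrightarrow> l' \<in> L \<Longrightarrow> p l = p l' \<Longrightarrow> a l = a l' \<Longrightarrow> k l = k l' \<Longrightarrow> l = l'"
    and approach: "\<And>u. \<exists>v \<gamma> \<psi> \<epsilon> c. (\<forall>l\<in>L. (\<lambda>i. F l (v i)) \<longlonglongrightarrow> F l u) \<and>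
       eventually (\<lambda>i. \<gamma> i \<noteq> 0) sequentially \<and> eventually (\<lambda>i. \<epsilon> i \<noteq> 0) sequentially \<and>
       filterlim (\<lambda>i. norm (\<psi> i)) at_top sequentially \<and>
       (\<forall>A. (\<lambda>i. \<psi> i ^ A * \<epsilon> i) \<longlonglongrightarrow> 0) \<and>
       (\<forall>A B. (\<lambda>i. \<gamma> i * \<psi> i ^ A / \<epsilon> i ^ B) \<longlonglongrightarrow> 0) \<and>
       (\<forall>l\<in>L. c (p l, a l) \<longlonglongrightarrow> 1) \<and>
       eventually (\<lambda>i. (\<Sum>l\<in>L. F l (v i) * (\<gamma> i ^ p l * \<psi> i ^ a l * c (p l, a l) i * (1 + \<epsilon> i) ^ k l)) = 0) sequentially"
begin

text \<open>Expanding \<open>(1 + \<epsilon>)\<^sup>k\<close>, this is the coefficient of \<open>\<gamma>\<^sup>p \<psi>\<^sup>a \<epsilon>\<^sup>j\<close> for \<open>x = ((p, a), j)\<close>.\<close>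

definition coeff :: "(nat \<times> nat) \<times> nat \<Rightarrow> 'u \<Rightarrow> complex" where
  "coeff x u = (\<Sum>l\<in>{l \<in> L. (p l, a l) = fst x}. of_nat (k l choose snd x) * F l u)"

definition K where "K = Max (insert 0 (k ` L))"

definition PA where "PA = (\<lambda>l. (p l, a l)) ` L"

lemma regroup:
  "(\<Sum>l\<in>L. F l u * (g ^ p l * s ^ a l * c (p l, a l) * (1 + e) ^ k l)) =
   (\<Sum>x\<in>PA \<times> {..K}. coeff x u * c (fst x) * (g ^ fst (fst x) * s ^ snd (fst x) * e ^ snd x))"
proof -
  have kK: "k l \<le> K" if "l \<in> L" for l
    unfolding K_def using fin that by (intro Max_ge) auto
  have bin: "(1 + e) ^ k l = (\<Sum>j\<le>K. of_nat (k l choose j) * e ^ j)" if "l \<in> L" for l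
  proof -
    have "(1 + e) ^ k l = (e + 1) ^ k l" by (simp add: add.commute)
    also have "\<dots> = (\<Sum>j\<le>k l. of_nat (k l choose j) * e ^ j)" by (simp add: binomial_ring)
    also have "\<dots> = (\<Sum>j\<le>K. of_nat (k l choose j) * e ^ j)"
      by (rule sum.mono_neutral_left) (use kK[OF that] in \<open>auto simp: binomial_eq_0\<close>)
    finally show ?thesis .
  qed
  have "(\<Sum>l\<in>L. F l u * (g ^ p l * s ^ a l * c (p l, a l) * (1 + e) ^ k l)) =
      (\<Sum>y\<in>PA. \<Sum>l\<in>{l \<in> L. (p l, a l) = y}. F l u * (g ^ p l * s ^ a l * c (p l, a l) * (1 + e) ^ k l))"
    by (rule sum.group[symmetric]) (auto simp: PA_def fin)
  also have "\<dots> = (\<Sum>y\<in>PA. \<Sum>j\<le>K. coeff (y, j) u * c y * (g ^ fst y * s ^ snd y * e ^ j))"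
  proof (rule sum.cong[OF refl])
    fix y assume "y \<in> PA"
    have "(\<Sum>l\<in>{l \<in> L. (p l, a l) = y}. F l u * (g ^ p l * s ^ a l * c (p l, a l) * (1 + e) ^ k l)) =
       (\<Sum>l\<in>{l \<in> L. (p l, a l) = y}. \<Sum>j\<le>K. (of_nat (k l choose j) * F l u) * (c y * (g ^ fst y * s ^ snd y * e ^ j)))"
      by (intro sum.cong refl) (auto simp: bin sum_distrib_left mult_ac)
    also have "\<dots> = (\<Sum>j\<le>K. coeff (y, j) u * (c y * (g ^ fst y * s ^ snd y * e ^ j)))"
      by (subst sum.swap) (simp add: coeff_def sum_distrib_right)
    finally show "(\<Sum>l\<in>{l \<in> L. (p l, a l) = y}. F l u * (g ^ p l * s ^ a l * c (p l, a l) * (1 + e) ^ k l)) =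
       (\<Sum>j\<le>K. coeff (y, j) u * c y * (g ^ fst y * s ^ snd y * e ^ j))" by (simp only: mult.assoc)
  qed
  also have "\<dots> = (\<Sum>x\<in>PA \<times> {..K}. coeff x u * c (fst x) * (g ^ fst (fst x) * s ^ snd (fst x) * e ^ snd x))"
    by (simp add: sum.cartesian_product case_prod_beta)
  finally show ?thesis .
qed

text \<open>Among the coefficients that do not vanish identically, the one of least
  \<open>rank\<close> belongs to the dominant monomial; after division by that monomial its value is
  the limit of a sum that is zero.\<close>

lemma coeff_eq_0:
  assumes "x \<in> PA \<times> {..K}"
  shows "coeff x u = 0"
proof (rule ccontr)
  assume nonzero: "coeff x u \<noteq> 0"
  define I where "I = PA \<times> {..K}"
  \<comment> \<open>Vanishing for all u is what counts: the coefficients are evaluated at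
    \<open>v i\<close>, so one that is 0 merely at the limit point need not drop out against a
    dominating monomial.\<close>
  define Bad where "Bad = {x \<in> I. \<exists>u. coeff x u \<noteq> 0}"
  define A where "A = Max (snd ` PA)"
  \<comment> \<open>Subtraction from the maximum A reverses the order in a, as \<psi> is large; on
    \<open>I\<close> it is never truncated.\<close>
  define rank where "rank = (\<lambda>x :: (nat \<times> nat) \<times> nat. (fst (fst x), snd x, A - snd (fst x)))"
  have finPA: "finite PA" using fin by (simp add: PA_def)
  have A: "snd (fst x) \<le> A" if "x \<in> I" for x
    unfolding A_def using that finPA by (intro Max_ge) (auto simp: I_def)
  have bad: "x \<in> Bad" using assms nonzero by (auto simp: Bad_def I_def)
  have wf: "wf (inv_image (less_than <*lex*> less_than <*lex*> less_than) rank)"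
    by (intro wf_inv_image wf_lex_prod wf_less_than)
  obtain x0 where x0: "x0 \<in> Bad"
    "\<And>y. (y, x0) \<in> inv_image (less_than <*lex*> less_than <*lex*> less_than) rank \<Longrightarrow> y \<notin> Bad"
    using wfE_min[OF wf bad] by blast
  obtain p0 a0 k0 where x0_eq: "x0 = ((p0, a0), k0)" by (metis prod.collapse)
  from x0 obtain u0 where u0: "coeff x0 u0 \<noteq> 0" by (auto simp: Bad_def)
  have x0I: "x0 \<in> I" using x0(1) by (simp add: Bad_def)
  from approach[of u0] obtain v \<gamma> \<psi> \<epsilon> c where v: "\<forall>l\<in>L. (\<lambda>i. F l (v i)) \<longlonglongrightarrow> F l u0"
    and \<gamma>: "eventually (\<lambda>i. \<gamma> i \<noteq> 0) sequentially" and \<epsilon>: "eventually (\<lambda>i. \<epsilon> i \<noteq> 0) sequentially"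
    and \<psi>: "filterlim (\<lambda>i. norm (\<psi> i)) at_top sequentially"
    and small: "\<forall>A. (\<lambda>i. \<psi> i ^ A * \<epsilon> i) \<longlonglongrightarrow> 0"
    and tiny: "\<forall>A B. (\<lambda>i. \<gamma> i * \<psi> i ^ A / \<epsilon> i ^ B) \<longlonglongrightarrow> 0"
    and c: "\<forall>l\<in>L. c (p l, a l) \<longlonglongrightarrow> 1"
    and zero: "eventually (\<lambda>i. (\<Sum>l\<in>L. F l (v i) * (\<gamma> i ^ p l * \<psi> i ^ a l * c (p l, a l) i * (1 + \<epsilon> i) ^ k l)) = 0) sequentially"
    by (elim exE conjE) (rule that)
  have coeff_lim: "(\<lambda>i. coeff x (v i)) \<longlonglongrightarrow> coeff x u0" for x
    unfolding coeff_def using v by (intro tendsto_intros) auto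
  have c_lim: "c (fst x) \<longlonglongrightarrow> 1" if "x \<in> I" for x
    using that c by (auto simp: I_def PA_def)
  define D where "D i = \<gamma> i ^ p0 * \<psi> i ^ a0 * \<epsilon> i ^ k0" for i
  define M where "M x i = \<gamma> i ^ fst (fst x) * \<psi> i ^ snd (fst x) * \<epsilon> i ^ snd x / D i" for x i
  have D: "eventually (\<lambda>i. D i \<noteq> 0) sequentially"
    using \<gamma> \<epsilon> \<psi>[unfolded filterlim_at_top, rule_format, of 1]
    by eventually_elim (auto simp: D_def)
  have lim: "(\<lambda>i. coeff x (v i) * c (fst x) i * M x i) \<longlonglongrightarrow> (if x = x0 then coeff x0 u0 else 0)" if x: "x \<in> I" for x
  proof (cases "x = x0")
    case True
    have "eventually (\<lambda>i. M x0 i = 1) sequentially"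
      using D by eventually_elim (simp add: M_def D_def x0_eq)
    hence "M x0 \<longlonglongrightarrow> 1" by (rule tendsto_eventually)
    hence "(\<lambda>i. coeff x0 (v i) * c (fst x0) i * M x0 i) \<longlonglongrightarrow> coeff x0 u0 * 1 * 1"
      by (intro tendsto_mult coeff_lim c_lim x0I)
    thus ?thesis using True by simp
  next
    case False
    show ?thesis
    proof (cases "x \<in> Bad")
      case True
      have "(x, x0) \<notin> inv_image (less_than <*lex*> less_than <*lex*> less_than) rank"
        using x0(2) True by blast
      hence "p0 < fst (fst x) \<or> p0 = fst (fst x) \<and> (k0 < snd x \<or> k0 = snd x \<and> snd (fst x) < a0)"
        using A[OF x] A[OF x0I] False by (cases x) (auto simp: rank_def x0_eq)
      hence "M x \<longlonglongrightarrow> 0"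
        unfolding M_def D_def by (rule quotient_monomial_tendsto_0[OF \<gamma> \<epsilon> \<psi> small[rule_format] tiny[rule_format]])
      hence "(\<lambda>i. coeff x (v i) * c (fst x) i * M x i) \<longlonglongrightarrow> coeff x u0 * 1 * 0"
        by (intro tendsto_mult coeff_lim c_lim x)
      thus ?thesis using False by simp
    next
      case False
      hence "coeff x w = 0" for w using x by (auto simp: Bad_def)
      thus ?thesis using \<open>x \<noteq> x0\<close> by simp
    qed
  qed
  have finI: "finite I" using finPA by (simp add: I_def)
  have "(\<lambda>i. \<Sum>x\<in>I. coeff x (v i) * c (fst x) i * M x i) \<longlonglongrightarrow> (\<Sum>x\<in>I. if x = x0 then coeff x0 u0 else 0)"
    by (intro tendsto_sum lim)
  also have "(\<Sum>x\<in>I. if x = x0 then coeff x0 u0 else 0) = coeff x0 u0"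
    using finI x0I by simp
  finally have 1: "(\<lambda>i. \<Sum>x\<in>I. coeff x (v i) * c (fst x) i * M x i) \<longlonglongrightarrow> coeff x0 u0" .
  have "eventually (\<lambda>i. (\<Sum>x\<in>I. coeff x (v i) * c (fst x) i * M x i) = 0) sequentially"
    using zero
  proof eventually_elim
    case (elim i)
    have "(\<Sum>x\<in>I. coeff x (v i) * c (fst x) i * M x i) =
        (\<Sum>x\<in>I. coeff x (v i) * c (fst x) i * (\<gamma> i ^ fst (fst x) * \<psi> i ^ snd (fst x) * \<epsilon> i ^ snd x)) / D i"
      by (simp add: M_def sum_divide_distrib)
    also have "\<dots> = 0"
      using elim regroup[of "v i" "\<gamma> i" "\<psi> i" "\<lambda>y. c y i" "\<epsilon> i"] by (simp add: I_def)
    finally show ?case .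
  qed
  hence "(\<lambda>i. \<Sum>x\<in>I. coeff x (v i) * c (fst x) i * M x i) \<longlonglongrightarrow> 0" by (rule tendsto_eventually)
  with 1 u0 show False using LIMSEQ_unique by blast
qed

text \<open>For fixed u the binomial system is triangular: let k be the largest exponent in the
  class of l at which \<open>F\<close> is nonzero. In the coefficient of \<epsilon>^k that member
  has factor 1, smaller exponents have factor 0, and injectivity excludes a tie.\<close>

lemma eliminate:
  assumes "l \<in> L"
  shows "F l u = 0"
proof (rule ccontr)
  assume nz: "F l u \<noteq> 0"
  define S where "S = {l' \<in> L. (p l', a l') = (p l, a l) \<and> F l' u \<noteq> 0}"
  have S: "finite S" "S \<noteq> {}" using fin nz assms by (auto simp: S_def)
  have "Max (k ` S) \<in> k ` S" using S by (intro Max_in) auto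
  then obtain l1 where l1: "l1 \<in> S" "k l1 = Max (k ` S)" by auto
  have max: "k l' \<le> k l1" if "l' \<in> S" for l' using S that by (simp add: l1(2))
  let ?x = "((p l, a l), k l1)"
  have "k l1 \<le> K"
    unfolding K_def using fin l1(1) by (intro Max_ge) (auto simp: S_def)
  hence "?x \<in> PA \<times> {..K}" using assms by (auto simp: PA_def)
  hence "coeff ?x u = 0" by (rule coeff_eq_0)
  also have "coeff ?x u = (\<Sum>l'\<in>{l' \<in> L. (p l', a l') = (p l, a l)}. if l' = l1 then F l1 u else 0)"
    unfolding coeff_def fst_conv snd_conv
  proof (rule sum.cong[OF refl])
    fix l' assume l': "l' \<in> {l' \<in> L. (p l', a l') = (p l, a l)}"
    show "of_nat (k l' choose k l1) * F l' u = (if l' = l1 then F l1 u else 0)"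
    proof (cases "l' \<in> S")
      case True
      show ?thesis
      proof (cases "k l' = k l1")
        case True
        have "l' = l1" by (rule inj) (use l' l1 True in \<open>auto simp: S_def\<close>)
        thus ?thesis by simp
      next
        case False
        with max[OF \<open>l' \<in> S\<close>] have "k l' < k l1" by simp
        thus ?thesis using False by (auto simp: binomial_eq_0)
      qed
    next
      case False
      hence "F l' u = 0" using l' by (auto simp: S_def)
      thus ?thesis using False l1(1) by auto
    qed
  qed
  also have "\<dots> = F l1 u" using fin l1(1) by (simp add: S_def)
  finally show False using l1(1) by (simp add: S_def)
qed

end

subsection \<open>Independence of the zeta and gamma functions\<close>

context strip_sequence
begin

lemma Digamma_nz: "eventually (\<lambda>i. Digamma (z i) \<noteq> 0) sequentially"
  using Digamma_ge_1 by eventually_elim auto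

lemma inverse_Digamma: "(\<lambda>i. 1 / Digamma (z i)) \<longlonglongrightarrow> 0"
proof (rule tendsto_norm_zero_cancel)
  have "(\<lambda>i. 1 / norm (Digamma (z i))) \<longlonglongrightarrow> 0"
    by (rule real_tendsto_divide_at_top[OF tendsto_const Digamma_at_top])
  thus "(\<lambda>i. norm (1 / Digamma (z i))) \<longlonglongrightarrow> 0" by (simp add: norm_divide)
qed

lemma small_scale:
  assumes \<kappa>: "(\<lambda>i. z i * Digamma (z i) ^ 2 * \<epsilon> i) \<longlonglongrightarrow> \<kappa>"
  shows "(\<lambda>i. Digamma (z i) ^ A * \<epsilon> i) \<longlonglongrightarrow> 0"
proof -
  have "(\<lambda>i. (z i * Digamma (z i) ^ 2 * \<epsilon> i) * (Digamma (z i) ^ A / z i) * (1 / Digamma (z i)) ^ 2) \<longlonglongrightarrow> \<kappa> * 0 * 0 ^ 2"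
    by (intro tendsto_mult tendsto_power \<kappa> Digamma_power_over_z inverse_Digamma)
  moreover have "eventually (\<lambda>i. (z i * Digamma (z i) ^ 2 * \<epsilon> i) * (Digamma (z i) ^ A / z i) * (1 / Digamma (z i)) ^ 2 =
      Digamma (z i) ^ A * \<epsilon> i) sequentially"
    using Digamma_nz by eventually_elim (simp add: nz power_divide)
  ultimately show ?thesis by (simp add: tendsto_cong)
qed

text \<open>1/\<epsilon>^B grows like (z \<psi>^2)^B, which the decay of \<Gamma> overcomes; one
  additional factor z serves to kill the power of \<psi>.\<close>

lemma Gamma_over_small_scale:
  assumes \<kappa>: "(\<lambda>i. z i * Digamma (z i) ^ 2 * \<epsilon> i) \<longlonglongrightarrow> \<kappa>" "\<kappa> \<noteq> 0"
  shows "eventually (\<lambda>i. \<epsilon> i \<noteq> 0) sequentially"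
    and "(\<lambda>i. Gamma (z i) * Digamma (z i) ^ A / \<epsilon> i ^ B) \<longlonglongrightarrow> 0"
proof -
  have ev: "eventually (\<lambda>i. z i * Digamma (z i) ^ 2 * \<epsilon> i \<noteq> 0) sequentially"
    using tendsto_imp_eventually_ne[OF \<kappa>] .
  thus "eventually (\<lambda>i. \<epsilon> i \<noteq> 0) sequentially" by eventually_elim auto
  have "(\<lambda>i. (Gamma (z i) * z i ^ Suc B) * (Digamma (z i) ^ (A + 2 * B) / z i) / (z i * Digamma (z i) ^ 2 * \<epsilon> i) ^ B) \<longlonglongrightarrow> 0 * 0 / \<kappa> ^ B"
    by (intro tendsto_mult tendsto_power tendsto_divide \<kappa> Gamma_times_power Digamma_power_over_z) (use \<kappa> in auto)
  moreover have "eventually (\<lambda>i. (Gamma (z i) * z i ^ Suc B) * (Digamma (z i) ^ (A + 2 * B) / z i) / (z i * Digamma (z i) ^ 2 * \<epsilon> i) ^ B =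
      Gamma (z i) * Digamma (z i) ^ A / \<epsilon> i ^ B) sequentially"
    using Digamma_nz by eventually_elim (simp add: nz power_add power_mult power_mult_distrib)
  ultimately show "(\<lambda>i. Gamma (z i) * Digamma (z i) ^ A / \<epsilon> i ^ B) \<longlonglongrightarrow> 0" by (simp add: tendsto_cong)
qed

text \<open>\<open>small_scale\<close> permits \<kappa> = 0, so the orders n < 2 are
  included.\<close>

lemma higher_deriv_Gamma_ratio:
  "(\<lambda>i. (deriv ^^ n) Gamma (z i) / (Gamma (z i) * Digamma (z i) ^ n)) \<longlonglongrightarrow> 1"
  using small_scale[OF higher_deriv_Gamma_asymp[of n], of 0] by (simp add: LIM_zero_iff)

end

lemma tendsto_fun_componentwise:
  fixes f :: "'a \<Rightarrow> 'i \<Rightarrow> 'b :: topological_space"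
  assumes "\<And>j. ((\<lambda>i. f i j) \<longlongrightarrow> l j) G"
  shows "(f \<longlongrightarrow> l) G"
proof -
  have "limitin (product_topology (\<lambda>_. euclidean) UNIV) f l G"
    unfolding limitin_componentwise using assms by auto
  thus ?thesis by (simp add: euclidean_product_topology)
qed

text \<open>For n = 1 the indices 1 and n coincide and \<open>tup_star\<close> counts that entry
  twice, so the identity needs n >= 2.\<close>

lemma index_sum_eq:
  assumes "n \<ge> 2"
  shows "(\<Sum>i\<le>n. i * l i) = tup_star n l + tup_chi n l"
proof -
  have "{..n} = insert 0 (insert 1 (insert n {2..<n}))" using assms by auto
  thus ?thesis using assms by (simp add: tup_star_def tup_chi_def)
qed

text \<open>Condition (ii) makes \<open>|\<lambda>|\<^sup>\<star> + \<chi>(|\<lambda>|\<^sup>\<star>)\<close> strictly increasing in \<open>|\<lambda>|\<^sup>\<star>\<close>, so it determines \<open>|\<lambda>|\<^sup>\<star>\<close>.\<close>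

lemma in_family_class:
  assumes "in_family m n Lam Fc" "n \<ge> 2" "l \<in> Lam" "l' \<in> Lam"
    and "tup_abs n l = tup_abs n l'" "(\<Sum>i\<le>n. i * l i) = (\<Sum>i\<le>n. i * l' i)"
  shows "tup_star n l = tup_star n l'" "\<And>j. j \<in> {2..<n} \<Longrightarrow> l j = l' j"
proof -
  have chi: "tup_chi n l \<le> tup_chi n \<mu>"
    if "l \<in> Lam" "\<mu> \<in> Lam" "tup_abs n l = tup_abs n \<mu>" "tup_star n l \<le> tup_star n \<mu>" for l \<mu>
    using assms(1) that unfolding in_family_def by blast
  show star: "tup_star n l = tup_star n l'"
    using chi[of l l'] chi[of l' l] assms(3-6) unfolding index_sum_eq[OF assms(2)] by linarith
  show "l j = l' j" if "j \<in> {2..<n}" for j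
    using assms(1,3-5) star that unfolding in_family_def by blast
qed

text \<open>For n >= 2 the value of \<open>tup_star\<close> together with the entry n fixes the
  entry 1; for n = 1 the weighted sum is that entry itself. The entry 0 is what remains of
  \<open>tup_abs\<close>.\<close>

lemma in_family_inj:
  assumes fam: "in_family m n Lam Fc" and n: "n \<ge> 1" and l: "l \<in> Lam" "l' \<in> Lam"
    and eq: "tup_abs n l = tup_abs n l'" "(\<Sum>i\<le>n. i * l i) = (\<Sum>i\<le>n. i * l' i)"
    and k: "n \<noteq> 1 \<Longrightarrow> l n = l' n"
  shows "l = l'"
proof -
  have pos: "l j = l' j" if j: "1 \<le> j" "j \<le> n" for j
  proof (cases "n = 1")
    case True
    thus ?thesis using eq(2) j by simp
  next
    case False
    hence n2: "n \<ge> 2" using n by simp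
    note cl = in_family_class[OF fam n2 l eq]
    consider "j = 1" | "j \<in> {2..<n}" | "j = n" using j by force
    thus ?thesis using cl k False by cases (auto simp: tup_star_def)
  qed
  have "l 0 + (\<Sum>j\<in>{1..n}. l j) = l' 0 + (\<Sum>j\<in>{1..n}. l' j)"
    using eq(1) by (simp add: tup_abs_def atMost_atLeast0 sum.atLeast_Suc_atMost)
  moreover have "(\<Sum>j\<in>{1..n}. l j) = (\<Sum>j\<in>{1..n}. l' j)"
    by (intro sum.cong) (use pos in auto)
  ultimately have "l 0 = l' 0" by simp
  moreover have "l j = 0" "l' j = 0" if "j > n" for j
    using fam l that unfolding in_family_def by blast+
  ultimately show ?thesis
    using pos by (intro ext) (metis leI less_one not_less)
qed

theorem theorem1:
  fixes m n :: nat and Lam :: "(nat \<Rightarrow> nat) set"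
    and Fc :: "(nat \<Rightarrow> nat) \<Rightarrow> (nat \<Rightarrow> complex) \<Rightarrow> complex"
  assumes "n \<ge> 1"
    and "in_family m n Lam Fc"
    and "\<forall>z::complex. z \<noteq> 1 \<and> z \<notin> \<int>\<^sub>\<le>\<^sub>0 \<longrightarrow>
           family_eval n Lam Fc (\<lambda>j. (deriv ^^ j) riemann_zeta z) (\<lambda>i. (deriv ^^ i) Gamma z) = 0"
  shows "\<forall>l\<in>Lam. \<forall>u. Fc l u = 0"
proof -
  note fam = assms(2)
  define a where "a l = (\<Sum>i\<le>n. i * l i)" for l :: "nat \<Rightarrow> nat"
  define k where "k l = (if n = 1 then 0 else l n)" for l :: "nat \<Rightarrow> nat"
  interpret elimination Lam Fc "tup_abs n" a k
  proof
    show "finite Lam" using fam by (simp add: in_family_def)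
    show "l = l'" if "l \<in> Lam" "l' \<in> Lam" "tup_abs n l = tup_abs n l'" "a l = a l'" "k l = k l'" for l l'
      by (rule in_family_inj[OF fam assms(1) that(1-3)]) (use that(4,5) in \<open>auto simp: a_def k_def split: if_splits\<close>)
    fix u :: "nat \<Rightarrow> complex"
    have "\<forall>i. \<exists>z. 1 < Re z \<and> Re z \<le> 2 \<and> \<bar>Im z\<bar> \<ge> real i \<and>
        (\<forall>j\<le>m. norm ((deriv ^^ j) riemann_zeta z - u j) < inverse (real (Suc i)))"
      by (intro allI zeta_jets_dense) simp
    then obtain z where z: "\<And>i. 1 < Re (z i)" "\<And>i. Re (z i) \<le> 2" "\<And>i. \<bar>Im (z i)\<bar> \<ge> real i"
      "\<And>i j. j \<le> m \<Longrightarrow> norm ((deriv ^^ j) riemann_zeta (z i) - u j) < inverse (real (Suc i))"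
      by metis
    interpret strip_sequence z
    proof
      show "filterlim (\<lambda>i. norm (z i)) at_top sequentially"
      proof (rule filterlim_at_top_mono[OF filterlim_real_sequentially], intro always_eventually allI)
        fix i show "real i \<le> norm (z i)" using z(3)[of i] abs_Im_le_cmod[of "z i"] by linarith
      qed
    qed (use z in \<open>auto intro: less_imp_le\<close>)
    define v where "v i j = (deriv ^^ j) riemann_zeta (z i)" for i j
    \<comment> \<open>Derivatives of order above m are not controlled, so these coordinates are
      frozen at those of u. \<open>Fc\<close> does not see them, and convergence then holds in the
      product topology, in which \<open>Fc\<close> is continuous.\<close>
    define v' where "v' i j = (if j \<le> m then v i j else u j)" for i j
    have "v' \<longlonglongrightarrow> u"
    proof (rule tendsto_fun_componentwise)
      fix j
      show "(\<lambda>i. v' i j) \<longlonglongrightarrow> u j"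
      proof (cases "j \<le> m")
        case True
        have "(\<lambda>i. v i j - u j) \<longlonglongrightarrow> 0"
          by (rule Lim_null_comparison[OF _ LIMSEQ_inverse_real_of_nat])
             (use z(4)[OF True] in \<open>auto intro!: always_eventually less_imp_le simp: v_def simp del: of_nat_Suc\<close>)
        thus ?thesis using True by (simp add: v'_def LIM_zero_iff)
      qed (simp add: v'_def)
    qed
    have F_lim: "(\<lambda>i. Fc l (v i)) \<longlonglongrightarrow> Fc l u" if l: "l \<in> Lam" for l
    proof -
      have dep: "Fc l (v i) = Fc l (v' i)" for i
      proof -
        have "\<forall>j\<le>m. v i j = v' i j" by (simp add: v'_def)
        thus ?thesis using fam l unfolding in_family_def by blast
      qed
      have "continuous_on UNIV (Fc l)" using fam l by (simp add: in_family_def)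
      hence "isCont (Fc l) u" by (simp add: continuous_on_eq_continuous_at)
      from isCont_tendsto_compose[OF this \<open>v' \<longlonglongrightarrow> u\<close>] show ?thesis unfolding dep .
    qed
    define e where "e j i = (deriv ^^ j) Gamma (z i) / (Gamma (z i) * Digamma (z i) ^ j)" for j i
    \<comment> \<open>For \<open>n = 1\<close> the factor \<open>(1 + \<epsilon>)\<^sup>k\<close> is absent (\<open>k = 0\<close>), and any \<open>\<epsilon>\<close> of the right size serves.\<close>
    define \<epsilon> where "\<epsilon> i = (if n = 1 then 1 / (z i * Digamma (z i) ^ 2) else e n i - 1)" for i
    obtain \<kappa> where \<kappa>: "(\<lambda>i. z i * Digamma (z i) ^ 2 * \<epsilon> i) \<longlonglongrightarrow> \<kappa>" "\<kappa> \<noteq> 0"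
    proof (cases "n = 1")
      case True
      have "eventually (\<lambda>i. z i * Digamma (z i) ^ 2 * \<epsilon> i = 1) sequentially"
        using Digamma_nz by eventually_elim (simp add: \<epsilon>_def True nz)
      thus ?thesis using that[of 1] tendsto_eventually by fastforce
    next
      case False
      hence "n choose 2 \<noteq> 0" using assms(1) by auto
      thus ?thesis using that[of "of_nat (n choose 2)"] higher_deriv_Gamma_asymp[of n] False
        by (simp add: \<epsilon>_def e_def)
    qed
    \<comment> \<open>\<open>c\<close> must be a function of (p, a), so a representative of the
      class is chosen; by \<open>in_family_class\<close> its entries of index 2 to n - 1 do not
      depend on the choice.\<close>
    define rep where "rep y = (SOME l. l \<in> Lam \<and> (tup_abs n l, a l) = y)" for y
    define c where "c y i = (\<Prod>j\<in>{2..<n}. e j i ^ rep y j)" for y i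
    have rep: "rep (tup_abs n l, a l) j = l j" if l: "l \<in> Lam" and j: "j \<in> {2..<n}" for l j
    proof -
      have "rep (tup_abs n l, a l) \<in> Lam \<and> (tup_abs n (rep (tup_abs n l, a l)), a (rep (tup_abs n l, a l))) = (tup_abs n l, a l)"
        unfolding rep_def by (rule someI[of _ l]) (use l in auto)
      thus ?thesis
        using j by (intro in_family_class(2)[OF fam _ _ l]) (auto simp: a_def)
    qed
    have "(\<lambda>i. c y i) \<longlonglongrightarrow> (\<Prod>j\<in>{2..<n}. 1 ^ rep y j)" for y
      unfolding c_def e_def by (intro tendsto_prod tendsto_power higher_deriv_Gamma_ratio)
    hence c_lim: "c y \<longlonglongrightarrow> 1" for y by simp
    have prod_eq: "(\<Prod>j\<le>n. (deriv ^^ j) Gamma (z i) ^ l j) =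
        Gamma (z i) ^ tup_abs n l * Digamma (z i) ^ a l * c (tup_abs n l, a l) i * (1 + \<epsilon> i) ^ k l"
      if l: "l \<in> Lam" and \<psi>: "Digamma (z i) \<noteq> 0" for l i
    proof -
      \<comment> \<open>\<Gamma>' = \<Gamma> \<psi> holds exactly, so the factors of index 0 and 1
        produce no correction.\<close>
      have e01: "e 0 i = 1" "e (Suc 0) i = 1"
        using \<psi> Gamma_nz[of i] DERIV_imp_deriv[OF has_field_derivative_Gamma[OF not_nonpos[of i], of UNIV]]
        by (auto simp: e_def)
      have "(\<Prod>j\<le>n. (deriv ^^ j) Gamma (z i) ^ l j) = (\<Prod>j\<le>n. Gamma (z i) ^ l j * Digamma (z i) ^ (j * l j) * e j i ^ l j)"
        using \<psi> Gamma_nz[of i] by (intro prod.cong refl) (simp add: e_def power_mult power_divide power_mult_distrib)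
      also have "\<dots> = Gamma (z i) ^ tup_abs n l * Digamma (z i) ^ a l * (\<Prod>j\<le>n. e j i ^ l j)"
        by (simp add: prod.distrib power_sum tup_abs_def a_def)
      also have "(\<Prod>j\<le>n. e j i ^ l j) = c (tup_abs n l, a l) i * (1 + \<epsilon> i) ^ k l"
      proof (cases "n = 1")
        case True
        thus ?thesis by (simp add: e01 c_def k_def)
      next
        case False
        hence "{..n} = insert 0 (insert 1 (insert n {2..<n}))" "n \<ge> 2" using assms(1) by auto
        hence "(\<Prod>j\<le>n. e j i ^ l j) = e n i ^ l n * (\<Prod>j\<in>{2..<n}. e j i ^ l j)"
          by (simp add: e01)
        also have "(\<Prod>j\<in>{2..<n}. e j i ^ l j) = c (tup_abs n l, a l) i"
          unfolding c_def by (intro prod.cong) (use rep[OF l] in auto)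
        finally show ?thesis using False by (simp add: \<epsilon>_def k_def)
      qed
      finally show ?thesis by (simp add: mult_ac)
    qed
    have "eventually (\<lambda>i. (\<Sum>l\<in>Lam. Fc l (v i) * (Gamma (z i) ^ tup_abs n l * Digamma (z i) ^ a l *
        c (tup_abs n l, a l) i * (1 + \<epsilon> i) ^ k l)) = 0) sequentially"
      using Digamma_nz
    proof eventually_elim
      case (elim i)
      have "z i \<noteq> 1" using z(1)[of i] by auto
      hence "family_eval n Lam Fc (v i) (\<lambda>j. (deriv ^^ j) Gamma (z i)) = 0"
        using assms(3) not_nonpos[of i] by (simp add: v_def[abs_def])
      thus ?case by (simp add: family_eval_def prod_eq elim)
    qed
    thus "\<exists>v \<gamma> \<psi> \<epsilon> c. (\<forall>l\<in>Lam. (\<lambda>i. Fc l (v i)) \<longlonglongrightarrow> Fc l u) \<and>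
       eventually (\<lambda>i. \<gamma> i \<noteq> 0) sequentially \<and> eventually (\<lambda>i. \<epsilon> i \<noteq> 0) sequentially \<and>
       filterlim (\<lambda>i. norm (\<psi> i)) at_top sequentially \<and>
       (\<forall>A. (\<lambda>i. \<psi> i ^ A * \<epsilon> i) \<longlonglongrightarrow> 0) \<and>
       (\<forall>A B. (\<lambda>i. \<gamma> i * \<psi> i ^ A / \<epsilon> i ^ B) \<longlonglongrightarrow> 0) \<and>
       (\<forall>l\<in>Lam. c (tup_abs n l, a l) \<longlonglongrightarrow> 1) \<and>
       eventually (\<lambda>i. (\<Sum>l\<in>Lam. Fc l (v i) * (\<gamma> i ^ tup_abs n l * \<psi> i ^ a l *
         c (tup_abs n l, a l) i * (1 + \<epsilon> i) ^ k l)) = 0) sequentially"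
      by (intro exI[of _ v] exI[of _ "\<lambda>i. Gamma (z i)"] exI[of _ "\<lambda>i. Digamma (z i)"] exI[of _ \<epsilon>] exI[of _ c] conjI ballI allI
            F_lim c_lim Digamma_at_top small_scale[OF \<kappa>(1)] Gamma_over_small_scale[OF \<kappa>])
         (auto simp: Gamma_nz)
  qed
  show ?thesis using eliminate by blast
qed

end
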